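(* Let $\Phi$ be an irreducible reduced root system in a Euclidean space $E$ with a basis $\Delta$, and let $\omega\in\Omega$, where $\Omega$ is the subgroup of the Weyl group of $\Phi$ defined in the context. Then $\Phi_{\mathrm{re}}^\omega=\{\beta^\omega : \beta\in\Phi,\ \beta^\omega\neq 0\}$ is an irreducible root system (not necessarily reduced) in the fixed subspace $E^\omega$, and $$\Delta^\omega=\{\alpha^\omega : \alpha\in\Delta,\ \omega^t(\alpha)\neq\alpha_0 \text{ for all } t\in\mathbb{Z}\}$$ is a basis of $\Phi_{\mathrm{re}}^\omega$.
   Context: Root systems: for nonzero $\alpha$ in a Euclidean space $E$ with inner product $(\cdot,\cdot)$ put $\alpha^\vee=2\alpha/(\alpha,\alpha)$ and $s_\alpha(x)=x-(\alpha^\vee,x)\alpha$. A subset $\Phi\subseteq E$ is a root system in $E$ if $\Phi$ is finite, does not contain $0$, spans $E$, and $s_\alpha(\beta)\in\Phi$, $(\alpha^\vee,\beta)\in\mathbb{Z}$ for all $\alpha,\beta\in\Phi$. The empty set is a root system in $\{0\}$. A root system $\Phi$ in $E$ is reducible if $\Phi=\Phi_1\sqcup\Phi_2$ and $E=E_1\oplus E_2$ with $\Phi_i$ a root system in $E_i\neq\{0\}$ for $i=1,2$; it is irreducible if it is not reducible. A root $\alpha$ is indivisible if $\frac12\alpha\notin\Phi$; $\Phi$ is reduced if all roots are indivisible. A basis of a root system $\Phi$ in $E$ is a subset of $\Phi$ that is a vector space basis of $E$, such that every root is a linear combination of it with integer coefficients that are all non-negative or all non-positive, and all of whose elements are indivisible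 roots. Setting: $\Phi$ is irreducible and reduced, with basis $\Delta=\{\alpha_1,\dots,\alpha_\ell\}$ and Weyl group $W$ (generated by all $s_\alpha$, $\alpha\in\Phi$). The highest root is $\tilde\alpha=\sum_{i=1}^\ell n_i\alpha_i$; put $\alpha_0=-\tilde\alpha$, $n_0=1$, $I=\{0,\dots,\ell\}$, $\Delta_0=\{\alpha_0,\dots,\alpha_\ell\}$ and $J=\{i\in I: n_i=1\}$. For $j\in J$ let $w_j$ be the longest element of the subgroup of $W$ generated by the $s_{\alpha_i}$ with $i\in\{1,\dots,\ell\}\setminus\{j\}$ (so $w_0$ is the longest element of $W$), and let $\omega_j=w_jw_0$. Then $\Omega=\{\omega_j: j\in J\}$ is a subgroup of $W$ which permutes $\Delta_0$. For $\omega\in\Omega$ with order $o(\omega)$ and $x\in E$ put $x^\omega=\frac{1}{o(\omega)}\sum_{t=1}^{o(\omega)}\omega^t(x)$, and let $E^\omega=\{x\in E:\omega(x)=x\}$. *)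

theory Defs
  imports
    "HOL-Analysis.Analysis"
    "HOL-Algebra.Bij"
    "HOL-Algebra.Generated_Groups"
    "HOL-Algebra.Multiplicative_Group"
begin

text \<open>
  A Euclidean space \<open>E\<close> is represented as a subspace of an ambient type of class
  \<open>euclidean_space\<close>, with the induced inner product. This allows \<open>E = {0}\<close>, and allows fixed
  subspaces to carry root systems themselves. Reflections are functions on the ambient type;
  since they fix the orthogonal complement of \<open>span \<Phi>\<close> pointwise, the groups that they generate,
  word lengths and orders of elements are the same as for their restrictions to \<open>E\<close>.
\<close>

definition coroot :: "'a::euclidean_space \<Rightarrow> 'a" where
  "coroot \<alpha> = (2 / (\<alpha> \<bullet> \<alpha>)) *\<^sub>R \<alpha>"

definition root_reflection :: "'a::euclidean_space \<Rightarrow> 'a \<Rightarrow> 'a" where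
  "root_reflection \<alpha> x = x - (coroot \<alpha> \<bullet> x) *\<^sub>R \<alpha>"

text \<open>The condition \<open>span \<Phi> = E\<close> includes that \<open>E\<close> is a subspace.\<close>

definition root_system :: "'a::euclidean_space set \<Rightarrow> 'a set \<Rightarrow> bool" where
  "root_system E \<Phi> \<longleftrightarrow>
     finite \<Phi> \<and> 0 \<notin> \<Phi> \<and> span \<Phi> = E \<and>
     (\<forall>\<alpha>\<in>\<Phi>. \<forall>\<beta>\<in>\<Phi>. root_reflection \<alpha> \<beta> \<in> \<Phi> \<and> coroot \<alpha> \<bullet> \<beta> \<in> \<int>)"

definition reducible_root_system :: "'a::euclidean_space set \<Rightarrow> 'a set \<Rightarrow> bool" where
  "reducible_root_system E \<Phi> \<longleftrightarrow>
     (\<exists>\<Phi>1 \<Phi>2 E1 E2.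
        \<Phi> = \<Phi>1 \<union> \<Phi>2 \<and> \<Phi>1 \<inter> \<Phi>2 = {} \<and>
        E = {x + y | x y. x \<in> E1 \<and> y \<in> E2} \<and> E1 \<inter> E2 = {0} \<and>
        E1 \<noteq> {0} \<and> E2 \<noteq> {0} \<and>
        root_system E1 \<Phi>1 \<and> root_system E2 \<Phi>2)"

definition irreducible_root_system :: "'a::euclidean_space set \<Rightarrow> 'a set \<Rightarrow> bool" where
  "irreducible_root_system E \<Phi> \<longleftrightarrow> root_system E \<Phi> \<and> \<not> reducible_root_system E \<Phi>"

definition indivisible_root :: "'a::euclidean_space set \<Rightarrow> 'a \<Rightarrow> bool" where
  "indivisible_root \<Phi> \<alpha> \<longleftrightarrow> \<alpha> \<in> \<Phi> \<and> (1/2) *\<^sub>R \<alpha> \<notin> \<Phi>"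

definition reduced_roots :: "'a::euclidean_space set \<Rightarrow> bool" where
  "reduced_roots \<Phi> \<longleftrightarrow> (\<forall>\<alpha>\<in>\<Phi>. indivisible_root \<Phi> \<alpha>)"

definition root_basis :: "'a::euclidean_space set \<Rightarrow> 'a set \<Rightarrow> 'a set \<Rightarrow> bool" where
  "root_basis E \<Phi> \<Delta> \<longleftrightarrow>
     \<Delta> \<subseteq> \<Phi> \<and> independent \<Delta> \<and> span \<Delta> = E \<and>
     (\<forall>\<beta>\<in>\<Phi>. \<exists>c :: 'a \<Rightarrow> int.
        \<beta> = (\<Sum>\<alpha>\<in>\<Delta>. of_int (c \<alpha>) *\<^sub>R \<alpha>) \<and>
        ((\<forall>\<alpha>\<in>\<Delta>. c \<alpha> \<ge> 0) \<or> (\<forall>\<alpha>\<in>\<Delta>. c \<alpha> \<le> 0))) \<and>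
     (\<forall>\<alpha>\<in>\<Delta>. indivisible_root \<Phi> \<alpha>)"

text \<open>
  The highest root: the unique root from which every root is obtained by subtracting a
  combination of \<open>\<Delta>\<close> with non-negative integer coefficients. (If \<open>\<Phi>\<close> is empty there is none, the
  value is arbitrary, and \<open>Omega\<close> below is the trivial group whatever the value is.)
\<close>

definition highest_root :: "'a::euclidean_space set \<Rightarrow> 'a set \<Rightarrow> 'a" where
  "highest_root \<Phi> \<Delta> =
     (THE \<theta>. \<theta> \<in> \<Phi> \<and>
        (\<forall>\<beta>\<in>\<Phi>. \<exists>c :: 'a \<Rightarrow> nat. \<theta> - \<beta> = (\<Sum>\<alpha>\<in>\<Delta>. of_nat (c \<alpha>) *\<^sub>R \<alpha>)))"

definition affine_root :: "'a::euclidean_space set \<Rightarrow> 'a set \<Rightarrow> 'a" where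
  "affine_root \<Phi> \<Delta> = - highest_root \<Phi> \<Delta>"

text \<open>
  The elements of \<open>\<Delta>\<^sub>0 = insert (affine_root \<Phi> \<Delta>) \<Delta>\<close> themselves serve as indices: \<open>\<alpha>\<^sub>i\<close> stands for
  \<open>i\<close>, and \<open>affine_root \<Phi> \<Delta>\<close>, which is not in \<open>\<Delta>\<close>, stands for \<open>0\<close>. Thus \<open>mark \<Phi> \<Delta> \<alpha>\<^sub>i\<close> is \<open>n\<^sub>i\<close>.
\<close>

definition mark :: "'a::euclidean_space set \<Rightarrow> 'a set \<Rightarrow> 'a \<Rightarrow> real" where
  "mark \<Phi> \<Delta> \<alpha> =
     (if \<alpha> = affine_root \<Phi> \<Delta> then 1 else representation \<Delta> (highest_root \<Phi> \<Delta>) \<alpha>)"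

definition special_nodes :: "'a::euclidean_space set \<Rightarrow> 'a set \<Rightarrow> 'a set" where
  "special_nodes \<Phi> \<Delta> = {\<alpha> \<in> insert (affine_root \<Phi> \<Delta>) \<Delta>. mark \<Phi> \<Delta> \<alpha> = 1}"

abbreviation perm_group :: "('a \<Rightarrow> 'a) monoid" where
  "perm_group \<equiv> BijGroup UNIV"

definition reflection_group :: "'a::euclidean_space set \<Rightarrow> ('a \<Rightarrow> 'a) set" where
  "reflection_group K = generate perm_group (root_reflection ` K)"

definition reflection_length :: "'a::euclidean_space set \<Rightarrow> ('a \<Rightarrow> 'a) \<Rightarrow> nat" where
  "reflection_length K w =
     (LEAST n. \<exists>as. length as = n \<and> set as \<subseteq> K \<and> w = foldr (\<circ>) (map root_reflection as) id)"

text \<open>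
  For \<open>K \<subseteq> \<Delta>\<close> the maximum is attained at exactly one element, and the length with respect to
  the reflections in \<open>K\<close> agrees on \<open>reflection_group K\<close> with the length with respect to those
  in \<open>\<Delta>\<close>.
\<close>

definition longest_element :: "'a::euclidean_space set \<Rightarrow> 'a \<Rightarrow> 'a" where
  "longest_element K = arg_max_on (reflection_length K) (reflection_group K)"

text \<open>
  Deleting \<open>affine_root \<Phi> \<Delta>\<close> from \<open>\<Delta>\<close> has no effect, so this choice of \<open>\<alpha>\<close> gives the identity
  \<open>w\<^sub>0 w\<^sub>0\<close>.
\<close>

definition Omega :: "'a::euclidean_space set \<Rightarrow> 'a set \<Rightarrow> ('a \<Rightarrow> 'a) set" where
  "Omega \<Phi> \<Delta> =
     {longest_element (\<Delta> - {\<alpha>}) \<circ> longest_element \<Delta> | \<alpha>. \<alpha> \<in> special_nodes \<Phi> \<Delta>}"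

definition orbit_average :: "('a::euclidean_space \<Rightarrow> 'a) \<Rightarrow> 'a \<Rightarrow> 'a" where
  "orbit_average \<omega> x =
     (let m = group.ord perm_group \<omega>
      in (1 / of_nat m) *\<^sub>R (\<Sum>t=1..m. (\<omega> [^]\<^bsub>perm_group\<^esub> t) x))"

definition fixed_space :: "'a::euclidean_space set \<Rightarrow> ('a \<Rightarrow> 'a) \<Rightarrow> 'a set" where
  "fixed_space E \<omega> = {x \<in> E. \<omega> x = x}"

definition folded_roots :: "'a::euclidean_space set \<Rightarrow> ('a \<Rightarrow> 'a) \<Rightarrow> 'a set" where
  "folded_roots \<Phi> \<omega> = {orbit_average \<omega> \<beta> | \<beta>. \<beta> \<in> \<Phi> \<and> orbit_average \<omega> \<beta> \<noteq> 0}"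

definition folded_basis ::
  "'a::euclidean_space set \<Rightarrow> 'a set \<Rightarrow> ('a \<Rightarrow> 'a) \<Rightarrow> 'a set" where
  "folded_basis \<Phi> \<Delta> \<omega> =
     {orbit_average \<omega> \<alpha> | \<alpha>.
        \<alpha> \<in> \<Delta> \<and> (\<forall>t::int. (\<omega> [^]\<^bsub>perm_group\<^esub> t) \<alpha> \<noteq> affine_root \<Phi> \<Delta>)}"

end

theory Submission
  imports Defs
begin

text \<open>
  Only three properties of \<open>\<omega>\<close> matter: it lies in the Weyl group, it permutes the extended basis
  \<open>\<Delta>\<^sub>0\<close>, and its order \<open>m\<close> is the length of the orbit of \<open>\<alpha>\<^sub>0\<close>. Let \<open>\<eta>\<close> be the sum of the
  fundamental coweights attached to the orbit of \<open>\<alpha>\<^sub>0\<close>. It is an integer of absolute value less than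
  \<open>m\<close> on every root, \<open>\<omega>\<close> preserves its values modulo \<open>m\<close>, it is orthogonal to the fixed space, and it
  does not vanish on roots that average to \<open>0\<close>. Hence two different roots of one orbit with
  non-zero average have non-positive inner product (else their difference contradicts the last property).
  So after replacing \<open>\<beta>\<close> by a sum \<open>\<beta> + \<gamma>\<close> if necessary, the orbit is orthogonal,
  and the reflection in \<open>\<beta>\<^sup>\<omega>\<close> is induced by the product of the commuting reflections in it.

  Integrality of the coefficients with respect to \<open>\<Delta>\<^sup>\<omega>\<close> means that \<open>m\<close> divides the total mark of each
  orbit in \<open>\<Delta>\<^sub>0\<close>. This holds because a non-zero minuscule coweight is not in the coroot lattice, and it
  implies that the elements of \<open>\<Delta>\<^sup>\<omega>\<close> are indivisible.

  If the coefficients of \<open>\<beta>\<^sup>\<omega>\<close> had different signs, then \<open>\<beta>\<close> would be orthogonal to a fixed vector \<open>x\<close> that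
  is positive on \<open>\<Delta>\<^sup>\<omega>\<close>. On the roots orthogonal to \<open>x\<close> the functional \<open>\<eta>\<close> is regular. As \<open>\<omega>\<close>
  is a product of reflections in such roots, it preserves their irreducible components. In the component of
  \<open>\<beta>\<close>, with highest root \<open>\<theta>\<close> with respect to \<open>\<eta>\<close>, the orbit of each simple root contains \<open>- \<theta>\<close>,
  since \<open>\<eta>\<close> cannot be positive on a whole orbit. So all simple roots have the average
  \<open>- \<theta>\<^sup>\<omega>\<close>, and \<open>\<theta>\<close> is a non-negative combination of them, which forces all these averages to be \<open>0\<close>.
\<close>

section \<open>Crystallographic root systems\<close>

lemma root_reflection_linear: "linear (root_reflection \<alpha>)"
  unfolding root_reflection_def
  by (rule linearI) (auto simp: algebra_simps inner_add_right)

lemma coroot_inner: "coroot \<alpha> \<bullet> x = 2 * (\<alpha> \<bullet> x) / (\<alpha> \<bullet> \<alpha>)"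
  by (simp add: coroot_def)

lemma root_reflection_self [simp]: "root_reflection \<alpha> \<alpha> = - \<alpha>"
proof (cases "\<alpha> = 0")
  case False
  then show ?thesis
    by (simp add: root_reflection_def coroot_inner scaleR_2)
qed (simp add: root_reflection_def)

lemma root_reflection_orthogonal: "\<alpha> \<bullet> x = 0 \<Longrightarrow> root_reflection \<alpha> x = x"
  by (simp add: root_reflection_def coroot_inner)

lemma root_reflection_inner [simp]: "root_reflection \<alpha> x \<bullet> root_reflection \<alpha> y = x \<bullet> y"
  by (cases "\<alpha> = 0")
     (simp_all add: root_reflection_def coroot_def inner_diff_left inner_diff_right
        inner_commute field_simps)

lemma root_reflection_inner_left: "root_reflection \<alpha> x \<bullet> y = x \<bullet> root_reflection \<alpha> y"
  by (simp add: root_reflection_def coroot_def inner_diff_left inner_diff_right inner_commute)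

text \<open>Reflections are self-adjoint isometries, so moving one factor across the inner product
  gives \<open>x \<bullet> y\<close> for every \<open>y\<close>; this covers
  \<open>\<alpha> = 0\<close> as well.\<close>

lemma root_reflection_involutive [simp]: "root_reflection \<alpha> (root_reflection \<alpha> x) = x"
proof -
  have "root_reflection \<alpha> (root_reflection \<alpha> x) \<bullet> y = x \<bullet> y" for y
    by (metis root_reflection_inner root_reflection_inner_left)
  then show ?thesis
    by (metis vector_eq_rdot)
qed

lemma root_reflection_comp [simp]: "root_reflection \<alpha> \<circ> root_reflection \<alpha> = id"
  by (simp add: fun_eq_iff)

lemma root_reflection_conj:
  assumes "linear g" and "\<And>x y. g x \<bullet> g y = x \<bullet> y"
  shows "root_reflection (g \<alpha>) (g x) = g (root_reflection \<alpha> x)"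
  using assms by (simp add: root_reflection_def coroot_inner linear_diff linear_cmul)

lemma root_reflection_scaleR: "c \<noteq> 0 \<Longrightarrow> root_reflection (c *\<^sub>R \<alpha>) = root_reflection \<alpha>"
  by (simp add: fun_eq_iff root_reflection_def coroot_inner)

text \<open>Irreducibility in a form that mentions roots only: there is no splitting into two
  orthogonal non-empty parts. It follows from the given notion by
  \<open>irreducible_imp_connected\<close> and holds for components by
  \<open>component_connected\<close>.\<close>

definition connected_roots :: "'a::euclidean_space set \<Rightarrow> bool" where
  "connected_roots \<Phi> \<longleftrightarrow>
     (\<forall>A\<subseteq>\<Phi>. A \<noteq> {} \<and> (\<forall>a\<in>A. \<forall>b\<in>\<Phi> - A. a \<bullet> b = 0) \<longrightarrow> A = \<Phi>)"

text \<open>In the applications \<open>x\<close> is the sum itself, a root written with non-negative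
  coefficients; the result is a simple root at an acute angle to it.\<close>

lemma inner_sum_pos_term:
  fixes x :: "'a::real_inner"
  assumes "x \<bullet> (\<Sum>a\<in>S. c a *\<^sub>R f a) > 0" and "\<And>a. a \<in> S \<Longrightarrow> c a \<ge> 0"
  obtains a where "a \<in> S" "c a > 0" "x \<bullet> f a > 0"
proof -
  have "\<exists>a\<in>S. c a * (x \<bullet> f a) > 0"
  proof (rule ccontr)
    assume "\<not> ?thesis"
    then have "(\<Sum>a\<in>S. c a * (x \<bullet> f a)) \<le> 0"
      by (intro sum_nonpos) force
    with assms(1) show False
      by (simp add: inner_sum_right)
  qed
  then show ?thesis
    using assms(2) that by (metis less_eq_real_def zero_less_mult_pos mult_zero_left less_irrefl)
qed

text \<open>The ambient space is left out so that the same facts serve subsystems of smaller span,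
  such as the roots orthogonal to a vector and their components.\<close>

locale crystallographic =
  fixes \<Phi> :: "'a::euclidean_space set"
  assumes finite_roots [simp]: "finite \<Phi>"
    and zero_not_root: "0 \<notin> \<Phi>"
    and reflection_closed: "\<alpha> \<in> \<Phi> \<Longrightarrow> \<beta> \<in> \<Phi> \<Longrightarrow> root_reflection \<alpha> \<beta> \<in> \<Phi>"
    and integral: "\<alpha> \<in> \<Phi> \<Longrightarrow> \<beta> \<in> \<Phi> \<Longrightarrow> coroot \<alpha> \<bullet> \<beta> \<in> \<int>"
begin

lemma root_nonzero: "\<alpha> \<in> \<Phi> \<Longrightarrow> \<alpha> \<noteq> 0"
  using zero_not_root by auto

lemma uminus_root: "\<alpha> \<in> \<Phi> \<Longrightarrow> - \<alpha> \<in> \<Phi>"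
  using reflection_closed[of \<alpha> \<alpha>] by simp

lemma uminus_root_iff [simp]: "- \<alpha> \<in> \<Phi> \<longleftrightarrow> \<alpha> \<in> \<Phi>"
  using uminus_root by fastforce

text \<open>Both coroot pairings are positive integers. If one of them is 1, a reflection produces
  the difference up to sign. If both are at least 2, then \<open>\<alpha> \<bullet> \<beta>\<close>
  is at least both squared norms, which forces the roots to coincide.\<close>

lemma diff_root:
  assumes "\<alpha> \<in> \<Phi>" "\<beta> \<in> \<Phi>" "\<alpha> \<bullet> \<beta> > 0" "\<alpha> \<noteq> \<beta>"
  shows "\<alpha> - \<beta> \<in> \<Phi>"
proof -
  have pos: "\<alpha> \<bullet> \<alpha> > 0" "\<beta> \<bullet> \<beta> > 0"
    using assms root_nonzero by auto
  obtain a b :: int where a: "coroot \<alpha> \<bullet> \<beta> = of_int a" and b: "coroot \<beta> \<bullet> \<alpha> = of_int b"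
    using integral assms by (metis Ints_cases)
  have "coroot \<alpha> \<bullet> \<beta> > 0" "coroot \<beta> \<bullet> \<alpha> > 0"
    using assms pos by (simp_all add: coroot_inner inner_commute[of \<beta> \<alpha>])
  then have ab0: "a > 0" "b > 0"
    using a b by auto
  show ?thesis
  proof (cases "a = 1 \<or> b = 1")
    case True
    then show ?thesis
    proof
      assume "a = 1"
      then have "\<beta> - \<alpha> \<in> \<Phi>"
        using reflection_closed[OF assms(1,2)] a by (simp add: root_reflection_def)
      then show ?thesis
        using uminus_root by fastforce
    next
      assume "b = 1"
      then show ?thesis
        using reflection_closed[OF assms(2,1)] b by (simp add: root_reflection_def)
    qed
  next
    case False
    with ab0 have "a \<ge> 2" "b \<ge> 2"
      by auto
    then have "real_of_int a \<ge> 2" "real_of_int b \<ge> 2"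
      by linarith+
    then have "2 * (\<alpha> \<bullet> \<alpha>) \<le> of_int a * (\<alpha> \<bullet> \<alpha>)" "2 * (\<beta> \<bullet> \<beta>) \<le> of_int b * (\<beta> \<bullet> \<beta>)"
      using pos by (auto intro!: mult_right_mono)
    moreover have "of_int a * (\<alpha> \<bullet> \<alpha>) = 2 * (\<alpha> \<bullet> \<beta>)" "of_int b * (\<beta> \<bullet> \<beta>) = 2 * (\<alpha> \<bullet> \<beta>)"
      using pos a[symmetric] b[symmetric] by (simp_all add: coroot_inner inner_commute[of \<beta> \<alpha>])
    ultimately have "\<alpha> \<bullet> \<beta> \<ge> \<alpha> \<bullet> \<alpha>" "\<alpha> \<bullet> \<beta> \<ge> \<beta> \<bullet> \<beta>"
      by simp_all
    then have "(\<alpha> - \<beta>) \<bullet> (\<alpha> - \<beta>) \<le> 0"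
      by (simp add: inner_diff_left inner_diff_right inner_commute)
    then have "\<alpha> = \<beta>"
      by (metis inner_ge_zero inner_eq_zero_iff order_antisym right_minus_eq)
    with assms show ?thesis by simp
  qed
qed

lemma sum_root:
  assumes "\<alpha> \<in> \<Phi>" "\<beta> \<in> \<Phi>" "\<alpha> \<bullet> \<beta> < 0" "\<alpha> \<noteq> - \<beta>"
  shows "\<alpha> + \<beta> \<in> \<Phi>"
  using diff_root[of \<alpha> "- \<beta>"] assms by simp

end

section \<open>Positive and simple roots of a regular functional\<close>

locale regular_functional = crystallographic \<Phi> for \<Phi> :: "'a::euclidean_space set" +
  fixes y :: 'a
  assumes regular: "\<beta> \<in> \<Phi> \<Longrightarrow> \<beta> \<bullet> y \<noteq> 0"
begin

definition pos_roots :: "'a set" where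
  "pos_roots = {\<beta> \<in> \<Phi>. \<beta> \<bullet> y > 0}"

text \<open>The indecomposable positive roots. They depend on \<open>y\<close> only: the theory is
  applied to \<open>rho\<close>, where a basis is given, and to \<open>eta\<close> on a component of
  a subsystem, where none is known beforehand.\<close>

definition simple_roots :: "'a set" where
  "simple_roots = {\<alpha> \<in> pos_roots. \<forall>\<beta>\<in>pos_roots. \<forall>\<gamma>\<in>pos_roots. \<alpha> \<noteq> \<beta> + \<gamma>}"

lemma finite_pos_roots [simp]: "finite pos_roots"
  by (simp add: pos_roots_def)

lemma finite_simple_roots [simp]: "finite simple_roots"
  by (simp add: simple_roots_def)

lemma pos_roots_root: "\<beta> \<in> pos_roots \<Longrightarrow> \<beta> \<in> \<Phi>"
  by (simp add: pos_roots_def)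

lemma simple_pos: "\<alpha> \<in> simple_roots \<Longrightarrow> \<alpha> \<in> pos_roots"
  by (simp add: simple_roots_def)

lemma pos_or_neg: "\<beta> \<in> \<Phi> \<Longrightarrow> \<beta> \<in> pos_roots \<or> - \<beta> \<in> pos_roots"
  using regular[of \<beta>] by (auto simp: pos_roots_def)

lemma pos_not_neg: "\<beta> \<in> pos_roots \<Longrightarrow> - \<beta> \<notin> pos_roots"
  by (auto simp: pos_roots_def)

text \<open>The values at \<open>y\<close> are real, but there are finitely many positive roots, so
  induction on the number of positive roots with a smaller value works.\<close>

lemma pos_induct [consumes 1, case_names less]:
  assumes "\<beta> \<in> pos_roots"
    and step: "\<And>\<beta>. \<beta> \<in> pos_roots \<Longrightarrow>
      (\<And>\<gamma>. \<gamma> \<in> pos_roots \<Longrightarrow> \<gamma> \<bullet> y < \<beta> \<bullet> y \<Longrightarrow> P \<gamma>) \<Longrightarrow> P \<beta>"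
  shows "P \<beta>"
  using assms(1)
proof (induction "card {\<gamma> \<in> pos_roots. \<gamma> \<bullet> y < \<beta> \<bullet> y}" arbitrary: \<beta> rule: less_induct)
  case less
  show ?case
  proof (rule step[OF less.prems])
    fix \<gamma> assume g: "\<gamma> \<in> pos_roots" "\<gamma> \<bullet> y < \<beta> \<bullet> y"
    have "{\<delta> \<in> pos_roots. \<delta> \<bullet> y < \<gamma> \<bullet> y} \<subset> {\<delta> \<in> pos_roots. \<delta> \<bullet> y < \<beta> \<bullet> y}"
      using g by force
    then show "P \<gamma>"
      by (intro less.hyps g psubset_card_mono) auto
  qed
qed

lemma pos_comb:
  assumes "\<beta> \<in> pos_roots"
  shows "\<exists>n::'a \<Rightarrow> nat. \<beta> = (\<Sum>\<alpha>\<in>simple_roots. of_nat (n \<alpha>) *\<^sub>R \<alpha>)"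
  using assms
proof (induction rule: pos_induct)
  case (less \<beta>)
  show ?case
  proof (cases "\<beta> \<in> simple_roots")
    case True
    then have "\<beta> = (\<Sum>\<alpha>\<in>simple_roots. of_nat (if \<alpha> = \<beta> then 1 else 0) *\<^sub>R \<alpha>)"
      by (simp add: if_distrib[of of_nat] if_distrib[of "\<lambda>c. c *\<^sub>R _"] sum.delta cong: if_cong)
    then show ?thesis by (rule exI[of _ "\<lambda>\<alpha>. if \<alpha> = \<beta> then 1 else 0"])
  next
    case False
    with less obtain \<gamma> \<delta> where gd: "\<gamma> \<in> pos_roots" "\<delta> \<in> pos_roots" "\<beta> = \<gamma> + \<delta>"
      by (auto simp: simple_roots_def)
    then have "\<gamma> \<bullet> y < \<beta> \<bullet> y" "\<delta> \<bullet> y < \<beta> \<bullet> y"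
      by (auto simp: pos_roots_def inner_add_left)
    with less.IH gd obtain m n :: "'a \<Rightarrow> nat" where
      "\<gamma> = (\<Sum>\<alpha>\<in>simple_roots. of_nat (m \<alpha>) *\<^sub>R \<alpha>)" "\<delta> = (\<Sum>\<alpha>\<in>simple_roots. of_nat (n \<alpha>) *\<^sub>R \<alpha>)"
      by blast
    with gd have "\<beta> = (\<Sum>\<alpha>\<in>simple_roots. of_nat (m \<alpha> + n \<alpha>) *\<^sub>R \<alpha>)"
      by (simp add: scaleR_add_left sum.distrib)
    then show ?thesis by (rule exI[of _ "\<lambda>\<alpha>. m \<alpha> + n \<alpha>"])
  qed
qed

text \<open>Otherwise \<open>\<alpha> - \<beta>\<close> is positive, and
  \<open>\<alpha> = (\<alpha> - \<beta>) + \<beta>\<close> decomposes a simple root.\<close>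

lemma diff_simple_pos:
  assumes "\<beta> \<in> pos_roots" "\<alpha> \<in> simple_roots" "\<beta> - \<alpha> \<in> \<Phi>"
  shows "\<beta> - \<alpha> \<in> pos_roots"
proof (rule ccontr)
  assume "\<beta> - \<alpha> \<notin> pos_roots"
  with pos_or_neg[OF assms(3)] have "\<alpha> - \<beta> \<in> pos_roots"
    by simp
  with assms show False
    unfolding simple_roots_def by (metis (mono_tags, lifting) diff_add_cancel mem_Collect_eq)
qed

lemma simple_obtuse:
  assumes "\<alpha> \<in> simple_roots" "\<beta> \<in> simple_roots" "\<alpha> \<noteq> \<beta>"
  shows "\<alpha> \<bullet> \<beta> \<le> 0"
proof (rule ccontr)
  assume "\<not> ?thesis"
  with assms have "\<alpha> - \<beta> \<in> \<Phi>"
    by (intro diff_root) (auto simp: simple_roots_def pos_roots_def)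
  then have d: "\<alpha> - \<beta> \<in> pos_roots"
    using diff_simple_pos assms simple_pos by blast
  have "\<alpha> = \<beta> + (\<alpha> - \<beta>)" by simp
  with d assms show False
    unfolding simple_roots_def by blast
qed

text \<open>As \<open>\<gamma>\<close> and \<open>\<alpha>\<close> are orthogonal, reflecting
  \<open>\<gamma> + \<alpha>\<close> in \<open>\<alpha>\<close> gives the root
  \<open>\<gamma> - \<alpha>\<close>, which is positive and smaller. Wherever the induction
  hypothesis puts it, one of \<open>\<gamma>\<close>, \<open>\<alpha>\<close> becomes orthogonal to
  itself.\<close>

lemma mixed_step:
  assumes "\<gamma> \<in> pos_roots" "\<alpha> \<in> simple_roots" "\<gamma> + \<alpha> \<in> \<Phi>"
    and orth: "\<And>u v. u \<in> span S \<Longrightarrow> v \<in> span T \<Longrightarrow> u \<bullet> v = 0"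
    and IH: "\<And>\<delta>. \<delta> \<in> pos_roots \<Longrightarrow> \<delta> \<bullet> y < \<gamma> \<bullet> y + \<alpha> \<bullet> y \<Longrightarrow> \<delta> \<in> span S \<or> \<delta> \<in> span T"
    and mem: "\<gamma> \<in> span S" "\<alpha> \<in> span T"
  shows False
proof -
  have ga: "\<gamma> \<bullet> \<alpha> = 0" using orth mem by blast
  have a: "\<alpha> \<in> \<Phi>" "\<alpha> \<bullet> y > 0" "\<alpha> \<noteq> 0" "\<gamma> \<noteq> 0"
    using assms simple_pos root_nonzero by (auto simp: pos_roots_def)
  have "root_reflection \<alpha> (\<gamma> + \<alpha>) = \<gamma> - \<alpha>"
    using ga by (simp add: linear_add[OF root_reflection_linear] root_reflection_orthogonal inner_commute)
  then have "\<gamma> - \<alpha> \<in> \<Phi>"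
    using reflection_closed[OF a(1) assms(3)] by simp
  then have "\<gamma> - \<alpha> \<in> pos_roots"
    using diff_simple_pos assms by blast
  moreover have "(\<gamma> - \<alpha>) \<bullet> y < \<gamma> \<bullet> y + \<alpha> \<bullet> y"
    using a by (simp add: inner_diff_left)
  ultimately have "\<gamma> - \<alpha> \<in> span S \<or> \<gamma> - \<alpha> \<in> span T"
    using IH by blast
  then show False
  proof
    assume "\<gamma> - \<alpha> \<in> span S"
    then have "\<gamma> - (\<gamma> - \<alpha>) \<in> span S" using mem span_diff by blast
    then have "\<alpha> \<bullet> \<alpha> = 0" using orth mem by simp
    with a show False by simp
  next
    assume "\<gamma> - \<alpha> \<in> span T"
    then have "(\<gamma> - \<alpha>) + \<alpha> \<in> span T" using mem span_add by blast
    then have "\<gamma> \<bullet> \<gamma> = 0" using orth mem by simp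
    with a show False by simp
  qed
qed

text \<open>Induction: subtract from \<open>\<beta>\<close> a simple root at an acute angle to it.
  The difference lies in one part, and \<open>mixed_step\<close>, applied in both orders of the
  parts, puts the subtracted simple root into the same part.\<close>

lemma pos_in_orthogonal_part:
  assumes "\<beta> \<in> pos_roots" and ST: "S \<union> T = simple_roots"
    and orth: "\<And>u v. u \<in> S \<Longrightarrow> v \<in> T \<Longrightarrow> u \<bullet> v = 0"
  shows "\<beta> \<in> span S \<or> \<beta> \<in> span T"
  using assms(1)
proof (induction rule: pos_induct)
  case (less \<beta>)
  have o1: "u \<bullet> v = 0" if "u \<in> span S" "v \<in> span T" for u v
    using orthogonal_to_span[of _ T u] orthogonal_to_span[of _ S] orth that
    by (metis orthogonal_commute orthogonal_def)
  then have o2: "u \<bullet> v = 0" if "u \<in> span T" "v \<in> span S" for u v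
    using that by (metis inner_commute)
  show ?case
  proof (cases "\<beta> \<in> simple_roots")
    case True
    then show ?thesis using ST span_base by blast
  next
    case False
    obtain n :: "'a \<Rightarrow> nat" where n: "\<beta> = (\<Sum>\<alpha>\<in>simple_roots. of_nat (n \<alpha>) *\<^sub>R \<alpha>)"
      using pos_comb less by blast
    have "\<beta> \<bullet> \<beta> > 0"
      using less.hyps root_nonzero pos_roots_root by auto
    then have "\<beta> \<bullet> (\<Sum>\<alpha>\<in>simple_roots. of_nat (n \<alpha>) *\<^sub>R \<alpha>) > 0"
      using n by metis
    then obtain \<alpha> where a: "\<alpha> \<in> simple_roots" "\<beta> \<bullet> \<alpha> > 0"
      by (rule inner_sum_pos_term) auto
    have "\<beta> \<noteq> \<alpha>" using a False by blast
    then have "\<beta> - \<alpha> \<in> \<Phi>"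
      using a less.hyps diff_root simple_pos pos_roots_root by blast
    then have g: "\<beta> - \<alpha> \<in> pos_roots"
      using diff_simple_pos less.hyps a by blast
    have ay: "\<alpha> \<bullet> y > 0"
      using a simple_pos by (auto simp: pos_roots_def)
    then have gST: "\<beta> - \<alpha> \<in> span S \<or> \<beta> - \<alpha> \<in> span T"
      using less.IH[OF g] by (simp add: inner_diff_left)
    have b: "(\<beta> - \<alpha>) + \<alpha> \<in> \<Phi>" "(\<beta> - \<alpha>) \<bullet> y + \<alpha> \<bullet> y = \<beta> \<bullet> y"
      using less.hyps by (auto simp: pos_roots_root inner_diff_left)
    have aST: "\<alpha> \<in> span S \<or> \<alpha> \<in> span T"
      using a ST span_base by blast
    have n1: False if "\<beta> - \<alpha> \<in> span S" "\<alpha> \<in> span T"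
      by (rule mixed_step[OF g a(1) b(1) o1 _ that]) (use less.IH b(2) in auto)
    have n2: False if "\<beta> - \<alpha> \<in> span T" "\<alpha> \<in> span S"
      by (rule mixed_step[OF g a(1) b(1) o2 _ that]) (use less.IH b(2) in auto)
    have "\<beta> = (\<beta> - \<alpha>) + \<alpha>" by simp
    then show ?thesis
      using gST aST n1 n2 span_add by metis
  qed
qed

section \<open>Maximal roots of a connected system\<close>

definition maximal_root :: "'a \<Rightarrow> bool" where
  "maximal_root \<beta> \<longleftrightarrow> \<beta> \<in> pos_roots \<and> (\<forall>\<gamma>\<in>pos_roots. \<beta> + \<gamma> \<notin> \<Phi>)"

lemma maximal_dominant:
  assumes "maximal_root \<beta>" "\<gamma> \<in> pos_roots"
  shows "\<beta> \<bullet> \<gamma> \<ge> 0"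
proof (rule ccontr)
  assume "\<not> ?thesis"
  moreover have "\<beta> \<noteq> - \<gamma>"
    using assms pos_not_neg[of \<gamma>] by (auto simp: maximal_root_def)
  ultimately have "\<beta> + \<gamma> \<in> \<Phi>"
    using assms by (intro sum_root) (auto simp: maximal_root_def pos_roots_root)
  with assms show False by (auto simp: maximal_root_def)
qed

text \<open>A simple root outside the support pairs non-negatively with \<open>\<beta>\<close> by
  dominance, but non-positively with each term of \<open>\<beta>\<close>, so it is orthogonal to the
  support. The system then splits orthogonally, and connectedness leaves nothing outside the
  support.\<close>

lemma maximal_full_support:
  assumes conn: "connected_roots \<Phi>" and max: "maximal_root \<beta>"
  shows "\<exists>n::'a \<Rightarrow> nat. \<beta> = (\<Sum>\<alpha>\<in>simple_roots. of_nat (n \<alpha>) *\<^sub>R \<alpha>) \<and> (\<forall>\<alpha>\<in>simple_roots. n \<alpha> > 0)"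
proof -
  have bp: "\<beta> \<in> pos_roots" using max by (simp add: maximal_root_def)
  obtain n :: "'a \<Rightarrow> nat" where n: "\<beta> = (\<Sum>\<alpha>\<in>simple_roots. of_nat (n \<alpha>) *\<^sub>R \<alpha>)"
    using pos_comb bp by blast
  define S where "S = {\<alpha> \<in> simple_roots. n \<alpha> > 0}"
  define T where "T = simple_roots - S"
  have fin: "finite S" "finite T" by (auto simp: S_def T_def)
  have bS: "\<beta> = (\<Sum>\<alpha>\<in>S. of_nat (n \<alpha>) *\<^sub>R \<alpha>)"
    unfolding n by (rule sum.mono_neutral_right) (auto simp: S_def)
  have orth: "u \<bullet> v = 0" if "u \<in> S" "v \<in> T" for u v
  proof -
    have v: "v \<in> simple_roots" using that by (simp add: T_def)
    have "0 \<le> v \<bullet> \<beta>"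
      using maximal_dominant[OF max] v simple_pos by (metis inner_commute)
    also have "v \<bullet> \<beta> = (\<Sum>\<alpha>\<in>S. of_nat (n \<alpha>) * (v \<bullet> \<alpha>))"
      by (subst bS) (simp add: inner_sum_right)
    finally have s: "0 \<le> (\<Sum>\<alpha>\<in>S. of_nat (n \<alpha>) * (v \<bullet> \<alpha>))" .
    have le: "of_nat (n \<alpha>) * (v \<bullet> \<alpha>) \<le> 0" if "\<alpha> \<in> S" for \<alpha>
    proof -
      have "\<alpha> \<in> simple_roots" "v \<noteq> \<alpha>"
        using that \<open>v \<in> T\<close> by (auto simp: S_def T_def)
      then show ?thesis
        using simple_obtuse[OF v] by (intro mult_nonneg_nonpos) auto
    qed
    have "(\<Sum>\<alpha>\<in>S. - (of_nat (n \<alpha>) * (v \<bullet> \<alpha>))) = 0"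
      using s sum_nonneg[of S "\<lambda>\<alpha>. - (of_nat (n \<alpha>) * (v \<bullet> \<alpha>))"] le
      by (simp add: sum_negf)
    then have "- (of_nat (n u) * (v \<bullet> u)) = 0"
      using le fin that by (subst (asm) sum_nonneg_eq_0_iff) auto
    then show ?thesis
      using that by (auto simp: S_def inner_commute)
  qed
  have ST: "S \<union> T = simple_roots" by (auto simp: S_def T_def)
  have o1: "u \<bullet> v = 0" if "u \<in> span S" "v \<in> span T" for u v
    using orthogonal_to_span[of _ T u] orthogonal_to_span[of _ S] orth that
    by (metis orthogonal_commute orthogonal_def)
  have parts: "\<gamma> \<in> span S \<or> \<gamma> \<in> span T" if "\<gamma> \<in> \<Phi>" for \<gamma>
    using pos_in_orthogonal_part[OF _ ST orth] pos_or_neg[OF that] span_neg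
    by (metis minus_minus)
  have "\<Phi> \<inter> span S = \<Phi>"
  proof -
    have "(\<Sum>\<alpha>\<in>S. of_nat (n \<alpha>) *\<^sub>R \<alpha>) \<in> span S"
      by (intro span_sum span_scale span_base)
    then have "\<beta> \<in> \<Phi> \<inter> span S"
      using bp pos_roots_root by (simp add: bS[symmetric])
    then have "\<Phi> \<inter> span S \<noteq> {}" by blast
    moreover have "a \<bullet> b = 0" if "a \<in> \<Phi> \<inter> span S" "b \<in> \<Phi> - \<Phi> \<inter> span S" for a b
      using that parts[of b] o1[of a b] by blast
    ultimately show ?thesis
      using conn unfolding connected_roots_def by (meson inf_le1)
  qed
  then have "v \<in> span S" if "v \<in> T" for v
    using that by (auto simp: T_def simple_roots_def pos_roots_def)
  then have "v \<bullet> v = 0" if "v \<in> T" for v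
    using o1 that span_base by blast
  moreover have "v \<noteq> 0" if "v \<in> T" for v
    using that root_nonzero by (auto simp: T_def simple_roots_def pos_roots_def)
  ultimately have "T = {}" by auto
  then have "\<forall>\<alpha>\<in>simple_roots. n \<alpha> > 0"
    by (auto simp: T_def S_def)
  with n show ?thesis by blast
qed

text \<open>Full support of \<open>\<theta>\<close> and dominance of \<open>\<beta>\<close> give
  \<open>\<beta> \<bullet> \<theta> > 0\<close>. So the difference is a root, and adding it or its
  negative enlarges one of the two maximal roots.\<close>

lemma maximal_unique:
  assumes conn: "connected_roots \<Phi>" and "maximal_root \<beta>" "maximal_root \<theta>"
  shows "\<beta> = \<theta>"
proof (rule ccontr)
  assume ne: "\<beta> \<noteq> \<theta>"
  have bp: "\<beta> \<in> pos_roots" "\<theta> \<in> pos_roots" using assms by (auto simp: maximal_root_def)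
  obtain n :: "'a \<Rightarrow> nat" where n: "\<theta> = (\<Sum>\<alpha>\<in>simple_roots. of_nat (n \<alpha>) *\<^sub>R \<alpha>)"
      "\<forall>\<alpha>\<in>simple_roots. n \<alpha> > 0"
    using maximal_full_support[OF conn assms(3)] by blast
  obtain m :: "'a \<Rightarrow> nat" where m: "\<beta> = (\<Sum>\<alpha>\<in>simple_roots. of_nat (m \<alpha>) *\<^sub>R \<alpha>)"
    using pos_comb bp by blast
  have "\<beta> \<bullet> \<beta> > 0"
    using bp root_nonzero pos_roots_root by auto
  then have "\<beta> \<bullet> (\<Sum>\<alpha>\<in>simple_roots. of_nat (m \<alpha>) *\<^sub>R \<alpha>) > 0"
    using m by metis
  then obtain \<alpha> where a: "\<alpha> \<in> simple_roots" "\<beta> \<bullet> \<alpha> > 0"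
    by (rule inner_sum_pos_term) auto
  have "(\<Sum>\<alpha>\<in>simple_roots. of_nat (n \<alpha>) * (\<beta> \<bullet> \<alpha>)) > 0"
    using a n(2) maximal_dominant[OF assms(2)] simple_pos
    by (intro sum_pos2[of _ \<alpha>]) auto
  then have pos: "\<beta> \<bullet> \<theta> > 0"
    by (subst n(1)) (simp add: inner_sum_right)
  then have d: "\<beta> - \<theta> \<in> \<Phi>"
    using bp ne diff_root pos_roots_root by blast
  have "\<beta> - \<theta> \<in> pos_roots \<or> \<theta> - \<beta> \<in> pos_roots"
    using pos_or_neg[OF d] by simp
  moreover have "\<theta> + (\<beta> - \<theta>) \<in> \<Phi>" "\<beta> + (\<theta> - \<beta>) \<in> \<Phi>"
    using bp by (auto simp: pos_roots_root)
  ultimately show False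
    using assms unfolding maximal_root_def by blast
qed

text \<open>A positive root with the greatest value at \<open>y\<close> is maximal. Uniqueness is
  stated as a climbing rule: every other positive root can be enlarged by a positive root.\<close>

lemma maximal_root_exists:
  assumes conn: "connected_roots \<Phi>" and ne: "\<Phi> \<noteq> {}"
  obtains \<theta> where "\<theta> \<in> pos_roots"
    and "\<And>\<beta>. \<beta> \<in> pos_roots \<Longrightarrow> \<beta> \<noteq> \<theta> \<Longrightarrow> \<exists>\<gamma>\<in>pos_roots. \<beta> + \<gamma> \<in> pos_roots"
proof -
  have "pos_roots \<noteq> {}"
    using ne pos_or_neg by blast
  then have "Max ((\<lambda>\<beta>. \<beta> \<bullet> y) ` pos_roots) \<in> (\<lambda>\<beta>. \<beta> \<bullet> y) ` pos_roots"
    by (intro Max_in) auto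
  then obtain \<theta> where th: "\<theta> \<in> pos_roots"
    and "Max ((\<lambda>\<beta>. \<beta> \<bullet> y) ` pos_roots) = \<theta> \<bullet> y"
    by auto
  then have th_max: "\<beta> \<bullet> y \<le> \<theta> \<bullet> y" if "\<beta> \<in> pos_roots" for \<beta>
    using that Max_ge[of "(\<lambda>\<beta>. \<beta> \<bullet> y) ` pos_roots" "\<beta> \<bullet> y"] by simp
  have add: "\<beta> + \<gamma> \<in> pos_roots" if "\<beta> \<in> pos_roots" "\<gamma> \<in> pos_roots" "\<beta> + \<gamma> \<in> \<Phi>" for \<beta> \<gamma>
    using that by (simp add: pos_roots_def inner_add_left)
  have "maximal_root \<theta>"
    unfolding maximal_root_def
  proof (intro conjI ballI notI th)
    fix \<gamma> assume "\<gamma> \<in> pos_roots" "\<theta> + \<gamma> \<in> \<Phi>"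
    with th_max[OF add[OF th]] have "\<gamma> \<bullet> y \<le> 0"
      by (simp add: inner_add_left)
    with \<open>\<gamma> \<in> pos_roots\<close> show False
      by (simp add: pos_roots_def)
  qed
  then show ?thesis
    using that[OF th] maximal_unique[OF conn] add unfolding maximal_root_def by metis
qed

end

section \<open>Simple reflections and the longest element\<close>

lemma carrier_perm_group: "f \<in> carrier perm_group \<longleftrightarrow> bij f"
  by (simp add: BijGroup_def Bij_def)

lemma mult_perm_group: "bij f \<Longrightarrow> bij g \<Longrightarrow> f \<otimes>\<^bsub>perm_group\<^esub> g = f \<circ> g"
  by (simp add: BijGroup_def Bij_def compose_def fun_eq_iff)

lemma one_perm_group: "\<one>\<^bsub>perm_group\<^esub> = id"
  by (simp add: BijGroup_def fun_eq_iff)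

lemma inv_perm_group: "bij f \<Longrightarrow> inv\<^bsub>perm_group\<^esub> f = inv_into UNIV f"
  by (simp add: inv_BijGroup Bij_def fun_eq_iff)

lemma pow_perm_group: "bij f \<Longrightarrow> f [^]\<^bsub>perm_group\<^esub> (n::nat) = f ^^ n"
proof (induction n)
  case (Suc n)
  then have "f [^]\<^bsub>perm_group\<^esub> Suc n = f ^^ n \<circ> f"
    by (simp add: mult_perm_group bij_betw_funpow)
  then show ?case by (simp only: funpow_Suc_right)
qed (simp add: one_perm_group)

section \<open>Words in reflections and the groups they generate\<close>

definition refl_word :: "'a::euclidean_space list \<Rightarrow> 'a \<Rightarrow> 'a" where
  "refl_word as = foldr (\<circ>) (map root_reflection as) id"

lemma refl_word_Nil [simp]: "refl_word [] = id"
  by (simp add: refl_word_def)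

lemma refl_word_Cons [simp]: "refl_word (a # as) = root_reflection a \<circ> refl_word as"
  by (simp add: refl_word_def)

lemma refl_word_append [simp]: "refl_word (as @ bs) = refl_word as \<circ> refl_word bs"
  by (induction as) (simp_all add: comp_assoc)

lemma refl_word_linear: "linear (refl_word as)"
proof (induction as)
  case (Cons a as)
  then show ?case
    unfolding refl_word_Cons by (intro linear_compose root_reflection_linear)
qed (simp add: id_def linear_ident)

lemma refl_word_inner [simp]: "refl_word as x \<bullet> refl_word as y = x \<bullet> y"
  by (induction as) simp_all

lemma refl_word_rev [simp]: "refl_word (rev as) \<circ> refl_word as = id"
proof -
  have "refl_word (rev as) (refl_word as x) = x" for x
    by (induction as) simp_all
  then show ?thesis by (simp add: fun_eq_iff)
qed

lemma refl_word_rev' [simp]: "refl_word as \<circ> refl_word (rev as) = id"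
  using refl_word_rev[of "rev as"] by simp

lemma refl_word_bij: "bij (refl_word as)"
  by (rule o_bij[of "refl_word (rev as)"]) simp_all

lemma reflection_bij: "bij (root_reflection a)"
  using refl_word_bij[of "[a]"] by simp

lemma refl_word_diff_span:
  "set as \<subseteq> K \<Longrightarrow> x - refl_word as x \<in> span K"
proof (induction as)
  case (Cons a as)
  have "x - refl_word (a # as) x = (x - refl_word as x) + (coroot a \<bullet> refl_word as x) *\<^sub>R a"
    by (simp add: root_reflection_def)
  moreover have "(x - refl_word as x) + (coroot a \<bullet> refl_word as x) *\<^sub>R a \<in> span K"
    using Cons by (intro span_add span_scale[OF span_base]) auto
  ultimately show ?case by (simp only:)
qed (simp add: span_zero)

text \<open>Reflections are their own inverses, so words without inverses exhaust the generated
  group. Later arguments about the group are inductions on words.\<close>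

lemma reflection_group_eq: "reflection_group K = refl_word ` lists K"
proof
  show "reflection_group K \<subseteq> refl_word ` lists K"
  proof
    fix w assume "w \<in> reflection_group K"
    then show "w \<in> refl_word ` lists K"
      unfolding reflection_group_def
    proof (induction rule: generate.induct)
      case one
      then show ?case by (auto simp: one_perm_group intro!: image_eqI[of _ _ "[]"])
    next
      case (incl h)
      then obtain a where "a \<in> K" "h = root_reflection a" by blast
      then show ?case by (auto intro!: image_eqI[of _ _ "[a]"])
    next
      case (inv h)
      then obtain a where a: "a \<in> K" "h = root_reflection a" by blast
      then have "inv\<^bsub>perm_group\<^esub> h = root_reflection a"
        by (simp add: inv_perm_group reflection_bij inv_unique_comp)
      with a show ?case by (auto intro!: image_eqI[of _ _ "[a]"])
    next
      case (eng g h)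
      then obtain as bs where "as \<in> lists K" "bs \<in> lists K" "g = refl_word as" "h = refl_word bs"
        by blast
      then show ?case
        by (auto simp: mult_perm_group refl_word_bij intro!: image_eqI[of _ _ "as @ bs"])
    qed
  qed
  show "refl_word ` lists K \<subseteq> reflection_group K"
  proof (rule image_subsetI)
    fix as assume "as \<in> lists K"
    then show "refl_word as \<in> reflection_group K"
    proof (induction as)
      case Nil
      then show ?case
        unfolding reflection_group_def using generate.one[of perm_group] by (simp only: one_perm_group refl_word_Nil)
    next
      case (Cons a as)
      then have "root_reflection a \<otimes>\<^bsub>perm_group\<^esub> refl_word as \<in> reflection_group K"
        unfolding reflection_group_def by (intro generate.eng generate.incl[of "root_reflection a"]) auto
      then have "root_reflection a \<circ> refl_word as \<in> reflection_group K"
        by (simp only: mult_perm_group[OF reflection_bij refl_word_bij])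
      then show ?case by (simp only: refl_word_Cons)
    qed
  qed
qed

lemma refl_word_in_group: "set as \<subseteq> K \<Longrightarrow> refl_word as \<in> reflection_group K"
  by (auto simp: reflection_group_eq)

lemma reflection_group_mono: "K \<subseteq> L \<Longrightarrow> reflection_group K \<subseteq> reflection_group L"
  unfolding reflection_group_eq by (intro image_mono lists_mono)

lemma reflection_group_comp:
  "g \<in> reflection_group K \<Longrightarrow> h \<in> reflection_group K \<Longrightarrow> g \<circ> h \<in> reflection_group K"
  unfolding reflection_group_eq
proof (elim imageE)
  fix as bs assume "as \<in> lists K" "bs \<in> lists K" "g = refl_word as" "h = refl_word bs"
  then show "g \<circ> h \<in> refl_word ` lists K"
    by (intro image_eqI[of _ _ "as @ bs"]) simp_all
qed

lemma reflection_in_group: "a \<in> K \<Longrightarrow> root_reflection a \<in> reflection_group K"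
  unfolding reflection_group_eq by (auto intro!: image_eqI[of _ _ "[a]"])

lemma reflection_group_funpow: "g \<in> reflection_group K \<Longrightarrow> g ^^ n \<in> reflection_group K"
proof (induction n)
  case 0
  then show ?case unfolding reflection_group_eq by (auto intro!: image_eqI[of _ _ "[]"])
qed (simp add: reflection_group_comp)

lemma reflection_group_inverse:
  assumes "g \<in> reflection_group K"
  obtains h where "h \<in> reflection_group K" "g \<circ> h = id" "h \<circ> g = id"
proof -
  obtain as where "set as \<subseteq> K" "g = refl_word as"
    using assms by (auto simp: reflection_group_eq)
  then show ?thesis
    by (intro that[of "refl_word (rev as)"]) (auto simp: reflection_group_eq subset_iff intro!: imageI)
qed

lemma reflection_group_linear: "g \<in> reflection_group K \<Longrightarrow> linear g"
  by (auto simp: reflection_group_eq refl_word_linear)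

lemma reflection_group_inner: "g \<in> reflection_group K \<Longrightarrow> g x \<bullet> g y = x \<bullet> y"
  by (auto simp: reflection_group_eq)

lemma reflection_group_bij: "g \<in> reflection_group K \<Longrightarrow> bij g"
  by (auto simp: reflection_group_eq refl_word_bij)

lemma reflection_group_diff_span: "g \<in> reflection_group K \<Longrightarrow> x - g x \<in> span K"
  by (auto simp: reflection_group_eq subset_iff intro!: refl_word_diff_span)

lemma reflection_group_span: "g \<in> reflection_group K \<Longrightarrow> K \<subseteq> L \<Longrightarrow> x \<in> span L \<Longrightarrow> g x \<in> span L"
  using reflection_group_diff_span[of g K x] span_mono[of K L] span_diff[of x L "x - g x"] by auto

lemma (in crystallographic) reflection_group_root:
  "g \<in> reflection_group K \<Longrightarrow> K \<subseteq> \<Phi> \<Longrightarrow> \<beta> \<in> \<Phi> \<Longrightarrow> g \<beta> \<in> \<Phi>"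
proof -
  have "\<beta> \<in> \<Phi> \<Longrightarrow> refl_word as \<beta> \<in> \<Phi>" if "set as \<subseteq> \<Phi>" for as
    using that by (induction as) (auto simp: reflection_closed)
  then show "g \<in> reflection_group K \<Longrightarrow> K \<subseteq> \<Phi> \<Longrightarrow> \<beta> \<in> \<Phi> \<Longrightarrow> g \<beta> \<in> \<Phi>"
    by (auto simp: reflection_group_eq)
qed

lemma reflection_length_le: "set as \<subseteq> K \<Longrightarrow> reflection_length K (refl_word as) \<le> length as"
  unfolding reflection_length_def refl_word_def by (rule Least_le) blast

lemma reflection_length_word:
  assumes "w \<in> reflection_group K"
  obtains as where "set as \<subseteq> K" "w = refl_word as" "length as = reflection_length K w"
proof -
  have "\<exists>n as. length as = n \<and> set as \<subseteq> K \<and> w = refl_word as"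
    using assms by (auto simp: reflection_group_eq)
  then have "\<exists>as. length as = reflection_length K w \<and> set as \<subseteq> K \<and> w = refl_word as"
    unfolding reflection_length_def refl_word_def by (rule LeastI_ex)
  then show ?thesis using that by blast
qed

text \<open>Extend a coordinate functional linearly, represent it by the vector
  \<open>adjoint g 1\<close>, and project orthogonally to \<open>span B\<close>; the projection
  keeps the inner products with \<open>B\<close>.\<close>

lemma dual_basis_exists:
  fixes B :: "'a::euclidean_space set"
  assumes "independent B"
  obtains d where "\<And>b. b \<in> B \<Longrightarrow> d b \<in> span B"
    and "\<And>b c. b \<in> B \<Longrightarrow> c \<in> B \<Longrightarrow> d b \<bullet> c = (if b = c then 1 else 0)"
proof -
  have "\<exists>v\<in>span B. \<forall>c\<in>B. v \<bullet> c = (if b = c then 1 else 0)" for b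
  proof -
    obtain g :: "'a \<Rightarrow> real" where g: "linear g" "\<And>c. c \<in> B \<Longrightarrow> g c = (if b = c then 1 else 0)"
      using linear_independent_extend[OF assms, of "\<lambda>c. if b = c then 1 else 0"] by auto
    define u where "u = adjoint g 1"
    have u: "u \<bullet> x = g x" for x
      using adjoint_works[OF g(1), of x 1] by (simp add: u_def inner_commute)
    obtain v z where v: "v \<in> span B" "\<And>w. w \<in> span B \<Longrightarrow> orthogonal z w" "u = v + z"
      using orthogonal_subspace_decomp_exists[of B u] by blast
    have "v \<bullet> c = u \<bullet> c" if "c \<in> B" for c
      using v that by (simp add: inner_add_left span_base orthogonal_def)
    with u g v show ?thesis by (intro bexI[of _ v]) auto
  qed
  then show ?thesis using that by metis
qed

section \<open>Reduced connected root systems with a basis and its fundamental coweights\<close>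

locale based_roots = crystallographic \<Phi> for \<Phi> :: "'a::euclidean_space set" +
  fixes \<Delta> :: "'a set" and coweight :: "'a \<Rightarrow> 'a"
  assumes nonempty: "\<Phi> \<noteq> {}"
    and conn: "connected_roots \<Phi>"
    and half_not_root: "\<alpha> \<in> \<Phi> \<Longrightarrow> (1/2) *\<^sub>R \<alpha> \<notin> \<Phi>"
    and base_roots: "\<Delta> \<subseteq> \<Phi>"
    and base_comb: "\<beta> \<in> \<Phi> \<Longrightarrow> \<exists>c :: 'a \<Rightarrow> int.
        \<beta> = (\<Sum>\<alpha>\<in>\<Delta>. of_int (c \<alpha>) *\<^sub>R \<alpha>) \<and> ((\<forall>\<alpha>\<in>\<Delta>. c \<alpha> \<ge> 0) \<or> (\<forall>\<alpha>\<in>\<Delta>. c \<alpha> \<le> 0))"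
    and coweight_span: "\<alpha> \<in> \<Delta> \<Longrightarrow> coweight \<alpha> \<in> span \<Delta>"
    and coweight_dual: "\<alpha> \<in> \<Delta> \<Longrightarrow> \<beta> \<in> \<Delta> \<Longrightarrow> coweight \<alpha> \<bullet> \<beta> = (if \<alpha> = \<beta> then 1 else 0)"
begin

lemma finite_base [simp]: "finite \<Delta>"
  using base_roots finite_roots finite_subset by blast

lemma base_root: "\<alpha> \<in> \<Delta> \<Longrightarrow> \<alpha> \<in> \<Phi>"
  using base_roots by blast

lemma coweight_sum: "\<alpha> \<in> \<Delta> \<Longrightarrow> coweight \<alpha> \<bullet> (\<Sum>\<beta>\<in>\<Delta>. c \<beta> *\<^sub>R \<beta>) = c \<alpha>"
  by (simp add: inner_sum_right coweight_dual if_distrib[of "(*) _"] cong: if_cong)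

lemma base_expand: "x \<in> span \<Delta> \<Longrightarrow> x = (\<Sum>\<alpha>\<in>\<Delta>. (coweight \<alpha> \<bullet> x) *\<^sub>R \<alpha>)"
proof -
  assume "x \<in> span \<Delta>"
  then obtain u where u: "x = (\<Sum>\<alpha>\<in>\<Delta>. u \<alpha> *\<^sub>R \<alpha>)"
    by (auto simp: span_finite)
  show ?thesis
    by (subst u, rule sum.cong) (simp_all add: u coweight_sum)
qed

lemma base_eqI:
  "x \<in> span \<Delta> \<Longrightarrow> z \<in> span \<Delta> \<Longrightarrow> (\<And>\<alpha>. \<alpha> \<in> \<Delta> \<Longrightarrow> coweight \<alpha> \<bullet> x = coweight \<alpha> \<bullet> z) \<Longrightarrow> x = z"
  using base_expand[of x] base_expand[of z] by simp

lemma root_span: "\<beta> \<in> \<Phi> \<Longrightarrow> \<beta> \<in> span \<Delta>"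
  using base_comb[of \<beta>] by (metis (no_types, lifting) span_base span_scale span_sum)

lemma coef_int: "\<beta> \<in> \<Phi> \<Longrightarrow> \<alpha> \<in> \<Delta> \<Longrightarrow> coweight \<alpha> \<bullet> \<beta> \<in> \<int>"
  using base_comb[of \<beta>] by (auto simp: coweight_sum)

lemma coef_sign: "\<beta> \<in> \<Phi> \<Longrightarrow> (\<forall>\<alpha>\<in>\<Delta>. 0 \<le> coweight \<alpha> \<bullet> \<beta>) \<or> (\<forall>\<alpha>\<in>\<Delta>. coweight \<alpha> \<bullet> \<beta> \<le> 0)"
  using base_comb[of \<beta>] by (auto simp: coweight_sum)

definition pos :: "'a \<Rightarrow> bool" where
  "pos \<beta> \<longleftrightarrow> \<beta> \<in> \<Phi> \<and> (\<forall>\<alpha>\<in>\<Delta>. 0 \<le> coweight \<alpha> \<bullet> \<beta>)"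

lemma pos_or_neg_root: "\<beta> \<in> \<Phi> \<Longrightarrow> pos \<beta> \<or> pos (- \<beta>)"
  using coef_sign[of \<beta>] by (auto simp: pos_def)

lemma pos_root: "pos \<beta> \<Longrightarrow> \<beta> \<in> \<Phi>"
  by (simp add: pos_def)

lemma pos_coef: "pos \<beta> \<Longrightarrow> \<alpha> \<in> \<Delta> \<Longrightarrow> 0 \<le> coweight \<alpha> \<bullet> \<beta>"
  by (simp add: pos_def)

lemma pos_if_coef: "\<beta> \<in> \<Phi> \<Longrightarrow> \<alpha> \<in> \<Delta> \<Longrightarrow> 0 < coweight \<alpha> \<bullet> \<beta> \<Longrightarrow> pos \<beta>"
  using coef_sign[of \<beta>] by (force simp: pos_def)

lemma root_coef_nonzero: "\<beta> \<in> \<Phi> \<Longrightarrow> \<exists>\<alpha>\<in>\<Delta>. coweight \<alpha> \<bullet> \<beta> \<noteq> 0"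
proof (rule ccontr)
  assume "\<beta> \<in> \<Phi>" "\<not> ?thesis"
  then have "\<beta> = 0" by (intro base_eqI) (auto simp: root_span span_zero)
  with \<open>\<beta> \<in> \<Phi>\<close> show False using root_nonzero by blast
qed

lemma simple_pos_root: "\<alpha> \<in> \<Delta> \<Longrightarrow> pos \<alpha>"
  by (auto simp: pos_def base_root coweight_dual)

lemma pos_not_uminus: "pos \<beta> \<Longrightarrow> \<not> pos (- \<beta>)"
  using root_coef_nonzero[of \<beta>] by (force simp: pos_def)

text \<open>Pairing with this vector gives the height of a root. It makes the general theory of
  regular functionals available with the positive roots determined by
  \<open>\<Delta>\<close>.\<close>

definition rho :: 'a where
  "rho = (\<Sum>\<alpha>\<in>\<Delta>. coweight \<alpha>)"

lemma rho_inner: "\<beta> \<bullet> rho = (\<Sum>\<alpha>\<in>\<Delta>. coweight \<alpha> \<bullet> \<beta>)"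
  by (simp add: rho_def inner_sum_right inner_commute)

lemma rho_simple: "\<alpha> \<in> \<Delta> \<Longrightarrow> \<alpha> \<bullet> rho = 1"
  by (simp add: rho_inner coweight_dual)

lemma rho_pos: assumes "pos \<beta>" shows "\<beta> \<bullet> rho \<ge> 1"
proof -
  have "\<beta> \<bullet> rho \<in> \<int>"
    unfolding rho_inner using assms by (intro Ints_sum coef_int) (auto simp: pos_def)
  moreover have "\<beta> \<bullet> rho > 0"
  proof -
    obtain \<alpha> where a: "\<alpha> \<in> \<Delta>" "coweight \<alpha> \<bullet> \<beta> \<noteq> 0"
      using root_coef_nonzero assms pos_root by blast
    show ?thesis
      unfolding rho_inner using a assms
      by (intro sum_pos2[of _ \<alpha>]) (auto simp: pos_def less_le)
  qed
  ultimately show ?thesis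
    by (auto elim!: Ints_cases)
qed

sublocale rho: regular_functional \<Phi> rho
proof
  fix \<beta> assume "\<beta> \<in> \<Phi>"
  then show "\<beta> \<bullet> rho \<noteq> 0"
    using pos_or_neg_root[of \<beta>] rho_pos[of \<beta>] rho_pos[of "- \<beta>"] by auto
qed

lemma rho_pos_roots: "rho.pos_roots = Collect pos"
proof -
  have "\<beta> \<bullet> rho > 0 \<longleftrightarrow> pos \<beta>" if "\<beta> \<in> \<Phi>" for \<beta>
    using pos_or_neg_root[OF that] rho_pos[of \<beta>] rho_pos[of "- \<beta>"] by auto
  then show ?thesis
    by (auto simp: rho.pos_roots_def pos_root)
qed

text \<open>A simple root \<open>\<alpha>\<close> at an acute angle to \<open>\<beta>\<close> can be
  subtracted. The difference cannot be negative, since \<open>\<alpha> - \<beta>\<close> has height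
  at most 0.\<close>

lemma pos_decomposable:
  assumes "pos \<beta>" "\<beta> \<notin> \<Delta>"
  obtains \<gamma> \<delta> where "pos \<gamma>" "pos \<delta>" "\<beta> = \<gamma> + \<delta>"
proof -
  have b: "\<beta> \<in> \<Phi>" "\<beta> \<noteq> 0" using assms pos_root root_nonzero by auto
  have "\<beta> \<bullet> (\<Sum>\<alpha>\<in>\<Delta>. (coweight \<alpha> \<bullet> \<beta>) *\<^sub>R \<alpha>) > 0"
    using base_expand[OF root_span[OF b(1)]] b(2) by simp
  then obtain \<alpha> where a: "\<alpha> \<in> \<Delta>" "\<beta> \<bullet> \<alpha> > 0" "coweight \<alpha> \<bullet> \<beta> > 0"
    by (rule inner_sum_pos_term) (use assms in \<open>auto simp: pos_def\<close>)
  then have d: "\<beta> - \<alpha> \<in> \<Phi>"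
    using assms b base_root by (intro diff_root) auto
  have "pos (\<beta> - \<alpha>)"
  proof (rule ccontr)
    assume "\<not> ?thesis"
    then have n: "pos (\<alpha> - \<beta>)" using pos_or_neg_root[OF d] by simp
    have "(\<alpha> - \<beta>) \<bullet> rho \<le> 0"
      using rho_pos[OF assms(1)] a by (simp add: inner_diff_left rho_simple)
    with rho_pos[OF n] show False by simp
  qed
  then show ?thesis
    using that[of "\<beta> - \<alpha>" \<alpha>] simple_pos_root a by simp
qed

text \<open>The reflection changes only the coefficient at \<open>\<alpha>\<close>. It therefore
  suffices that \<open>\<beta>\<close> has another simple root in its support, that is, that it is
  not a multiple of \<open>\<alpha>\<close>; here reducedness enters.\<close>

lemma reflection_pos:
  assumes a: "\<alpha> \<in> \<Delta>" and p: "pos \<beta>" and ne: "\<beta> \<noteq> \<alpha>"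
  shows "pos (root_reflection \<alpha> \<beta>)"
proof -
  have "\<exists>b\<in>\<Delta>. b \<noteq> \<alpha> \<and> coweight b \<bullet> \<beta> \<noteq> 0"
  proof (rule ccontr)
    assume "\<not> ?thesis"
    then have z: "\<And>b. b \<in> \<Delta> \<Longrightarrow> b \<noteq> \<alpha> \<Longrightarrow> coweight b \<bullet> \<beta> = 0" by blast
    have "\<beta> = (\<Sum>b\<in>\<Delta>. (coweight b \<bullet> \<beta>) *\<^sub>R b)"
      using base_expand root_span p pos_root by blast
    also have "\<dots> = (\<Sum>b\<in>{\<alpha>}. (coweight b \<bullet> \<beta>) *\<^sub>R b)"
      using a z by (intro sum.mono_neutral_right) auto
    finally have ba: "\<beta> = (coweight \<alpha> \<bullet> \<beta>) *\<^sub>R \<alpha>" by simp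
    obtain c :: int where c: "coweight \<alpha> \<bullet> \<beta> = of_int c"
      using coef_int a p pos_root Ints_cases by metis
    have an: "\<alpha> \<noteq> 0" "\<beta> \<noteq> 0" using a p base_root pos_root root_nonzero by auto
    then have c0: "c > 0" using ba c pos_coef[OF p a] by (cases "c = 0") auto
    have b2: "\<beta> = of_int c *\<^sub>R \<alpha>" using ba c by simp
    have "coroot \<beta> \<bullet> \<alpha> = 2 / of_int c"
      using an c0 by (simp add: coroot_inner b2)
    moreover have "coroot \<beta> \<bullet> \<alpha> \<in> \<int>" using integral p a base_root pos_root by blast
    ultimately obtain k :: int where "2 / real_of_int c = of_int k" by (metis Ints_cases)
    then have "2 = real_of_int (c * k)" using c0 by (simp add: field_simps)
    then have "2 = c * k" by linarith
    \<comment> \<open>So \<open>\<beta>\<close> is \<open>\<alpha>\<close> or twice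
      \<open>\<alpha>\<close>; the first is excluded by assumption, the second because half a root
      is not a root.\<close>
    then have "c dvd 2" by (rule dvdI)
    then have "c \<le> 2" by (rule zdvd_imp_le) simp
    then consider "c = 1" | "c = 2" using c0 by linarith
    then show False
    proof cases
      case 1
      then show False using b2 ne by simp
    next
      case 2
      then have "(1/2) *\<^sub>R \<beta> = \<alpha>" using b2 by simp
      then show False using half_not_root p pos_root a base_root by metis
    qed
  qed
  then obtain b where b: "b \<in> \<Delta>" "b \<noteq> \<alpha>" "coweight b \<bullet> \<beta> \<noteq> 0" by blast
  then have "coweight b \<bullet> root_reflection \<alpha> \<beta> > 0"
    using pos_coef[OF p] a by (simp add: root_reflection_def inner_diff_right coweight_dual less_le)
  then show ?thesis
    using pos_if_coef b(1) reflection_closed base_root a p pos_root by blast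
qed

text \<open>Follow \<open>a\<close> through the word from the right. By
  \<open>reflection_pos\<close> the letter \<open>c\<close> that first makes it negative meets it
  exactly at \<open>c\<close>; then \<open>root_reflection c\<close> equals the conjugate of
  \<open>root_reflection a\<close> by the letters to its right, and both reflections cancel.\<close>

lemma exchange:
  assumes "set as \<subseteq> \<Delta>" "a \<in> \<Delta>" "\<not> pos (refl_word as a)"
  shows "\<exists>bs. length bs < length as \<and> set bs \<subseteq> set as \<and> refl_word as \<circ> root_reflection a = refl_word bs"
  using assms
proof (induction as)
  case Nil
  then show ?case using simple_pos_root by simp
next
  case (Cons c as)
  show ?case
  proof (cases "pos (refl_word as a)")
    case False
    have "set as \<subseteq> \<Delta>" using Cons.prems by simp
    from Cons.IH[OF this Cons.prems(2) False] obtain bs where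
      "length bs < length as" "set bs \<subseteq> set as" "refl_word as \<circ> root_reflection a = refl_word bs"
      by blast
    then show ?thesis
      by (intro exI[of _ "c # bs"]) (auto simp: fun_eq_iff)
  next
    case True
    with Cons.prems reflection_pos[of c] have c: "refl_word as a = c" by auto
    have "root_reflection c \<circ> refl_word as = refl_word as \<circ> root_reflection a"
      using root_reflection_conj[OF refl_word_linear refl_word_inner, of as a] c
      by (auto simp: fun_eq_iff)
    then have "refl_word (c # as) \<circ> root_reflection a
        = refl_word as \<circ> (root_reflection a \<circ> root_reflection a)"
      by (simp add: comp_assoc del: root_reflection_comp)
    then have "refl_word (c # as) \<circ> root_reflection a = refl_word as"
      by (simp only: root_reflection_comp comp_id)
    moreover have "length as < length (c # as)" "set as \<subseteq> set (c # as)" by auto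
    ultimately show ?thesis by blast
  qed
qed

text \<open>A non-empty word ending in \<open>a\<close> has a prefix that makes \<open>a\<close>
  negative, so \<open>exchange\<close> gives a shorter word for the same element, with letters still
  in \<open>K\<close>.\<close>

lemma pos_imp_id:
  assumes "w \<in> reflection_group K" "K \<subseteq> \<Delta>" "\<And>a. a \<in> K \<Longrightarrow> pos (w a)"
  shows "w = id"
proof -
  have "refl_word as = id" if "set as \<subseteq> K" "\<And>a. a \<in> K \<Longrightarrow> pos (refl_word as a)" for as
    using that
  proof (induction as rule: length_induct)
    case (1 as)
    show ?case
    proof (cases as rule: rev_cases)
      case (snoc bs a)
      have "pos (- refl_word bs a)"
        using 1(2) 1(3)[of a] snoc by (simp add: linear_neg[OF refl_word_linear])
      then have "\<not> pos (refl_word bs a)" using pos_not_uminus by auto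
      then obtain cs where "length cs < length bs" "set cs \<subseteq> set bs"
          "refl_word bs \<circ> root_reflection a = refl_word cs"
        using exchange[of bs a] 1(2) snoc assms(2) by auto
      then show ?thesis using 1 snoc by (auto dest!: spec[of _ cs])
    qed simp
  qed
  then show ?thesis using assms by (auto simp: reflection_group_eq)
qed

lemma weyl_root: "w \<in> reflection_group \<Delta> \<Longrightarrow> \<beta> \<in> \<Phi> \<Longrightarrow> w \<beta> \<in> \<Phi>"
  using reflection_group_root base_roots by blast

text \<open>By \<open>pos_imp_id\<close> an element is determined by its values on
  \<open>\<Delta>\<close>, which lie in the finite set \<open>\<Phi>\<close>.\<close>

lemma finite_weyl: "finite (reflection_group \<Delta>)"
proof (rule inj_on_finite)
  show "inj_on (\<lambda>w. restrict w \<Delta>) (reflection_group \<Delta>)"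
  proof (rule inj_onI)
    fix v w assume v: "v \<in> reflection_group \<Delta>" and w: "w \<in> reflection_group \<Delta>"
      and eq: "restrict v \<Delta> = restrict w \<Delta>"
    obtain u where u: "u \<in> reflection_group \<Delta>" "w \<circ> u = id" "u \<circ> w = id"
      using reflection_group_inverse[OF w] by blast
    have "u \<circ> v = id"
    proof (rule pos_imp_id[OF reflection_group_comp[OF u(1) v] order_refl])
      fix a assume a: "a \<in> \<Delta>"
      then have "(u \<circ> v) a = (u \<circ> w) a" using eq by (metis comp_apply restrict_apply')
      then show "pos ((u \<circ> v) a)" using u a simple_pos_root by simp
    qed
    then show "v = w" using u by (metis comp_assoc comp_id id_comp)
  qed
  show "(\<lambda>w. restrict w \<Delta>) ` reflection_group \<Delta> \<subseteq> \<Delta> \<rightarrow>\<^sub>E \<Phi>"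
    using weyl_root base_root by (auto simp: PiE_def extensional_def)
qed (simp add: finite_PiE)

section \<open>Longest elements, characterised by making all simple roots negative\<close>

definition negates :: "'a set \<Rightarrow> ('a \<Rightarrow> 'a) \<Rightarrow> bool" where
  "negates K g \<longleftrightarrow> g \<in> reflection_group K \<and> (\<forall>a\<in>K. pos (- g a))"

text \<open>If \<open>a\<close> were not sent to a negative root, \<open>exchange\<close> applied to
  a shortest word of \<open>v\<close> would make the longest element shorter than \<open>v\<close>.
  All later facts about longest elements use \<open>negates\<close> instead of lengths.\<close>

lemma longest_negates:
  assumes K: "K \<subseteq> \<Delta>"
  shows "negates K (longest_element K)"
proof -
  let ?G = "reflection_group K"
  \<comment> \<open>Lengths are bounded on a finite group, so the maximum behind
    \<open>arg_max_on\<close> is attained.\<close>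
  have fin: "finite ?G" using finite_weyl reflection_group_mono[OF K] finite_subset by blast
  have "id \<in> ?G" unfolding reflection_group_eq by (auto intro!: image_eqI[of _ _ "[]"])
  moreover have "reflection_length K w < Suc (Max (reflection_length K ` ?G))" if "w \<in> ?G" for w
    using fin that by (simp add: less_Suc_eq_le)
  ultimately have "\<exists>w. is_arg_max (reflection_length K) (\<lambda>w. w \<in> ?G) w"
    unfolding is_arg_max_linorder by (intro ex_has_greatest_nat) blast+
  then have am: "is_arg_max (reflection_length K) (\<lambda>w. w \<in> ?G) (longest_element K)"
    unfolding longest_element_def arg_max_on_def arg_max_def by (rule someI_ex)
  let ?w = "longest_element K"
  have w: "?w \<in> ?G" and max: "\<And>v. v \<in> ?G \<Longrightarrow> reflection_length K v \<le> reflection_length K ?w"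
    using am by (auto simp: is_arg_max_linorder)
  have "pos (- ?w a)" if a: "a \<in> K" for a
  proof (rule ccontr)
    assume n: "\<not> pos (- ?w a)"
    define v where "v = ?w \<circ> root_reflection a"
    have v: "v \<in> ?G" unfolding v_def by (intro reflection_group_comp w reflection_in_group a)
    have vv: "v \<circ> root_reflection a = ?w"
      unfolding v_def comp_assoc by simp
    obtain as where as: "set as \<subseteq> K" "v = refl_word as" "length as = reflection_length K v"
      using reflection_length_word[OF v] by blast
    have "v a = - ?w a"
      using linear_neg[OF reflection_group_linear[OF w]] by (simp add: v_def)
    then obtain bs where "length bs < length as" "set bs \<subseteq> set as" "?w = refl_word bs"
      using exchange[of as a] n as a K vv by auto
    then have "reflection_length K ?w < reflection_length K v"
      using reflection_length_le[of bs K] as by (metis order_trans le_less_trans)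
    with max[OF v] show False by simp
  qed
  with w show ?thesis by (simp add: negates_def)
qed

text \<open>Reflections in \<open>K\<close> change a vector only by an element of
  \<open>span K\<close>.\<close>

lemma coef_invariant:
  assumes "g \<in> reflection_group K" "K \<subseteq> \<Delta>" "b \<in> \<Delta>" "b \<notin> K"
  shows "coweight b \<bullet> g x = coweight b \<bullet> x"
proof -
  have "coweight b \<bullet> u = 0" if "u \<in> span K" for u
    using that
  proof (induction rule: span_induct_alt)
    case (step c k u)
    then show ?case using assms by (auto simp: inner_add_right coweight_dual subset_iff)
  qed simp
  from this[OF reflection_group_diff_span[OF assms(1), of x]] show ?thesis
    by (simp add: inner_diff_right)
qed

lemma negates_cone:
  assumes g: "negates K g" and K: "K \<subseteq> \<Delta>" and x: "x \<in> span \<Delta>"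
    and K0: "\<And>b. b \<in> K \<Longrightarrow> 0 \<le> coweight b \<bullet> x" "\<And>b. b \<in> \<Delta> \<Longrightarrow> b \<notin> K \<Longrightarrow> coweight b \<bullet> x = 0"
    and c: "c \<in> \<Delta>"
  shows "coweight c \<bullet> g x \<le> 0"
proof -
  have lin: "linear g" using g reflection_group_linear by (auto simp: negates_def)
  have "x = (\<Sum>b\<in>\<Delta>. (coweight b \<bullet> x) *\<^sub>R b)" by (rule base_expand[OF x])
  also have "\<dots> = (\<Sum>b\<in>K. (coweight b \<bullet> x) *\<^sub>R b)"
    using K K0 by (intro sum.mono_neutral_right) auto
  finally have "g x = g (\<Sum>b\<in>K. (coweight b \<bullet> x) *\<^sub>R b)" by simp
  then have "g x = (\<Sum>b\<in>K. (coweight b \<bullet> x) *\<^sub>R g b)"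
    by (simp add: linear_sum[OF lin] linear_cmul[OF lin])
  then have "coweight c \<bullet> g x = (\<Sum>b\<in>K. (coweight b \<bullet> x) * (coweight c \<bullet> g b))"
    by (simp add: inner_sum_right)
  moreover have "coweight c \<bullet> g b \<le> 0" if "b \<in> K" for b
    using g that c by (force simp: negates_def pos_def)
  ultimately show ?thesis
    using K0(1) by (auto intro!: sum_nonpos mult_nonneg_nonpos)
qed

text \<open>Were \<open>h a\<close> positive, it would have support in \<open>K\<close> by
  \<open>coef_invariant\<close>, and \<open>negates_cone\<close> would give
  \<open>g (h a) = a\<close> a non-positive coefficient at \<open>a\<close>.\<close>

lemma negates_inverse:
  assumes g: "negates K g" and K: "K \<subseteq> \<Delta>"
    and h: "h \<in> reflection_group K" "g \<circ> h = id"
  shows "negates K h"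
proof -
  have "pos (- h a)" if a: "a \<in> K" for a
  proof (rule ccontr)
    have hr: "h a \<in> \<Phi>" using h K a weyl_root base_root reflection_group_mono[OF K] by blast
    assume "\<not> ?thesis"
    then have p: "pos (h a)" using pos_or_neg_root[OF hr] by simp
    have "coweight a \<bullet> g (h a) \<le> 0"
    proof (rule negates_cone[OF g K root_span[OF hr]])
      show "coweight b \<bullet> h a = 0" if "b \<in> \<Delta>" "b \<notin> K" for b
        using that a K coef_invariant[OF h(1) K that] by (auto simp: coweight_dual)
    qed (use p a K in \<open>auto simp: pos_def\<close>)
    moreover have "g (h a) = a" using h(2) by (metis comp_apply id_apply)
    ultimately show False using a K by (simp add: coweight_dual subset_iff)
  qed
  then show ?thesis using h by (simp add: negates_def)
qed

text \<open>If \<open>- g a\<close> were a sum of two positive roots, both would have support in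
  \<open>K\<close>, so the negated inverse of \<open>g\<close> would keep them positive. This writes
  \<open>a\<close> as a sum of two positive roots, contrary to its height 1.\<close>

lemma negates_simple:
  assumes g: "negates K g" and K: "K \<subseteq> \<Delta>" and a: "a \<in> K"
  shows "- g a \<in> K"
proof -
  have gK: "g \<in> reflection_group K" using g by (simp add: negates_def)
  obtain h where h: "h \<in> reflection_group K" "g \<circ> h = id" "h \<circ> g = id"
    using reflection_group_inverse[OF gK] by blast
  note hn = negates_inverse[OF g K h(1,2)]
  have lin: "linear h" "linear g" using h gK reflection_group_linear by auto
  have p: "pos (- g a)" using g a by (simp add: negates_def)
  have coef0: "coweight b \<bullet> (- g a) = 0" if "b \<in> \<Delta>" "b \<notin> K" for b
    using that a K coef_invariant[OF gK K that] by (auto simp: coweight_dual)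
  have "- g a \<in> \<Delta>"
  proof (rule ccontr)
    assume "- g a \<notin> \<Delta>"
    then obtain \<gamma> \<delta> where gd: "pos \<gamma>" "pos \<delta>" "- g a = \<gamma> + \<delta>"
      using pos_decomposable[OF p] by blast
    have neg: "pos (- h \<epsilon>)" if e: "pos \<epsilon>" "\<And>b. b \<in> \<Delta> \<Longrightarrow> b \<notin> K \<Longrightarrow> coweight b \<bullet> \<epsilon> = 0" for \<epsilon>
    proof -
      have "h \<epsilon> \<in> \<Phi>" using e h K weyl_root reflection_group_mono[OF K] pos_root by blast
      moreover have "coweight c \<bullet> h \<epsilon> \<le> 0" if "c \<in> \<Delta>" for c
        by (rule negates_cone[OF hn K root_span _ _ that]) (use e K in \<open>auto simp: pos_def\<close>)
      ultimately show ?thesis by (simp add: pos_def)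
    qed
    have "coweight b \<bullet> \<gamma> = 0 \<and> coweight b \<bullet> \<delta> = 0" if "b \<in> \<Delta>" "b \<notin> K" for b
      using coef0[OF that] pos_coef[OF gd(1) that(1)] pos_coef[OF gd(2) that(1)]
      unfolding gd(3) by (simp add: inner_add_right)
    then have "pos (- h \<gamma>)" "pos (- h \<delta>)" using neg gd by auto
    then have "(- h \<gamma>) \<bullet> rho + (- h \<delta>) \<bullet> rho \<ge> 2" using rho_pos[of "- h \<gamma>"] rho_pos[of "- h \<delta>"] by linarith
    moreover have "- h \<gamma> + - h \<delta> = a"
    proof -
      have "h (\<gamma> + \<delta>) = - h (g a)" using gd(3) linear_neg[OF lin(1)] by metis
      also have "h (g a) = a" using h(3) by (metis comp_apply id_apply)
      finally have "h \<gamma> + h \<delta> = - a" by (simp add: linear_add[OF lin(1)])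
      then show ?thesis by (metis add.inverse_distrib_swap add.commute minus_minus)
    qed
    ultimately have "a \<bullet> rho \<ge> 2" by (metis inner_add_left)
    then show False using rho_simple a K by (auto simp: subset_iff)
  qed
  moreover from this have "- g a \<in> K" if "- g a \<notin> K"
    using coef0[OF _ that] coweight_dual[of "- g a" "- g a"] by simp
  ultimately show ?thesis by blast
qed

section \<open>The highest root and the action of Omega on the extended basis\<close>

lemma highest_root_exists:
  "\<exists>\<theta>\<in>\<Phi>. \<forall>\<beta>\<in>\<Phi>. \<forall>\<alpha>\<in>\<Delta>. coweight \<alpha> \<bullet> \<beta> \<le> coweight \<alpha> \<bullet> \<theta>"
proof -
  obtain \<theta> where th: "pos \<theta>"
    and max: "\<And>\<beta>. pos \<beta> \<Longrightarrow> \<beta> \<noteq> \<theta> \<Longrightarrow> \<exists>\<gamma>. pos \<gamma> \<and> pos (\<beta> + \<gamma>)"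
    using rho.maximal_root_exists[OF conn nonempty] unfolding rho_pos_roots by auto
  \<comment> \<open>Climb from \<open>\<beta>\<close> to \<open>\<theta>\<close> by adding positive
    roots; no coefficient decreases on the way, and the number of roots of greater height
    does.\<close>
  have le: "coweight \<alpha> \<bullet> \<beta> \<le> coweight \<alpha> \<bullet> \<theta>" if "pos \<beta>" "\<alpha> \<in> \<Delta>" for \<alpha> \<beta>
    using that(1)
  proof (induction "card {\<gamma> \<in> \<Phi>. \<gamma> \<bullet> rho > \<beta> \<bullet> rho}" arbitrary: \<beta> rule: less_induct)
    case less
    show ?case
    proof (cases "\<beta> = \<theta>")
      case False
      then obtain \<gamma> where g: "pos \<gamma>" "pos (\<beta> + \<gamma>)" using max less.prems by blast
      have "{\<delta> \<in> \<Phi>. \<delta> \<bullet> rho > (\<beta> + \<gamma>) \<bullet> rho} \<subset> {\<delta> \<in> \<Phi>. \<delta> \<bullet> rho > \<beta> \<bullet> rho}"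
      proof (rule psubsetI)
        show "{\<delta> \<in> \<Phi>. \<delta> \<bullet> rho > (\<beta> + \<gamma>) \<bullet> rho} \<subseteq> {\<delta> \<in> \<Phi>. \<delta> \<bullet> rho > \<beta> \<bullet> rho}"
          using rho_pos[OF g(1)] by (auto simp: inner_add_left)
        have "\<beta> + \<gamma> \<in> {\<delta> \<in> \<Phi>. \<delta> \<bullet> rho > \<beta> \<bullet> rho}"
          using rho_pos[OF g(1)] pos_root[OF g(2)] by (simp add: inner_add_left)
        then show "{\<delta> \<in> \<Phi>. \<delta> \<bullet> rho > (\<beta> + \<gamma>) \<bullet> rho} \<noteq> {\<delta> \<in> \<Phi>. \<delta> \<bullet> rho > \<beta> \<bullet> rho}"
          by blast
      qed
      then have "card {\<delta> \<in> \<Phi>. \<delta> \<bullet> rho > (\<beta> + \<gamma>) \<bullet> rho} < card {\<delta> \<in> \<Phi>. \<delta> \<bullet> rho > \<beta> \<bullet> rho}"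
        by (intro psubset_card_mono) auto
      then have "coweight \<alpha> \<bullet> (\<beta> + \<gamma>) \<le> coweight \<alpha> \<bullet> \<theta>" using less.hyps g by blast
      then show ?thesis using pos_coef[OF g(1) that(2)] by (simp add: inner_add_right)
    qed simp
  qed
  have "coweight \<alpha> \<bullet> \<beta> \<le> coweight \<alpha> \<bullet> \<theta>" if "\<beta> \<in> \<Phi>" "\<alpha> \<in> \<Delta>" for \<alpha> \<beta>
    using pos_or_neg_root[OF that(1)] le[OF _ that(2), of \<beta>] pos_coef[of "- \<beta>" \<alpha>] pos_coef[OF th that(2)] that
    by auto
  then show ?thesis using pos_root[OF th] by blast
qed

abbreviation hr :: 'a where "hr \<equiv> highest_root \<Phi> \<Delta>"

text \<open>The condition under \<open>THE\<close> is equivalent to dominance in every coefficient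
  (\<open>P\<close>), which determines the root uniquely because the coefficients determine
  it.\<close>

lemma highest_root: "hr \<in> \<Phi>"
  and highest_root_coef: "\<beta> \<in> \<Phi> \<Longrightarrow> \<alpha> \<in> \<Delta> \<Longrightarrow> coweight \<alpha> \<bullet> \<beta> \<le> coweight \<alpha> \<bullet> hr"
proof -
  let ?P = "\<lambda>\<theta>. \<theta> \<in> \<Phi> \<and> (\<forall>\<beta>\<in>\<Phi>. \<exists>c :: 'a \<Rightarrow> nat. \<theta> - \<beta> = (\<Sum>\<alpha>\<in>\<Delta>. of_nat (c \<alpha>) *\<^sub>R \<alpha>))"
  have P: "?P \<theta> \<longleftrightarrow> \<theta> \<in> \<Phi> \<and> (\<forall>\<beta>\<in>\<Phi>. \<forall>\<alpha>\<in>\<Delta>. coweight \<alpha> \<bullet> \<beta> \<le> coweight \<alpha> \<bullet> \<theta>)" (is "_ \<longleftrightarrow> ?Q \<theta>") for \<theta>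
  proof
    assume p: "?P \<theta>"
    have "coweight \<alpha> \<bullet> \<beta> \<le> coweight \<alpha> \<bullet> \<theta>" if b: "\<beta> \<in> \<Phi>" and a: "\<alpha> \<in> \<Delta>" for \<alpha> \<beta>
    proof -
      obtain c :: "'a \<Rightarrow> nat" where c: "\<theta> - \<beta> = (\<Sum>\<alpha>\<in>\<Delta>. of_nat (c \<alpha>) *\<^sub>R \<alpha>)"
        using p b by blast
      have "coweight \<alpha> \<bullet> (\<theta> - \<beta>) = of_nat (c \<alpha>)" unfolding c using a by (rule coweight_sum)
      then show ?thesis by (simp add: inner_diff_right)
    qed
    with p show "?Q \<theta>" by blast
  next
    assume q: "?Q \<theta>"
    have "\<exists>c :: 'a \<Rightarrow> nat. \<theta> - \<beta> = (\<Sum>\<alpha>\<in>\<Delta>. of_nat (c \<alpha>) *\<^sub>R \<alpha>)" if b: "\<beta> \<in> \<Phi>" for \<beta>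
    proof -
      have "\<theta> - \<beta> = (\<Sum>\<alpha>\<in>\<Delta>. (coweight \<alpha> \<bullet> (\<theta> - \<beta>)) *\<^sub>R \<alpha>)"
        using q b by (intro base_expand span_diff root_span) auto
      also have "\<dots> = (\<Sum>\<alpha>\<in>\<Delta>. of_nat (nat \<lfloor>coweight \<alpha> \<bullet> (\<theta> - \<beta>)\<rfloor>) *\<^sub>R \<alpha>)"
      proof (rule sum.cong)
        fix \<alpha> assume a: "\<alpha> \<in> \<Delta>"
        have "coweight \<alpha> \<bullet> (\<theta> - \<beta>) \<in> \<int>" "0 \<le> coweight \<alpha> \<bullet> (\<theta> - \<beta>)"
          using q a b coef_int by (auto simp: inner_diff_right)
        then have "of_nat (nat \<lfloor>coweight \<alpha> \<bullet> (\<theta> - \<beta>)\<rfloor>) = coweight \<alpha> \<bullet> (\<theta> - \<beta>)"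
          by (auto elim!: Ints_cases)
        then show "(coweight \<alpha> \<bullet> (\<theta> - \<beta>)) *\<^sub>R \<alpha> = of_nat (nat \<lfloor>coweight \<alpha> \<bullet> (\<theta> - \<beta>)\<rfloor>) *\<^sub>R \<alpha>"
          by simp
      qed simp
      finally show ?thesis by (rule exI[of _ "\<lambda>\<alpha>. nat \<lfloor>coweight \<alpha> \<bullet> (\<theta> - \<beta>)\<rfloor>"])
    qed
    with q show "?P \<theta>" by blast
  qed
  have "\<exists>!\<theta>. ?P \<theta>"
  proof (rule ex_ex1I)
    show "\<exists>\<theta>. ?P \<theta>" unfolding P using highest_root_exists by blast
    fix \<theta> \<theta>' assume "?P \<theta>" "?P \<theta>'"
    then have "?Q \<theta>" "?Q \<theta>'" unfolding P by auto
    then show "\<theta> = \<theta>'" by (intro base_eqI root_span) (auto intro: order_antisym)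
  qed
  then have "?P hr" unfolding highest_root_def by (rule theI')
  then show "hr \<in> \<Phi>" "\<beta> \<in> \<Phi> \<Longrightarrow> \<alpha> \<in> \<Delta> \<Longrightarrow> coweight \<alpha> \<bullet> \<beta> \<le> coweight \<alpha> \<bullet> hr"
    unfolding P by auto
qed

lemma highest_root_coef_ge1: "\<alpha> \<in> \<Delta> \<Longrightarrow> 1 \<le> coweight \<alpha> \<bullet> hr"
  using highest_root_coef[of \<alpha> \<alpha>] base_root by (simp add: coweight_dual)

lemma highest_root_pos: "pos hr"
  using highest_root highest_root_coef_ge1 by (force simp: pos_def)

text \<open>The coefficients of \<open>hr\<close> and \<open>g j\<close> at \<open>j\<close> are
  both 1, so \<open>hr - g j\<close> is a non-negative combination of the other simple roots and the
  inverse \<open>h\<close> makes it non-positive. Hence \<open>h hr\<close> is bounded by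
  \<open>j\<close>; being positive with coefficient 1 at \<open>j\<close>, it equals
  \<open>j\<close>.\<close>

lemma negates_top:
  assumes g: "negates (\<Delta> - {j}) g" and j: "j \<in> \<Delta>" and one: "coweight j \<bullet> hr = 1"
  shows "g j = hr"
proof -
  let ?K = "\<Delta> - {j}"
  have K: "?K \<subseteq> \<Delta>" by blast
  have gK: "g \<in> reflection_group ?K" using g by (simp add: negates_def)
  obtain h where h: "h \<in> reflection_group ?K" "g \<circ> h = id" "h \<circ> g = id"
    using reflection_group_inverse[OF gK] by blast
  note hn = negates_inverse[OF g K h(1,2)]
  have hlin: "linear h" using h reflection_group_linear by auto
  have gr: "g j \<in> \<Phi>" "h hr \<in> \<Phi>"
    using gK h weyl_root reflection_group_mono[OF K] j base_root highest_root by blast+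
  have coefj: "coweight j \<bullet> g j = 1" "coweight j \<bullet> h hr = 1"
    using coef_invariant[OF gK K j] coef_invariant[OF h(1) K j] j one by (simp_all add: coweight_dual)
  have "h (hr - g j) = h hr - j"
    using h(3) by (simp add: linear_diff[OF hlin]) (metis comp_apply id_apply)
  moreover have "coweight c \<bullet> h (hr - g j) \<le> 0" if "c \<in> \<Delta>" for c
    by (rule negates_cone[OF hn K _ _ _ that])
       (use gr highest_root highest_root_coef[OF gr(1)] coefj one in
         \<open>auto intro: span_diff root_span simp: inner_diff_right\<close>)
  ultimately have le: "coweight c \<bullet> h hr \<le> coweight c \<bullet> j" if "c \<in> \<Delta>" for c
    using that by (simp add: inner_diff_right)
  have p: "pos (h hr)" using pos_if_coef[OF gr(2) j] coefj by simp
  have "h hr = j"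
  proof (rule base_eqI)
    fix c assume c: "c \<in> \<Delta>"
    show "coweight c \<bullet> h hr = coweight c \<bullet> j"
      using le[OF c] pos_coef[OF p c] coefj c j by (cases "c = j") (auto simp: coweight_dual)
  qed (use gr j root_span base_root in auto)
  then show ?thesis using h(2) by (metis comp_apply id_apply)
qed

text \<open>The vector \<open>hr + h hr\<close> has non-negative coefficients, so its image
  \<open>g hr + hr\<close> has non-positive ones. The opposite inequality says that
  \<open>hr\<close> dominates the root \<open>- g hr\<close>.\<close>

lemma longest_highest: "negates \<Delta> g \<Longrightarrow> g hr = - hr"
proof -
  assume g: "negates \<Delta> g"
  have gG: "g \<in> reflection_group \<Delta>" using g by (simp add: negates_def)
  obtain h where h: "h \<in> reflection_group \<Delta>" "g \<circ> h = id" "h \<circ> g = id"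
    using reflection_group_inverse[OF gG] by blast
  note hn = negates_inverse[OF g order_refl h(1,2)]
  have lin: "linear h" "linear g" using h gG reflection_group_linear by auto
  have r: "g hr \<in> \<Phi>" "h hr \<in> \<Phi>" using weyl_root h gG highest_root by auto
  have sp: "hr + h hr \<in> span \<Delta>" using r highest_root by (intro span_add root_span)
  have "0 \<le> coweight b \<bullet> (hr + h hr)" if "b \<in> \<Delta>" for b
    using highest_root_coef[of "- h hr" b] r that by (simp add: inner_add_right)
  then have "coweight c \<bullet> g (hr + h hr) \<le> 0" if "c \<in> \<Delta>" for c
    by (intro negates_cone[OF g order_refl sp _ _ that]) auto
  moreover have "g (hr + h hr) = g hr + hr"
    using h(2) by (simp add: linear_add[OF lin(2)]) (metis comp_apply id_apply)
  ultimately have "coweight c \<bullet> g hr \<le> - (coweight c \<bullet> hr)" if "c \<in> \<Delta>" for c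
    using that by (simp add: inner_add_right add.commute) (smt (verit))
  moreover have "- (coweight c \<bullet> hr) \<le> coweight c \<bullet> g hr" if "c \<in> \<Delta>" for c
    using highest_root_coef[of "- g hr" c] r that by auto
  ultimately show ?thesis
    using r highest_root by (intro base_eqI root_span) (auto intro: order_antisym)
qed

lemma affine_root_not_simple: "- hr \<notin> \<Delta>"
  using pos_not_uminus[OF highest_root_pos] simple_pos_root by blast

lemma representation_base: "x \<in> span \<Delta> \<Longrightarrow> independent \<Delta> \<Longrightarrow> \<alpha> \<in> \<Delta> \<Longrightarrow> representation \<Delta> x \<alpha> = coweight \<alpha> \<bullet> x"
  using coweight_sum[of \<alpha> "representation \<Delta> x"] sum_representation_eq[of \<Delta> x \<Delta>] by simp

text \<open>Both \<open>- v\<close> on \<open>\<Delta>\<close> and \<open>- u\<close> on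
  \<open>\<Delta> - {j}\<close> take simple roots to simple roots. The exceptional root
  \<open>j\<close> is exchanged with \<open>hr\<close> by \<open>u\<close>, while \<open>v\<close>
  negates \<open>hr\<close>; so \<open>\<omega>\<close> maps \<open>- hr\<close> to
  \<open>j\<close>, and a simple root \<open>a\<close> with \<open>- v a = j\<close> to
  \<open>- hr\<close>.\<close>

lemma Omega_permutes:
  assumes \<omega>: "\<omega> \<in> Omega \<Phi> \<Delta>" and ind: "independent \<Delta>"
  shows "\<omega> \<in> reflection_group \<Delta>" and "\<omega> ` insert (- hr) \<Delta> \<subseteq> insert (- hr) \<Delta>"
proof -
  obtain j where j: "j \<in> special_nodes \<Phi> \<Delta>"
    and om: "\<omega> = longest_element (\<Delta> - {j}) \<circ> longest_element \<Delta>"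
    using \<omega> by (auto simp: Omega_def)
  define u where "u = longest_element (\<Delta> - {j})"
  define v where "v = longest_element \<Delta>"
  have u: "negates (\<Delta> - {j}) u" and v: "negates \<Delta> v"
    unfolding u_def v_def by (auto intro!: longest_negates)
  have uG: "u \<in> reflection_group \<Delta>" and vG: "v \<in> reflection_group \<Delta>"
    using u v reflection_group_mono[of "\<Delta> - {j}" \<Delta>] by (auto simp: negates_def)
  then have lin: "linear u" "linear v" using reflection_group_linear by auto
  show "\<omega> \<in> reflection_group \<Delta>"
    using reflection_group_comp[OF uG vG] om by (simp add: u_def v_def)
  have om_apply: "\<omega> x = u (v x)" for x using om by (simp add: u_def v_def)
  have vs: "- v a \<in> \<Delta>" if "a \<in> \<Delta>" for a using negates_simple[OF v order_refl that] .
  show "\<omega> ` insert (- hr) \<Delta> \<subseteq> insert (- hr) \<Delta>"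
  proof (cases "j = - hr")
    case True
    then have "\<Delta> - {j} = \<Delta>" using affine_root_not_simple by auto
    then have "u = v" by (simp add: u_def v_def)
    then have "\<omega> a \<in> \<Delta>" if "a \<in> \<Delta>" for a
      using vs[OF vs[OF that]] om_apply linear_neg[OF lin(2)] by simp
    moreover have "\<omega> (- hr) = - hr"
      using \<open>u = v\<close> longest_highest[OF v] om_apply linear_neg[OF lin(2)] by simp
    ultimately show ?thesis by auto
  next
    case False
    then have jD: "j \<in> \<Delta>" and "mark \<Phi> \<Delta> j = 1"
      using j by (auto simp: special_nodes_def affine_root_def)
    then have one: "coweight j \<bullet> hr = 1"
      using False representation_base[OF root_span[OF highest_root] ind jD]
      by (simp add: mark_def affine_root_def)
    have K: "\<Delta> - {j} \<subseteq> \<Delta>" by blast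
    have uj: "u j = hr" by (rule negates_top[OF u jD one])
    have "\<omega> a \<in> insert (- hr) \<Delta>" if a: "a \<in> \<Delta>" for a
    proof (cases "- v a = j")
      case True
      then have "v a = - j" by (metis minus_minus)
      then have "\<omega> a = - u j" using om_apply linear_neg[OF lin(1), of j] by simp
      then show ?thesis using uj by simp
    next
      case False
      then have "- u (- v a) \<in> \<Delta> - {j}" using vs[OF a] by (intro negates_simple[OF u K]) auto
      then show ?thesis using om_apply linear_neg[OF lin(1), of "v a"] by simp
    qed
    moreover have "\<omega> (- hr) = j"
    proof -
      have uK: "u \<in> reflection_group (\<Delta> - {j})" using u by (simp add: negates_def)
      obtain h where h: "h \<in> reflection_group (\<Delta> - {j})" "u \<circ> h = id" "h \<circ> u = id"
        using reflection_group_inverse[OF uK] by blast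
      have "h j = hr"
        by (rule negates_top[OF negates_inverse[OF u K h(1,2)] jD one])
      then have "u hr = j" using h(2) by (metis comp_apply id_apply)
      then show ?thesis using longest_highest[OF v] om_apply linear_neg[OF lin(2)] by simp
    qed
    ultimately show ?thesis using jD by auto
  qed
qed

end

section \<open>The action on the extended basis\<close>

lemma coroot_scale: "(coroot \<beta> \<bullet> x) *\<^sub>R \<beta> = (\<beta> \<bullet> x) *\<^sub>R coroot \<beta>"
  by (simp add: coroot_def)

context crystallographic
begin

text \<open>Lists allow repetition, and negatives of roots are roots, so this is the whole lattice.
  The number of summands serves as the induction measure in
  \<open>minuscule_in_coroot_lattice\<close>.\<close>

definition coroot_lattice :: "'a set" where
  "coroot_lattice = {sum_list (map coroot \<beta>s) | \<beta>s. set \<beta>s \<subseteq> \<Phi>}"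

lemma coroot_lattice_0: "0 \<in> coroot_lattice"
  unfolding coroot_lattice_def by (auto intro!: exI[of _ "[]"])

lemma coroot_lattice_add:
  assumes "u \<in> coroot_lattice" "v \<in> coroot_lattice" shows "u + v \<in> coroot_lattice"
proof -
  obtain \<beta>s \<gamma>s where "set \<beta>s \<subseteq> \<Phi>" "set \<gamma>s \<subseteq> \<Phi>"
    "u = sum_list (map coroot \<beta>s)" "v = sum_list (map coroot \<gamma>s)"
    using assms by (auto simp: coroot_lattice_def)
  then show ?thesis
    unfolding coroot_lattice_def by (intro CollectI exI[of _ "\<beta>s @ \<gamma>s"]) auto
qed

lemma coroot_lattice_uminus:
  assumes "u \<in> coroot_lattice" shows "- u \<in> coroot_lattice"
proof -
  obtain \<beta>s where "set \<beta>s \<subseteq> \<Phi>" "u = sum_list (map coroot \<beta>s)"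
    using assms by (auto simp: coroot_lattice_def)
  moreover have "- sum_list (map coroot \<beta>s) = sum_list (map coroot (map uminus \<beta>s))"
    by (induction \<beta>s) (simp_all add: coroot_def)
  ultimately show ?thesis
    unfolding coroot_lattice_def by (intro CollectI exI[of _ "map uminus \<beta>s"]) auto
qed

lemma coroot_lattice_coroot: "\<beta> \<in> \<Phi> \<Longrightarrow> coroot \<beta> \<in> coroot_lattice"
  unfolding coroot_lattice_def by (intro CollectI exI[of _ "[\<beta>]"]) auto

lemma coroot_lattice_sum: "(\<And>i. i \<in> I \<Longrightarrow> f i \<in> coroot_lattice) \<Longrightarrow> sum f I \<in> coroot_lattice"
  by (induction I rule: infinite_finite_induct)
     (auto simp: coroot_lattice_0 intro: coroot_lattice_add)

lemma coroot_lattice_of_nat: "u \<in> coroot_lattice \<Longrightarrow> of_nat n *\<^sub>R u \<in> coroot_lattice"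
  by (induction n) (auto simp: scaleR_add_left coroot_lattice_0 intro: coroot_lattice_add)

lemma coroot_lattice_of_int: "u \<in> coroot_lattice \<Longrightarrow> of_int n *\<^sub>R u \<in> coroot_lattice"
proof (cases n rule: int_cases2)
  case (nonpos k)
  assume "u \<in> coroot_lattice"
  then have "- (of_nat k *\<^sub>R u) \<in> coroot_lattice"
    by (intro coroot_lattice_uminus coroot_lattice_of_nat)
  then show ?thesis unfolding nonpos by simp
qed (simp add: coroot_lattice_of_nat)

text \<open>The group acts trivially on coweights modulo the coroot lattice: each reflection in a
  word subtracts a multiple of a coroot. The multiple is the pairing of \<open>v\<close> with the
  root moved back by the reversed word, hence an integer.\<close>

lemma coweight_diff_coroot_lattice:
  assumes w: "w \<in> reflection_group K" and K: "K \<subseteq> \<Phi>" and v: "\<And>\<beta>. \<beta> \<in> \<Phi> \<Longrightarrow> v \<bullet> \<beta> \<in> \<int>"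
  shows "v - w v \<in> coroot_lattice"
proof -
  have "v - refl_word as v \<in> coroot_lattice" if "set as \<subseteq> \<Phi>" for as
    using that
  proof (induction as)
    case (Cons a as)
    have "refl_word (rev as) a \<in> \<Phi>"
      using Cons.prems by (intro reflection_group_root[OF refl_word_in_group, of _ \<Phi>]) auto
    then have "v \<bullet> refl_word (rev as) a \<in> \<int>" by (rule v)
    moreover have "v \<bullet> refl_word (rev as) a = refl_word as v \<bullet> refl_word as (refl_word (rev as) a)"
      by simp
    moreover have "refl_word as (refl_word (rev as) a) = a"
      using refl_word_rev'[of as] by (metis comp_apply id_apply)
    ultimately have "a \<bullet> refl_word as v \<in> \<int>" by (simp add: inner_commute)
    then obtain n :: int where n: "a \<bullet> refl_word as v = of_int n" by (auto elim: Ints_cases)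
    have "v - refl_word (a # as) v = (v - refl_word as v) + of_int n *\<^sub>R coroot a"
      by (simp add: root_reflection_def coroot_scale n)
    moreover have "(v - refl_word as v) + of_int n *\<^sub>R coroot a \<in> coroot_lattice"
      using Cons by (intro coroot_lattice_add coroot_lattice_of_int coroot_lattice_coroot) auto
    ultimately show ?case by (simp only:)
  qed (simp add: coroot_lattice_0)
  then show ?thesis
    using w K by (auto simp: reflection_group_eq subset_iff)
qed

text \<open>Reflecting \<open>v \<noteq> 0\<close> in a suitable summand shortens its expression as a sum of
  coroots and preserves its norm.\<close>

lemma minuscule_in_coroot_lattice:
  assumes "v \<in> coroot_lattice" "\<And>\<beta>. \<beta> \<in> \<Phi> \<Longrightarrow> v \<bullet> \<beta> \<in> {-1, 0, 1}"
  shows "v = 0"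
proof -
  have "v = 0" if "set \<beta>s \<subseteq> \<Phi>" "v = sum_list (map coroot \<beta>s)"
    "\<And>\<beta>. \<beta> \<in> \<Phi> \<Longrightarrow> v \<bullet> \<beta> \<in> {-1, 0, 1}" for \<beta>s v
    using that
  proof (induction "length \<beta>s" arbitrary: \<beta>s v)
    case (Suc n)
    show ?case
    proof (rule ccontr)
      assume "v \<noteq> 0"
      then have "0 < v \<bullet> v" by simp
      moreover have "v \<bullet> sum_list (map coroot \<beta>s) = (\<Sum>\<beta>\<leftarrow>\<beta>s. v \<bullet> coroot \<beta>)"
        by (induction \<beta>s) (auto simp: inner_add_right)
      ultimately have "0 < (\<Sum>\<beta>\<leftarrow>\<beta>s. v \<bullet> coroot \<beta>)"
        unfolding Suc.prems(2)[symmetric] by simp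
      then obtain \<beta> where b: "\<beta> \<in> set \<beta>s" "0 < v \<bullet> coroot \<beta>"
        using sum_list_nonpos[of "map (\<lambda>\<beta>. v \<bullet> coroot \<beta>) \<beta>s"] by (force simp: not_less)
      then have bP: "\<beta> \<in> \<Phi>" using Suc.prems by blast
      then have "0 < v \<bullet> \<beta>" using b inner_ge_zero[of \<beta>] by (auto simp: coroot_def zero_less_divide_iff)
      then have vb: "v \<bullet> \<beta> = 1" using Suc.prems(3)[OF bP] by auto
      have "root_reflection \<beta> v = v - coroot \<beta>"
        using vb coroot_scale[of \<beta> v] inner_commute[of \<beta> v] by (simp add: root_reflection_def)
      also have "\<dots> = sum_list (map coroot (remove1 \<beta> \<beta>s))"
        using b Suc.prems(2) by (simp add: sum_list_map_remove1)
      finally have r: "root_reflection \<beta> v = sum_list (map coroot (remove1 \<beta> \<beta>s))" .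
      have "root_reflection \<beta> v = 0"
      proof (rule Suc.hyps(1)[OF _ _ r])
        show "n = length (remove1 \<beta> \<beta>s)" using Suc.hyps(2) b by (simp add: length_remove1)
        show "set (remove1 \<beta> \<beta>s) \<subseteq> \<Phi>" using Suc.prems(1) set_remove1_subset by fastforce
        show "root_reflection \<beta> v \<bullet> \<gamma> \<in> {-1, 0, 1}" if "\<gamma> \<in> \<Phi>" for \<gamma>
          using Suc.prems(3)[OF reflection_closed[OF bP that]] by (simp add: root_reflection_inner_left)
      qed
      then show False
        using \<open>v \<noteq> 0\<close> root_reflection_inner[of \<beta> v v] by simp
    qed
  qed simp
  then show ?thesis using assms by (auto simp: coroot_lattice_def)
qed

end

section \<open>Orbits and averages of an isometry of finite order\<close>

locale isometry_of_finite_order =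
  fixes \<omega> :: "'a::euclidean_space \<Rightarrow> 'a" and m :: nat
  assumes om_linear: "linear \<omega>"
    and om_inner [simp]: "\<omega> x \<bullet> \<omega> y = x \<bullet> y"
    and order_pos: "0 < m"
    and om_order: "\<omega> ^^ m = id"
begin

lemma om_bij: "bij \<omega>"
proof (rule o_bij)
  have *: "\<omega> ^^ m = \<omega> \<circ> \<omega> ^^ (m - 1)" "\<omega> ^^ m = \<omega> ^^ (m - 1) \<circ> \<omega>"
    using order_pos by (metis funpow.simps(2) Suc_pred', metis funpow_Suc_right Suc_pred')
  then show "\<omega> ^^ (m - 1) \<circ> \<omega> = id" "\<omega> \<circ> \<omega> ^^ (m - 1) = id"
    using om_order by auto
qed

lemma om_inj: "\<omega> x = \<omega> y \<longleftrightarrow> x = y"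
  using om_bij by (auto simp: bij_def inj_def)

lemma pow_linear: "linear (\<omega> ^^ n)"
proof (induction n)
  case (Suc n)
  then show ?case unfolding funpow.simps by (intro linear_compose om_linear)
qed (simp add: id_def linear_ident)

lemma pow_inner [simp]: "(\<omega> ^^ n) x \<bullet> (\<omega> ^^ n) y = x \<bullet> y"
  by (induction n) simp_all

lemma pow_bij: "bij (\<omega> ^^ n)"
  using om_bij by (simp add: bij_betw_funpow)

lemma pow_inj: "(\<omega> ^^ n) x = (\<omega> ^^ n) y \<longleftrightarrow> x = y"
  using pow_bij[of n] by (auto simp: bij_def inj_def)

lemma pow_mult_order: "(\<omega> ^^ (m * n)) x = x"
  by (simp add: funpow_mult[symmetric] om_order)

lemma pow_mod: "(\<omega> ^^ (n mod m)) x = (\<omega> ^^ n) x"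
proof -
  have "(\<omega> ^^ n) x = (\<omega> ^^ (n mod m + m * (n div m))) x" by simp
  also have "\<dots> = (\<omega> ^^ (n mod m)) x"
    by (simp only: funpow_add comp_apply pow_mult_order)
  finally show ?thesis by simp
qed

lemma pow_inverse: "(\<omega> ^^ (m * n - n)) ((\<omega> ^^ n) x) = x"
proof -
  have "m * n - n + n = m * n" using order_pos by simp
  then show ?thesis using pow_mult_order[of n x] by (metis comp_apply funpow_add)
qed

text \<open>Natural exponents already give the full orbit, since inverses are natural powers by
  \<open>pow_inverse\<close>.\<close>

definition orb :: "'a \<Rightarrow> 'a set" where
  "orb x = range (\<lambda>t. (\<omega> ^^ t) x)"

lemma orb_eq: "orb x = (\<lambda>t. (\<omega> ^^ t) x) ` {..<m}"
  unfolding orb_def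
proof (intro equalityI subsetI)
  fix y assume "y \<in> range (\<lambda>t. (\<omega> ^^ t) x)"
  then obtain t where "y = (\<omega> ^^ t) x" by blast
  then show "y \<in> (\<lambda>t. (\<omega> ^^ t) x) ` {..<m}"
    using order_pos pow_mod[of t x] by (intro image_eqI[of _ _ "t mod m"]) auto
qed auto

lemma finite_orb [simp]: "finite (orb x)"
  by (simp add: orb_eq)

lemma orb_self: "x \<in> orb x"
  unfolding orb_def by (intro range_eqI[of _ _ 0]) simp

lemma orb_card_pos: "0 < card (orb x)"
  using orb_self by (auto simp: card_gt_0_iff)

lemma orb_sub: "y \<in> orb x \<Longrightarrow> orb y \<subseteq> orb x"
proof -
  have "(\<omega> ^^ s) ((\<omega> ^^ t) x) = (\<omega> ^^ (s + t)) x" for s t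
    by (simp add: funpow_add)
  then show "y \<in> orb x \<Longrightarrow> orb y \<subseteq> orb x" unfolding orb_def by auto
qed

lemma orb_sym: "y \<in> orb x \<Longrightarrow> x \<in> orb y"
proof -
  assume "y \<in> orb x"
  then obtain t where "y = (\<omega> ^^ t) x" by (auto simp: orb_def)
  then have "x = (\<omega> ^^ (m * t - t)) y" by (simp add: pow_inverse)
  then show ?thesis unfolding orb_def by (rule range_eqI)
qed

lemma orb_cong: "y \<in> orb x \<Longrightarrow> orb y = orb x"
  using orb_sub orb_sym by blast

lemma orb_om: "y \<in> orb x \<Longrightarrow> \<omega> y \<in> orb x"
proof -
  assume "y \<in> orb x"
  then obtain t where "y = (\<omega> ^^ t) x" by (auto simp: orb_def)
  then have "\<omega> y = (\<omega> ^^ Suc t) x" by simp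
  then show ?thesis unfolding orb_def by (rule range_eqI)
qed

lemma bij_betw_orb: "bij_betw \<omega> (orb x) (orb x)"
  unfolding bij_betw_def
proof
  show "inj_on \<omega> (orb x)" using om_bij by (simp add: bij_def inj_on_def inj_def)
  then show "\<omega> ` orb x = orb x"
    using orb_om by (intro endo_inj_surj) auto
qed

text \<open>This is the orthogonal projection to the fixed space.\<close>

definition avg :: "'a \<Rightarrow> 'a" where
  "avg x = (1 / of_nat m) *\<^sub>R (\<Sum>t<m. (\<omega> ^^ t) x)"

lemma avg_linear: "linear avg"
  unfolding avg_def
  by (intro linear_compose_scale_right linear_compose_sum ballI pow_linear)

lemma sum_pow_Suc: "(\<Sum>t<m. (\<omega> ^^ Suc t) x) = (\<Sum>t<m. (\<omega> ^^ t) x)"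
proof -
  have "(\<Sum>t<m. (\<omega> ^^ Suc t) x) + (\<omega> ^^ 0) x = (\<Sum>t<Suc m. (\<omega> ^^ t) x)"
    by (subst sum.lessThan_Suc_shift) simp
  also have "\<dots> = (\<Sum>t<m. (\<omega> ^^ t) x) + x" by (simp add: om_order)
  finally show ?thesis by simp
qed

lemma avg_om: "avg (\<omega> x) = avg x"
proof -
  have "(\<Sum>t<m. (\<omega> ^^ t) (\<omega> x)) = (\<Sum>t<m. (\<omega> ^^ Suc t) x)"
    by (simp add: funpow_swap1)
  then show ?thesis unfolding avg_def using sum_pow_Suc by simp
qed

lemma om_avg: "\<omega> (avg x) = avg x"
proof -
  have "\<omega> (\<Sum>t<m. (\<omega> ^^ t) x) = (\<Sum>t<m. (\<omega> ^^ Suc t) x)"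
    by (simp add: linear_sum[OF om_linear])
  then show ?thesis
    unfolding avg_def using sum_pow_Suc by (simp add: linear_cmul[OF om_linear])
qed

lemma avg_orb: "y \<in> orb x \<Longrightarrow> avg y = avg x"
proof -
  have "avg ((\<omega> ^^ t) x) = avg x" for t
    by (induction t) (simp_all add: avg_om)
  then show "y \<in> orb x \<Longrightarrow> avg y = avg x" by (auto simp: orb_def)
qed

lemma pow_fixed: "\<omega> x = x \<Longrightarrow> (\<omega> ^^ t) x = x"
  by (induction t) simp_all

lemma avg_fixed: "\<omega> x = x \<Longrightarrow> avg x = x"
  unfolding avg_def using order_pos by (simp add: pow_fixed sum_constant_scaleR)

lemma avg_inner_fixed: "\<omega> z = z \<Longrightarrow> avg x \<bullet> z = x \<bullet> z"
proof -
  assume z: "\<omega> z = z"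
  have "(\<omega> ^^ t) x \<bullet> z = x \<bullet> z" for t
    using pow_inner[of t x z] pow_fixed[OF z, of t] by simp
  then show ?thesis
    unfolding avg_def using order_pos by (simp add: inner_sum_left)
qed

lemma avg_inner: "avg x \<bullet> y = x \<bullet> avg y"
  using avg_inner_fixed[OF om_avg, of x y] avg_inner_fixed[OF om_avg, of y x]
  by (simp add: inner_commute)

lemma avg_uminus: "avg (- x) = - avg x"
  by (rule linear_neg[OF avg_linear])

lemma avg_0: "avg 0 = 0"
  by (rule linear_0[OF avg_linear])

text \<open>The sum over an orbit is fixed, so it equals its own average, and all members of the
  orbit have the same average.\<close>

lemma card_orb_avg: "of_nat (card (orb x)) *\<^sub>R avg x = (\<Sum>c\<in>orb x. c)"
proof -
  have "\<omega> (\<Sum>c\<in>orb x. c) = (\<Sum>c\<in>orb x. \<omega> c)"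
    by (rule linear_sum[OF om_linear])
  also have "\<dots> = (\<Sum>c\<in>orb x. c)"
    by (rule sum.reindex_bij_betw[OF bij_betw_orb])
  finally have "(\<Sum>c\<in>orb x. c) = avg (\<Sum>c\<in>orb x. c)" by (simp add: avg_fixed)
  also have "\<dots> = (\<Sum>c\<in>orb x. avg c)" by (rule linear_sum[OF avg_linear])
  also have "\<dots> = (\<Sum>c\<in>orb x. avg x)" by (rule sum.cong) (auto simp: avg_orb)
  finally show ?thesis by (simp add: sum_constant_scaleR)
qed

end

section \<open>The extended basis with its marks and coweights\<close>

locale folding = based_roots \<Phi> \<Delta> coweight + isometry_of_finite_order \<omega> m
  for \<Phi> :: "'a::euclidean_space set" and \<Delta> coweight and \<omega> :: "'a \<Rightarrow> 'a" and m +
  assumes om_weyl: "\<omega> \<in> reflection_group \<Delta>"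
    and om_perm: "\<omega> ` insert (- highest_root \<Phi> \<Delta>) \<Delta> \<subseteq> insert (- highest_root \<Phi> \<Delta>) \<Delta>"
    and order_min: "\<And>n. \<omega> ^^ n = id \<Longrightarrow> m dvd n"
begin

abbreviation a0 :: 'a where "a0 \<equiv> - hr"
abbreviation D0 :: "'a set" where "D0 \<equiv> insert a0 \<Delta>"

lemma a0_notin: "a0 \<notin> \<Delta>"
  by (rule affine_root_not_simple)

lemma om_root: "\<beta> \<in> \<Phi> \<Longrightarrow> \<omega> \<beta> \<in> \<Phi>"
  using om_weyl weyl_root by blast

lemma pow_root: "\<beta> \<in> \<Phi> \<Longrightarrow> (\<omega> ^^ t) \<beta> \<in> \<Phi>"
  by (induction t) (auto simp: om_root)

lemma orb_root: "\<beta> \<in> \<Phi> \<Longrightarrow> \<gamma> \<in> orb \<beta> \<Longrightarrow> \<gamma> \<in> \<Phi>"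
  by (auto simp: orb_def pow_root)

lemma om_span: "x \<in> span \<Delta> \<Longrightarrow> \<omega> x \<in> span \<Delta>"
  using reflection_group_span[OF om_weyl order_refl] .

lemma pow_span: "x \<in> span \<Delta> \<Longrightarrow> (\<omega> ^^ t) x \<in> span \<Delta>"
  by (induction t) (auto simp: om_span)

lemma avg_span: "x \<in> span \<Delta> \<Longrightarrow> avg x \<in> span \<Delta>"
  unfolding avg_def by (intro span_scale span_sum pow_span)

lemma om_D0: "a \<in> D0 \<Longrightarrow> \<omega> a \<in> D0"
  using om_perm by blast

lemma pow_D0: "a \<in> D0 \<Longrightarrow> (\<omega> ^^ t) a \<in> D0"
  by (induction t) (simp_all only: funpow.simps comp_apply id_apply om_D0)

lemma orb_D0: "a \<in> D0 \<Longrightarrow> c \<in> orb a \<Longrightarrow> c \<in> D0"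
  using pow_D0 by (auto simp: orb_def)

lemma bij_betw_D0: "bij_betw \<omega> D0 D0"
  unfolding bij_betw_def
proof
  show "inj_on \<omega> D0" using om_bij by (simp add: bij_def inj_on_def inj_def)
  then show "\<omega> ` D0 = D0" using om_perm by (intro endo_inj_surj) auto
qed

text \<open>A power that fixes the affine node maps \<open>\<Delta>\<close> into itself, so by
  \<open>pos_imp_id\<close> it is the identity. This is why the orbit of the affine node has exactly
  \<open>m\<close> elements.\<close>

lemma pow_a0_iff: "(\<omega> ^^ n) a0 = a0 \<longleftrightarrow> m dvd n"
proof
  assume eq: "(\<omega> ^^ n) a0 = a0"
  have "\<omega> ^^ n = id"
  proof (rule pos_imp_id[OF reflection_group_funpow[OF om_weyl] order_refl])
    fix a assume a: "a \<in> \<Delta>"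
    then have "(\<omega> ^^ n) a \<in> D0" "(\<omega> ^^ n) a \<noteq> a0"
      using pow_D0[of a] pow_inj[of n a a0] eq a0_notin by auto
    then show "pos ((\<omega> ^^ n) a)" using simple_pos_root by auto
  qed
  then show "m dvd n" by (rule order_min)
next
  assume "m dvd n"
  then show "(\<omega> ^^ n) a0 = a0" by (auto simp: dvd_def pow_mult_order)
qed

definition node_mark :: "'a \<Rightarrow> real" where
  "node_mark a = (if a = a0 then 1 else coweight a \<bullet> hr)"

text \<open>Giving the affine node the coweight \<open>0\<close> makes \<open>node_coweight_pair\<close> and \<open>om_node_coweight\<close>
  hold uniformly on the extended basis.\<close>

definition node_coweight :: "'a \<Rightarrow> 'a" where
  "node_coweight a = (if a = a0 then 0 else coweight a)"

lemma node_mark_a0 [simp]: "node_mark a0 = 1"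
  by (simp add: node_mark_def)

lemma node_mark_simple: "a \<in> \<Delta> \<Longrightarrow> node_mark a = coweight a \<bullet> hr"
  using a0_notin by (auto simp: node_mark_def)

lemma node_coweight_a0 [simp]: "node_coweight a0 = 0"
  by (simp add: node_coweight_def)

lemma node_coweight_simple: "a \<in> \<Delta> \<Longrightarrow> node_coweight a = coweight a"
  using a0_notin by (auto simp: node_coweight_def)

lemma node_mark_ge1: "a \<in> D0 \<Longrightarrow> 1 \<le> node_mark a"
  using highest_root_coef_ge1 by (auto simp: node_mark_def)

lemma node_mark_int: "a \<in> D0 \<Longrightarrow> node_mark a \<in> \<int>"
  using coef_int[OF highest_root] by (auto simp: node_mark_def)

lemma node_coweight_span: "a \<in> D0 \<Longrightarrow> node_coweight a \<in> span \<Delta>"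
  using coweight_span by (auto simp: node_coweight_def span_zero)

lemma node_coweight_int: "a \<in> D0 \<Longrightarrow> \<beta> \<in> \<Phi> \<Longrightarrow> node_coweight a \<bullet> \<beta> \<in> \<int>"
  using coef_int by (auto simp: node_coweight_def)

lemma node_coweight_pair:
  "a \<in> D0 \<Longrightarrow> b \<in> D0 \<Longrightarrow> node_coweight a \<bullet> b = (if a = b then 1 else 0) - (if b = a0 then node_mark a else 0)"
  using a0_notin by (auto simp: node_coweight_def node_mark_def coweight_dual)

lemma node_coweight_bound: "a \<in> D0 \<Longrightarrow> \<beta> \<in> \<Phi> \<Longrightarrow> \<bar>node_coweight a \<bullet> \<beta>\<bar> \<le> node_mark a"
  using highest_root_coef[of \<beta> a] highest_root_coef[of "- \<beta>" a]
  by (auto simp: node_coweight_def node_mark_def abs_le_iff)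

lemma node_mark_relation: "(\<Sum>a\<in>D0. node_mark a *\<^sub>R a) = 0"
proof -
  have "(\<Sum>a\<in>\<Delta>. node_mark a *\<^sub>R a) = (\<Sum>a\<in>\<Delta>. (coweight a \<bullet> hr) *\<^sub>R a)"
    by (rule sum.cong) (auto simp: node_mark_simple)
  also have "\<dots> = hr" using base_expand[OF root_span[OF highest_root]] by simp
  finally show ?thesis using a0_notin by simp
qed

text \<open>The linear relation among the extended basis is unique up to a factor, so transporting
  it by \<open>\<omega>\<close> multiplies all marks by \<open>node_mark (\<omega> a0)\<close>. The
  factor is 1 because the total of the marks is unchanged and positive.\<close>

lemma node_mark_om: "a \<in> D0 \<Longrightarrow> node_mark (\<omega> a) = node_mark a"
proof -
  have "\<omega> (\<Sum>a\<in>D0. node_mark (\<omega> a) *\<^sub>R a) = (\<Sum>a\<in>D0. node_mark (\<omega> a) *\<^sub>R \<omega> a)"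
    by (simp only: linear_sum[OF om_linear] linear_cmul[OF om_linear])
  also have "\<dots> = (\<Sum>a\<in>D0. node_mark a *\<^sub>R a)"
    by (rule sum.reindex_bij_betw[OF bij_betw_D0])
  also have "\<dots> = \<omega> 0" by (simp only: node_mark_relation linear_0[OF om_linear])
  finally have z: "(\<Sum>a\<in>D0. node_mark (\<omega> a) *\<^sub>R a) = 0" by (simp only: om_inj)
  have scaled: "node_mark (\<omega> b) = node_mark (\<omega> a0) * node_mark b" if b: "b \<in> \<Delta>" for b
  proof -
    have "0 = coweight b \<bullet> (\<Sum>a\<in>D0. node_mark (\<omega> a) *\<^sub>R a)" using z by simp
    also have "\<dots> = node_mark (\<omega> a0) * (coweight b \<bullet> a0) + coweight b \<bullet> (\<Sum>a\<in>\<Delta>. node_mark (\<omega> a) *\<^sub>R a)"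
      using a0_notin by (simp add: inner_add_right inner_diff_right)
    also have "\<dots> = - node_mark (\<omega> a0) * node_mark b + node_mark (\<omega> b)"
      using b by (simp add: coweight_sum node_mark_simple)
    finally show ?thesis by simp
  qed
  then have all: "node_mark (\<omega> b) = node_mark (\<omega> a0) * node_mark b" if "b \<in> D0" for b
    using that by (cases "b = a0") auto
  have "(\<Sum>a\<in>D0. node_mark a) = (\<Sum>a\<in>D0. node_mark (\<omega> a))"
    by (rule sum.reindex_bij_betw[OF bij_betw_D0, symmetric])
  also have "\<dots> = node_mark (\<omega> a0) * (\<Sum>a\<in>D0. node_mark a)"
    unfolding sum_distrib_left by (rule sum.cong[OF refl all])
  finally have "(\<Sum>a\<in>D0. node_mark a) = node_mark (\<omega> a0) * (\<Sum>a\<in>D0. node_mark a)" .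
  moreover have "(\<Sum>a\<in>D0. node_mark a) > 0"
  proof (rule sum_pos)
    show "0 < node_mark a" if "a \<in> D0" for a using node_mark_ge1[OF that] by linarith
  qed auto
  ultimately have "node_mark (\<omega> a0) = 1" by simp
  then show "a \<in> D0 \<Longrightarrow> node_mark (\<omega> a) = node_mark a" by (simp only: all mult_1_left)
qed

lemma node_mark_orb: "a \<in> D0 \<Longrightarrow> c \<in> orb a \<Longrightarrow> node_mark c = node_mark a"
proof -
  assume a: "a \<in> D0"
  have "node_mark ((\<omega> ^^ t) a) = node_mark a" for t
    by (induction t) (simp_all add: node_mark_om pow_D0[OF a] del: insert_iff)
  then show "c \<in> orb a \<Longrightarrow> node_mark c = node_mark a" by (auto simp: orb_def)
qed

lemma span_eqI:
  assumes "x \<in> span \<Delta>" "z \<in> span \<Delta>" "\<And>c. c \<in> \<Delta> \<Longrightarrow> x \<bullet> c = z \<bullet> c"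
  shows "x = z"
proof -
  have "(x - z) \<bullet> u = 0" if "u \<in> span \<Delta>" for u
    using that
  proof (induction rule: span_induct_alt)
    case (step c k u)
    then show ?case using assms(3) by (simp add: inner_add_right inner_diff_left)
  qed simp
  then have "(x - z) \<bullet> (x - z) = 0" using assms span_diff by blast
  then show ?thesis by simp
qed

section \<open>The translation part \<open>tau\<close> and the functional \<open>eta\<close>\<close>

abbreviation tau :: 'a where "tau \<equiv> node_coweight (\<omega> a0)"

text \<open>Geometrically, the affine map sending \<open>x\<close> to
  \<open>\<omega> x + tau\<close> permutes the alcove vertices
  \<open>node_coweight a / node_mark a\<close> as \<open>\<omega>\<close> permutes the nodes. The
  proof pairs both sides with simple roots written as \<open>\<omega> b\<close>, where
  \<open>b\<close> may be the affine node.\<close>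

lemma om_node_coweight:
  assumes a: "a \<in> D0"
  shows "\<omega> (node_coweight a) = node_coweight (\<omega> a) - node_mark a *\<^sub>R tau"
proof (rule span_eqI)
  fix c assume "c \<in> \<Delta>"
  then obtain b where b: "b \<in> D0" "c = \<omega> b"
    using bij_betw_D0 unfolding bij_betw_def by blast
  have a0: "a0 \<in> D0" by simp
  note D = a b(1) a0 om_D0[OF a] om_D0[OF b(1)] om_D0[OF a0]
  have "\<omega> (node_coweight a) \<bullet> c = node_coweight a \<bullet> b" by (simp add: b)
  also have "\<dots> = (if a = b then 1 else 0) - (if b = a0 then node_mark a else 0)"
    by (rule node_coweight_pair[OF D(1,2)])
  also have "\<dots> = (node_coweight (\<omega> a) - node_mark a *\<^sub>R tau) \<bullet> c"
    unfolding b(2) inner_diff_left inner_scaleR_left node_coweight_pair[OF D(4,5)] node_coweight_pair[OF D(6,5)]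
      om_inj node_mark_om[OF D(1)] node_mark_om[OF D(3)]
    by auto
  finally show "\<omega> (node_coweight a) \<bullet> c = (node_coweight (\<omega> a) - node_mark a *\<^sub>R tau) \<bullet> c" .
qed (use a in \<open>auto intro!: om_span node_coweight_span span_diff span_scale om_D0 simp del: insert_iff\<close>)

lemma tau_int: "\<beta> \<in> \<Phi> \<Longrightarrow> tau \<bullet> \<beta> \<in> \<int>"
  by (rule node_coweight_int[OF om_D0]) auto

text \<open>Up to the factor \<open>m\<close>, this is the barycentre of those vertices of the fundamental alcove that
  correspond to the orbit of the affine node. It is fixed by the affine map that induces \<open>\<omega>\<close>, so
  \<open>\<omega>\<close> changes the value of \<open>eta\<close> on a root by a multiple of \<open>m\<close> only.\<close>

definition eta :: 'a where
  "eta = (\<Sum>t<m. node_coweight ((\<omega> ^^ t) a0))"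

lemma pow_a0_D0: "(\<omega> ^^ t) a0 \<in> D0"
  by (rule pow_D0) simp

lemma node_mark_pow_a0: "node_mark ((\<omega> ^^ t) a0) = 1"
  using node_mark_orb[of a0 "(\<omega> ^^ t) a0"] by (simp add: orb_def)

lemma om_eta: "\<omega> eta = eta - of_nat m *\<^sub>R tau"
proof -
  have "\<omega> eta = (\<Sum>t<m. \<omega> (node_coweight ((\<omega> ^^ t) a0)))"
    unfolding eta_def by (rule linear_sum[OF om_linear])
  also have "\<dots> = (\<Sum>t<m. node_coweight ((\<omega> ^^ Suc t) a0) - tau)"
    by (simp only: om_node_coweight[OF pow_a0_D0] node_mark_pow_a0) simp
  also have "\<dots> = (\<Sum>t<m. node_coweight ((\<omega> ^^ Suc t) a0)) - of_nat m *\<^sub>R tau"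
    by (simp add: sum_subtractf sum_constant_scaleR)
  also have "(\<Sum>t<m. node_coweight ((\<omega> ^^ Suc t) a0)) = eta"
  proof -
    have "(\<Sum>t<m. node_coweight ((\<omega> ^^ Suc t) a0)) + node_coweight ((\<omega> ^^ 0) a0) = (\<Sum>t<Suc m. node_coweight ((\<omega> ^^ t) a0))"
      by (subst sum.lessThan_Suc_shift) simp
    also have "\<dots> = eta + node_coweight ((\<omega> ^^ m) a0)" by (simp add: eta_def)
    finally show ?thesis by (simp add: om_order)
  qed
  finally show ?thesis .
qed

lemma eta_om: "eta \<bullet> \<omega> x = eta \<bullet> x + of_nat m * (tau \<bullet> \<omega> x)"
  using om_inner[of eta x] unfolding om_eta by (simp add: inner_diff_left)

text \<open>Comparing \<open>eta\<close> at \<open>z\<close> and \<open>\<omega> z\<close> gives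
  \<open>tau \<bullet> z = 0\<close>. Then the coweights along the orbit, starting from the coweight
  0 of the affine node, all vanish at \<open>z\<close>.\<close>

lemma eta_fixed:
  assumes z: "\<omega> z = z"
  shows "eta \<bullet> z = 0"
proof -
  have tz: "tau \<bullet> z = 0" using eta_om[of z] z order_pos by simp
  have "node_coweight ((\<omega> ^^ t) a0) \<bullet> z = 0" for t
  proof (induction t)
    case (Suc t)
    have "node_coweight ((\<omega> ^^ Suc t) a0) = \<omega> (node_coweight ((\<omega> ^^ t) a0)) + tau"
      using om_node_coweight[OF pow_a0_D0, of t] by (simp add: node_mark_pow_a0)
    then have "node_coweight ((\<omega> ^^ Suc t) a0) \<bullet> z = \<omega> (node_coweight ((\<omega> ^^ t) a0)) \<bullet> \<omega> z"
      using tz z by (simp add: inner_add_left)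
    then show ?case using Suc by simp
  qed simp
  then show ?thesis by (simp add: eta_def inner_sum_left)
qed

text \<open>Each of the \<open>m\<close> summands has absolute value at most 1, the common mark of
  the orbit; the summand of the affine node itself is 0, which makes the bound strict.\<close>

lemma eta_bound:
  assumes b: "\<beta> \<in> \<Phi>"
  shows "\<bar>eta \<bullet> \<beta>\<bar> < of_nat m"
proof -
  have "\<bar>eta \<bullet> \<beta>\<bar> \<le> (\<Sum>t<m. \<bar>node_coweight ((\<omega> ^^ t) a0) \<bullet> \<beta>\<bar>)"
    unfolding eta_def inner_sum_left by (rule sum_abs)
  also have "\<dots> < (\<Sum>t<m. 1)"
  proof (rule sum_strict_mono_ex1)
    show "\<forall>t\<in>{..<m}. \<bar>node_coweight ((\<omega> ^^ t) a0) \<bullet> \<beta>\<bar> \<le> 1"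
      using node_coweight_bound[OF pow_a0_D0 b] node_mark_pow_a0 by metis
    show "\<exists>t\<in>{..<m}. \<bar>node_coweight ((\<omega> ^^ t) a0) \<bullet> \<beta>\<bar> < 1"
      using order_pos by (intro bexI[of _ 0]) auto
  qed simp
  finally show ?thesis by simp
qed

lemma O0_eq: "orb a0 = (\<lambda>t. (\<omega> ^^ t) a0) ` {..<m}"
  by (rule orb_eq)

lemma card_O0: "card (orb a0) = m"
proof -
  have "inj_on (\<lambda>t. (\<omega> ^^ t) a0) {..<m}"
  proof (rule linorder_inj_onI')
    fix s t assume st: "s \<in> {..<m}" "t \<in> {..<m}" "s < t"
    have "(\<omega> ^^ t) a0 = (\<omega> ^^ s) ((\<omega> ^^ (t - s)) a0)"
      using st by (metis comp_apply funpow_add le_add_diff_inverse less_imp_le_nat)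
    moreover have "(\<omega> ^^ (t - s)) a0 \<noteq> a0"
      using st by (auto simp: pow_a0_iff dest: dvd_imp_le)
    ultimately show "(\<omega> ^^ s) a0 \<noteq> (\<omega> ^^ t) a0" by (metis pow_inj)
  qed
  then show ?thesis unfolding O0_eq by (simp add: card_image)
qed

text \<open>On a positive root \<open>eta\<close> is a sum of non-negative coefficients, so its
  vanishing makes each of them vanish.\<close>

lemma eta_zero_coef:
  assumes b: "\<beta> \<in> \<Phi>" "eta \<bullet> \<beta> = 0" and a: "a \<in> \<Delta>" "a \<in> orb a0"
  shows "coweight a \<bullet> \<beta> = 0"
proof -
  have *: "coweight a \<bullet> \<gamma> = 0" if g: "pos \<gamma>" "eta \<bullet> \<gamma> = 0" for \<gamma>
  proof -
    have nonneg: "0 \<le> node_coweight ((\<omega> ^^ t) a0) \<bullet> \<gamma>" for t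
      using pow_a0_D0[of t] pos_coef[OF g(1)] by (auto simp: node_coweight_def)
    have "node_coweight ((\<omega> ^^ t) a0) \<bullet> \<gamma> = 0" if "t < m" for t
      using g(2) that nonneg unfolding eta_def inner_sum_left
      by (subst (asm) sum_nonneg_eq_0_iff) auto
    moreover obtain t where "t < m" "a = (\<omega> ^^ t) a0" using a(2) by (auto simp: O0_eq)
    ultimately show ?thesis using node_coweight_simple[OF a(1)] by metis
  qed
  show ?thesis
    using pos_or_neg_root[OF b(1)] *[of \<beta>] *[of "- \<beta>"] b(2) by auto
qed

text \<open>Modulo the coroot lattice, passing from \<open>a\<close> to \<open>\<omega> a\<close> adds \<open>node_mark a *\<^sub>R tau\<close> to the coweight.
  Going once around the orbit of \<open>\<alpha>\<close> shows that a multiple of \<open>tau\<close> is in the lattice, and this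
  multiple is congruent to the (minuscule or zero) coweight of a node in the orbit of the affine node.\<close>

lemma orbit_mark_divisible:
  assumes a: "\<alpha> \<in> D0"
  shows "node_mark \<alpha> * of_nat (card (orb \<alpha>)) / of_nat m \<in> \<int>"
proof -
  let ?s = "card (orb \<alpha>)"
  have step: "node_coweight (\<omega> c) - node_coweight c - node_mark c *\<^sub>R tau \<in> coroot_lattice" if c: "c \<in> D0" for c
  proof -
    have "node_coweight c - \<omega> (node_coweight c) \<in> coroot_lattice"
      by (rule coweight_diff_coroot_lattice[OF om_weyl base_roots node_coweight_int[OF c]])
    then have "- (node_coweight c - \<omega> (node_coweight c)) \<in> coroot_lattice" by (rule coroot_lattice_uminus)
    then show ?thesis unfolding om_node_coweight[OF c] by (simp add: algebra_simps)
  qed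
  have "(\<Sum>c\<in>orb \<alpha>. node_coweight (\<omega> c) - node_coweight c - node_mark c *\<^sub>R tau) \<in> coroot_lattice"
    using step orb_D0[OF a] by (intro coroot_lattice_sum) blast
  moreover have "(\<Sum>c\<in>orb \<alpha>. node_coweight (\<omega> c) - node_coweight c - node_mark c *\<^sub>R tau) = - ((node_mark \<alpha> * ?s) *\<^sub>R tau)"
  proof -
    have "(\<Sum>c\<in>orb \<alpha>. node_coweight (\<omega> c)) = (\<Sum>c\<in>orb \<alpha>. node_coweight c)"
      by (rule sum.reindex_bij_betw[OF bij_betw_orb])
    moreover have "(\<Sum>c\<in>orb \<alpha>. node_mark c *\<^sub>R tau) = (\<Sum>c\<in>orb \<alpha>. node_mark \<alpha> *\<^sub>R tau)"
      using node_mark_orb[OF a] by (intro sum.cong) auto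
    ultimately show ?thesis by (simp add: sum_subtractf sum_constant_scaleR mult.commute)
  qed
  ultimately have "- ((node_mark \<alpha> * ?s) *\<^sub>R tau) \<in> coroot_lattice" by (simp only:)
  then have stau: "(node_mark \<alpha> * ?s) *\<^sub>R tau \<in> coroot_lattice"
    using coroot_lattice_uminus by fastforce
  have ktau: "node_coweight ((\<omega> ^^ k) a0) - of_nat k *\<^sub>R tau \<in> coroot_lattice" for k
  proof (induction k)
    case (Suc k)
    have "(node_coweight (\<omega> ((\<omega> ^^ k) a0)) - node_coweight ((\<omega> ^^ k) a0) - tau) + (node_coweight ((\<omega> ^^ k) a0) - of_nat k *\<^sub>R tau)
        \<in> coroot_lattice"
      using step[OF pow_a0_D0[of k]] Suc by (intro coroot_lattice_add) (auto simp: node_mark_pow_a0)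
    then show ?case by (simp add: algebra_simps)
  qed (simp add: coroot_lattice_0)
  obtain i :: int where i: "node_mark \<alpha> = of_int i" using node_mark_int[OF a] by (auto elim: Ints_cases)
  \<comment> \<open>The total mark of the orbit, as an exponent: \<open>ktau\<close> at
    \<open>k\<close> together with \<open>stau\<close> puts the coweight of the node
    \<open>k\<close> steps from the affine one into the lattice.\<close>
  define k where "k = nat i * ?s"
  have "i \<ge> 1" using node_mark_ge1[OF a] i by simp
  then have k: "real k = node_mark \<alpha> * ?s" by (simp add: k_def i)
  have "(node_coweight ((\<omega> ^^ k) a0) - of_nat k *\<^sub>R tau) + of_nat k *\<^sub>R tau \<in> coroot_lattice"
    using ktau[of k] stau unfolding k by (intro coroot_lattice_add)
  then have mem: "node_coweight ((\<omega> ^^ k) a0) \<in> coroot_lattice" by simp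
  have "node_coweight ((\<omega> ^^ k) a0) = 0"
  proof (rule minuscule_in_coroot_lattice[OF mem])
    fix \<beta> assume b: "\<beta> \<in> \<Phi>"
    have "\<bar>node_coweight ((\<omega> ^^ k) a0) \<bullet> \<beta>\<bar> \<le> 1" using node_coweight_bound[OF pow_a0_D0 b] node_mark_pow_a0 by metis
    moreover obtain j :: int where "node_coweight ((\<omega> ^^ k) a0) \<bullet> \<beta> = of_int j"
      using node_coweight_int[OF pow_a0_D0 b] by (auto elim: Ints_cases)
    ultimately have "\<bar>j\<bar> \<le> 1" "node_coweight ((\<omega> ^^ k) a0) \<bullet> \<beta> = of_int j" by auto
    then show "node_coweight ((\<omega> ^^ k) a0) \<bullet> \<beta> \<in> {-1, 0, 1}" by (auto simp: abs_le_iff)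
  qed
  then have "(\<omega> ^^ k) a0 = a0"
    using pow_a0_D0[of k] coweight_dual[of "(\<omega> ^^ k) a0" "(\<omega> ^^ k) a0"]
    by (auto simp: node_coweight_def split: if_splits)
  then have "m dvd k" by (simp add: pow_a0_iff)
  then obtain q where "k = m * q" by blast
  then have "real k / real m = of_nat q" using order_pos by simp
  then show ?thesis unfolding k by (metis Ints_of_nat)
qed

text \<open>These vectors restrict to the dual basis of the averaged basis.\<close>

definition orbit_coweight :: "'a \<Rightarrow> 'a" where
  "orbit_coweight \<alpha> = of_nat (card (orb \<alpha>)) *\<^sub>R avg (coweight \<alpha>)"

lemma om_orbit_coweight: "\<omega> (orbit_coweight \<alpha>) = orbit_coweight \<alpha>"
  by (simp add: orbit_coweight_def linear_cmul[OF om_linear] om_avg)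

lemma orbit_coweight_avg: "orbit_coweight \<alpha> \<bullet> avg \<beta> = orbit_coweight \<alpha> \<bullet> \<beta>"
  using avg_inner_fixed[OF om_orbit_coweight, of \<beta> \<alpha>] by (simp add: inner_commute)

text \<open>Averaging moves to the other argument, so the value is read off from the sum of
  \<open>coweight \<alpha>\<close> over the orbit of \<open>a\<close>. In the affine orbit, which
  has length \<open>m\<close>, only \<open>a0\<close> contributes, namely the negative of the
  mark.\<close>

lemma orbit_coweight_pair:
  assumes al: "\<alpha> \<in> \<Delta>" "\<alpha> \<notin> orb a0" and a: "a \<in> D0"
  shows "orbit_coweight \<alpha> \<bullet> a = (if a \<in> orb a0 then - (node_mark \<alpha> * of_nat (card (orb \<alpha>)) / of_nat m)
                      else if a \<in> orb \<alpha> then 1 else 0)"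
proof -
  have "of_nat (card (orb a)) * (avg (coweight \<alpha>) \<bullet> a) = coweight \<alpha> \<bullet> (of_nat (card (orb a)) *\<^sub>R avg a)"
    by (simp add: avg_inner)
  also have "\<dots> = (\<Sum>c\<in>orb a. coweight \<alpha> \<bullet> c)"
    unfolding card_orb_avg by (rule inner_sum_right)
  finally have eq: "of_nat (card (orb a)) * (avg (coweight \<alpha>) \<bullet> a) = (\<Sum>c\<in>orb a. coweight \<alpha> \<bullet> c)" .
  show ?thesis
  proof (cases "a \<in> orb a0")
    case True
    then have oa: "orb a = orb a0" by (rule orb_cong)
    have "(\<Sum>c\<in>orb a0. coweight \<alpha> \<bullet> c) = (\<Sum>c\<in>orb a0. if c = a0 then - node_mark \<alpha> else 0)"
    proof (rule sum.cong)
      fix c assume c: "c \<in> orb a0"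
      then have "c \<in> D0" using orb_D0[of a0 c] by blast
      then show "coweight \<alpha> \<bullet> c = (if c = a0 then - node_mark \<alpha> else 0)"
        using al c by (auto simp: node_mark_simple coweight_dual)
    qed simp
    also have "\<dots> = - node_mark \<alpha>" using orb_self[of a0] by simp
    finally have "of_nat m * (avg (coweight \<alpha>) \<bullet> a) = - node_mark \<alpha>" using eq oa card_O0 by simp
    then have "avg (coweight \<alpha>) \<bullet> a = - node_mark \<alpha> / of_nat m" using order_pos by (simp add: field_simps)
    then show ?thesis using True by (simp add: orbit_coweight_def)
  next
    case False
    have "c \<in> \<Delta>" if "c \<in> orb a" for c
    proof -
      have "c \<noteq> a0" using False orb_sym[OF that] by blast
      then show ?thesis using orb_D0[OF a that] by blast
    qed
    then have "(\<Sum>c\<in>orb a. coweight \<alpha> \<bullet> c) = (\<Sum>c\<in>orb a. if c = \<alpha> then 1 else 0)"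
      using coweight_dual[OF al(1)] by (intro sum.cong) auto
    also have "\<dots> = (if \<alpha> \<in> orb a then 1 else 0)" by simp
    finally have s: "of_nat (card (orb a)) * (avg (coweight \<alpha>) \<bullet> a) = (if \<alpha> \<in> orb a then 1 else 0)"
      using eq by simp
    show ?thesis
    proof (cases "a \<in> orb \<alpha>")
      case True
      then have "orb a = orb \<alpha>" "\<alpha> \<in> orb a" using orb_cong orb_sym by blast+
      then show ?thesis using s False True by (simp add: orbit_coweight_def)
    next
      case n: False
      then have "\<alpha> \<notin> orb a" using orb_sym by blast
      then have "avg (coweight \<alpha>) \<bullet> a = 0" using s orb_self[of a] by auto
      then show ?thesis using False n by (simp add: orbit_coweight_def)
    qed
  qed
qed

lemma orbit_coweight_int:
  assumes al: "\<alpha> \<in> \<Delta>" "\<alpha> \<notin> orb a0" and b: "\<beta> \<in> \<Phi>"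
  shows "orbit_coweight \<alpha> \<bullet> \<beta> \<in> \<int>"
proof -
  have "orbit_coweight \<alpha> \<bullet> a \<in> \<int>" if a: "a \<in> \<Delta>" for a
  proof -
    have "orbit_coweight \<alpha> \<bullet> a = (if a \<in> orb a0 then - (node_mark \<alpha> * of_nat (card (orb \<alpha>)) / of_nat m)
                      else if a \<in> orb \<alpha> then 1 else 0)"
      using a by (intro orbit_coweight_pair[OF al]) auto
    moreover have "- (node_mark \<alpha> * of_nat (card (orb \<alpha>)) / of_nat m) \<in> \<int>"
      using al by (intro Ints_minus orbit_mark_divisible) auto
    ultimately show ?thesis by simp
  qed
  then have "(\<Sum>a\<in>\<Delta>. (coweight a \<bullet> \<beta>) * (orbit_coweight \<alpha> \<bullet> a)) \<in> \<int>"
    using coef_int[OF b] by (intro Ints_sum Ints_mult)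
  moreover have "orbit_coweight \<alpha> \<bullet> \<beta> = (\<Sum>a\<in>\<Delta>. (coweight a \<bullet> \<beta>) * (orbit_coweight \<alpha> \<bullet> a))"
    by (subst base_expand[OF root_span[OF b]]) (simp add: inner_sum_right)
  ultimately show ?thesis by simp
qed

end

section \<open>Averaged roots\<close>

text \<open>This is the product of the commuting reflections in \<open>R\<close>: by orthogonality
  the earlier ones do not change the pairing with the next coroot.\<close>

lemma (in crystallographic) orthogonal_reflections:
  assumes "finite R" "R \<subseteq> \<Phi>" "\<And>\<gamma> \<delta>. \<gamma> \<in> R \<Longrightarrow> \<delta> \<in> R \<Longrightarrow> \<gamma> \<noteq> \<delta> \<Longrightarrow> \<gamma> \<bullet> \<delta> = 0" "\<nu> \<in> \<Phi>"
  shows "\<nu> - (\<Sum>\<gamma>\<in>R. (coroot \<gamma> \<bullet> \<nu>) *\<^sub>R \<gamma>) \<in> \<Phi>"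
  using assms(1-3)
proof (induction R rule: finite_induct)
  case (insert \<gamma> R)
  let ?v = "\<nu> - (\<Sum>\<gamma>\<in>R. (coroot \<gamma> \<bullet> \<nu>) *\<^sub>R \<gamma>)"
  have v: "?v \<in> \<Phi>" using insert by auto
  have "\<gamma> \<bullet> \<delta> = 0" if "\<delta> \<in> R" for \<delta> using insert that by auto
  then have "\<gamma> \<bullet> (\<Sum>\<delta>\<in>R. (coroot \<delta> \<bullet> \<nu>) *\<^sub>R \<delta>) = 0"
    by (simp add: inner_sum_right)
  then have "coroot \<gamma> \<bullet> ?v = coroot \<gamma> \<bullet> \<nu>"
    by (simp add: coroot_inner inner_diff_right)
  then have "root_reflection \<gamma> ?v = \<nu> - (\<Sum>\<gamma>\<in>insert \<gamma> R. (coroot \<gamma> \<bullet> \<nu>) *\<^sub>R \<gamma>)"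
    using insert by (simp add: root_reflection_def)
  then show ?case using reflection_closed[OF _ v, of \<gamma>] insert by simp
qed (simp add: assms)

context isometry_of_finite_order
begin

lemma orb_pow_surj:
  assumes "\<delta> \<in> orb x" obtains \<delta>' where "\<delta>' \<in> orb x" "\<delta> = (\<omega> ^^ s) \<delta>'"
proof -
  obtain t where t: "\<delta> = (\<omega> ^^ t) x" using assms by (auto simp: orb_def)
  have "s \<le> m * s" using order_pos by simp
  then have e: "s + (m * s - s + t) = m * s + t" by linarith
  have "\<delta> = (\<omega> ^^ (m * s + t)) x" unfolding t by (simp add: funpow_add pow_mult_order)
  also have "\<dots> = (\<omega> ^^ s) ((\<omega> ^^ (m * s - s + t)) x)"
    unfolding e[symmetric] by (simp only: funpow_add comp_apply)
  finally show ?thesis by (intro that[of "(\<omega> ^^ (m * s - s + t)) x"]) (auto simp: orb_def)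
qed

lemma orb_norm: "\<gamma> \<in> orb x \<Longrightarrow> \<gamma> \<bullet> \<gamma> = x \<bullet> x"
  by (auto simp: orb_def)

text \<open>Orthogonality is required of \<open>x\<close> alone; applying powers of the isometry
  gives it for all pairs in the orbit.\<close>

definition orthogonal_orbit :: "'a \<Rightarrow> bool" where
  "orthogonal_orbit x \<longleftrightarrow> (\<forall>\<gamma>\<in>orb x. \<gamma> \<noteq> x \<longrightarrow> x \<bullet> \<gamma> = 0)"

lemma orthogonal_orbit_pairwise:
  assumes "orthogonal_orbit x" "\<gamma> \<in> orb x" "\<delta> \<in> orb x" "\<gamma> \<noteq> \<delta>"
  shows "\<gamma> \<bullet> \<delta> = 0"
proof -
  obtain s where s: "\<gamma> = (\<omega> ^^ s) x" using assms by (auto simp: orb_def)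
  obtain \<delta>' where d: "\<delta>' \<in> orb x" "\<delta> = (\<omega> ^^ s) \<delta>'" using orb_pow_surj assms(3) by blast
  then have "\<delta>' \<noteq> x" using s assms(4) by auto
  then show ?thesis using assms(1) d s by (simp add: orthogonal_orbit_def)
qed

lemma orthogonal_orbit_avg:
  assumes o: "orthogonal_orbit x"
  shows "of_nat (card (orb x)) * (avg x \<bullet> avg x) = x \<bullet> x"
proof -
  have "of_nat (card (orb x)) * (avg x \<bullet> avg x) = (of_nat (card (orb x)) *\<^sub>R avg x) \<bullet> x"
    using avg_inner_fixed[OF om_avg, of x x] by (simp add: inner_commute)
  also have "\<dots> = (\<Sum>\<gamma>\<in>orb x. \<gamma> \<bullet> x)" unfolding card_orb_avg by (rule inner_sum_left)
  also have "\<dots> = (\<Sum>\<gamma>\<in>orb x. if \<gamma> = x then x \<bullet> x else 0)"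
    using o by (intro sum.cong) (auto simp: orthogonal_orbit_def inner_commute)
  also have "\<dots> = x \<bullet> x" using orb_self by simp
  finally show ?thesis .
qed

text \<open>Both sides are multiples of \<open>avg x\<close>, and
  \<open>orthogonal_orbit_avg\<close> matches the factors. Integrality and the reflections of
  averaged roots both rest on this formula.\<close>

lemma orthogonal_orbit_coroot:
  assumes o: "orthogonal_orbit x"
  shows "coroot (avg x) = (\<Sum>\<gamma>\<in>orb x. coroot \<gamma>)"
proof -
  have "coroot (avg x) = (2 * of_nat (card (orb x)) / (x \<bullet> x)) *\<^sub>R avg x"
    unfolding coroot_def orthogonal_orbit_avg[OF o, symmetric] using orb_self[of x] by auto
  also have "\<dots> = (2 / (x \<bullet> x)) *\<^sub>R (of_nat (card (orb x)) *\<^sub>R avg x)" by simp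
  also have "\<dots> = (\<Sum>\<gamma>\<in>orb x. coroot \<gamma>)"
    unfolding card_orb_avg scaleR_sum_right coroot_def by (rule sum.cong) (simp_all add: orb_norm)
  finally show ?thesis .
qed

end

section \<open>Angles within orbits and reflections of averaged roots\<close>

context folding
begin

lemma orb_base:
  assumes "\<alpha> \<in> \<Delta>" "\<alpha> \<notin> orb a0" "a \<in> orb \<alpha>"
  shows "a \<in> \<Delta>" "a \<notin> orb a0"
proof -
  show n: "a \<notin> orb a0"
  proof
    assume "a \<in> orb a0"
    then have "orb \<alpha> = orb a0" using orb_cong[OF assms(3)] orb_cong by simp
    then show False using assms(2) orb_self by blast
  qed
  have "a \<in> D0" using assms orb_D0[of \<alpha> a] by blast
  moreover have "a \<noteq> a0" using n orb_self by metis
  ultimately show "a \<in> \<Delta>" by blast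
qed

text \<open>The coefficients at the affine orbit vanish by \<open>eta_zero_coef\<close>, so the
  negative values of \<open>orbit_coweight \<alpha>\<close> on that orbit do not contribute.\<close>

lemma orbit_coweight_eta_zero:
  assumes al: "\<alpha> \<in> \<Delta>" "\<alpha> \<notin> orb a0" and b: "\<beta> \<in> \<Phi>" "eta \<bullet> \<beta> = 0"
  shows "orbit_coweight \<alpha> \<bullet> \<beta> = (\<Sum>a\<in>orb \<alpha>. coweight a \<bullet> \<beta>)"
proof -
  have "orbit_coweight \<alpha> \<bullet> \<beta> = (\<Sum>a\<in>\<Delta>. (coweight a \<bullet> \<beta>) * (orbit_coweight \<alpha> \<bullet> a))"
    by (subst base_expand[OF root_span[OF b(1)]]) (simp add: inner_sum_right)
  also have "\<dots> = (\<Sum>a\<in>orb \<alpha>. coweight a \<bullet> \<beta>)"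
  proof (rule sum.mono_neutral_cong_right)
    show "orb \<alpha> \<subseteq> \<Delta>" using orb_base[OF al] by blast
    show "\<forall>a\<in>\<Delta> - orb \<alpha>. (coweight a \<bullet> \<beta>) * (orbit_coweight \<alpha> \<bullet> a) = 0"
      using eta_zero_coef[OF b] orbit_coweight_pair[OF al] by auto
    show "(coweight a \<bullet> \<beta>) * (orbit_coweight \<alpha> \<bullet> a) = coweight a \<bullet> \<beta>" if "a \<in> orb \<alpha>" for a
      using orb_base[OF al that] orbit_coweight_pair[OF al, of a] that by simp
  qed simp
  finally show ?thesis .
qed

text \<open>Up to sign the root is positive. If \<open>eta\<close> vanished, the coefficients would
  be 0 on the affine orbit, and on every other orbit they would be non-negative with sum 0.\<close>

lemma kernel_eta:
  assumes g: "\<gamma> \<in> \<Phi>" and z: "avg \<gamma> = 0"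
  shows "eta \<bullet> \<gamma> \<noteq> 0"
proof
  assume e: "eta \<bullet> \<gamma> = 0"
  have *: False if p: "pos \<delta>" and z: "avg \<delta> = 0" and e: "eta \<bullet> \<delta> = 0" for \<delta>
  proof -
    have d: "\<delta> \<in> \<Phi>" using p pos_root by blast
    have "coweight \<alpha> \<bullet> \<delta> = 0" if al: "\<alpha> \<in> \<Delta>" for \<alpha>
    proof (cases "\<alpha> \<in> orb a0")
      case True
      then show ?thesis using eta_zero_coef[OF d e al] by blast
    next
      case False
      have "(\<Sum>a\<in>orb \<alpha>. coweight a \<bullet> \<delta>) = 0"
        using orbit_coweight_eta_zero[OF al False d e] orbit_coweight_avg[of \<alpha> \<delta>] z by simp
      then show ?thesis
        using orb_self[of \<alpha>] pos_coef[OF p] orb_base[OF al False]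
        by (subst (asm) sum_nonneg_eq_0_iff) auto
    qed
    then show False using root_coef_nonzero[OF d] by blast
  qed
  show False
    using pos_or_neg_root[OF g] *[of \<gamma>] *[of "- \<gamma>"] z e by (auto simp: avg_uminus)
qed

lemma eta_orb:
  assumes "\<beta> \<in> \<Phi>" "\<gamma> \<in> orb \<beta>"
  obtains k :: int where "eta \<bullet> \<gamma> = eta \<bullet> \<beta> + of_nat m * of_int k"
proof -
  have "\<exists>k::int. eta \<bullet> (\<omega> ^^ t) \<beta> = eta \<bullet> \<beta> + of_nat m * of_int k" for t
  proof (induction t)
    case 0
    show ?case by (rule exI[of _ 0]) simp
  next
    case (Suc t)
    then obtain k :: int where k: "eta \<bullet> (\<omega> ^^ t) \<beta> = eta \<bullet> \<beta> + of_nat m * of_int k" by blast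
    have "tau \<bullet> (\<omega> ^^ Suc t) \<beta> \<in> \<int>" using assms(1) by (intro tau_int pow_root)
    then obtain j :: int where "tau \<bullet> \<omega> ((\<omega> ^^ t) \<beta>) = of_int j" by (auto elim: Ints_cases)
    then show ?case
      using k by (intro exI[of _ "k + j"]) (simp add: eta_om algebra_simps)
  qed
  then show ?thesis using assms(2) that by (auto simp: orb_def)
qed

text \<open>Otherwise the difference would be a root that averages to \<open>0\<close> and on which \<open>eta\<close> is a
  multiple of \<open>m\<close>, hence \<open>0\<close>.\<close>

lemma orbit_obtuse:
  assumes b: "\<beta> \<in> \<Phi>" and g: "\<gamma> \<in> orb \<beta>" "\<gamma> \<noteq> \<beta>"
  shows "\<beta> \<bullet> \<gamma> \<le> 0"
proof (rule ccontr)
  assume "\<not> ?thesis"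
  then have d: "\<gamma> - \<beta> \<in> \<Phi>"
    using b g orb_root by (intro diff_root) (auto simp: inner_commute)
  have "avg (\<gamma> - \<beta>) = 0" using avg_orb[OF g(1)] by (simp add: linear_diff[OF avg_linear])
  then have ne: "eta \<bullet> (\<gamma> - \<beta>) \<noteq> 0" using kernel_eta[OF d] by blast
  obtain k :: int where "eta \<bullet> \<gamma> = eta \<bullet> \<beta> + of_nat m * of_int k" using eta_orb[OF b g(1)] .
  then have k: "eta \<bullet> (\<gamma> - \<beta>) = of_nat m * of_int k" by (simp add: inner_diff_right)
  with ne have "1 \<le> \<bar>k\<bar>" by auto
  then have "1 \<le> \<bar>real_of_int k\<bar>" by linarith
  then have "of_nat m * 1 \<le> of_nat m * \<bar>real_of_int k\<bar>" by (intro mult_left_mono) auto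
  with eta_bound[OF d] k show False by (simp add: abs_mult)
qed

text \<open>As \<open>avg \<beta> \<noteq> 0\<close>, the orbit has at most one root \<open>\<gamma> \<noteq> \<beta>\<close> that is not orthogonal to \<open>\<beta>\<close>.
  If there is one, then \<open>\<beta> + \<gamma>\<close> has an orthogonal orbit.\<close>

lemma orthogonal_orbit_exists:
  assumes b: "\<beta> \<in> \<Phi>" and nz: "avg \<beta> \<noteq> 0"
  obtains \<rho> and c :: nat where "\<rho> \<in> \<Phi>" "orthogonal_orbit \<rho>" "c \<noteq> 0" "avg \<rho> = of_nat c *\<^sub>R avg \<beta>"
proof (cases "orthogonal_orbit \<beta>")
  case True
  then show ?thesis using that[of \<beta> 1] b by simp
next
  case False
  then obtain \<gamma> where g: "\<gamma> \<in> orb \<beta>" "\<gamma> \<noteq> \<beta>" "\<beta> \<bullet> \<gamma> \<noteq> 0"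
    by (auto simp: orthogonal_orbit_def)
  have bb: "0 < \<beta> \<bullet> \<beta>" using b root_nonzero by simp
  have neg: "\<beta> \<bullet> c \<le> - (\<beta> \<bullet> \<beta>) / 2" if c: "c \<in> orb \<beta>" "c \<noteq> \<beta>" "\<beta> \<bullet> c \<noteq> 0" for c
  proof -
    obtain k :: int where k: "coroot \<beta> \<bullet> c = of_int k"
      using integral[OF b orb_root[OF b c(1)]] by (auto elim: Ints_cases)
    then have e: "2 * (\<beta> \<bullet> c) = of_int k * (\<beta> \<bullet> \<beta>)" using bb by (simp add: coroot_inner field_simps)
    have "\<beta> \<bullet> c < 0" using orbit_obtuse[OF b c(1,2)] c(3) by simp
    then have "of_int k * (\<beta> \<bullet> \<beta>) < 0" using e by simp
    then have "k < 0" using bb by (simp add: mult_less_0_iff)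
    then have "of_int k \<le> (-1::real)" by linarith
    then have "of_int k * (\<beta> \<bullet> \<beta>) \<le> -1 * (\<beta> \<bullet> \<beta>)" using bb by (intro mult_right_mono) auto
    then show ?thesis using e by simp
  qed
  \<comment> \<open>Pairing \<open>\<beta>\<close> with the sum of its orbit gives a positive
    number, as its average is not 0. By \<open>neg\<close>, two further non-orthogonal members would
    already cancel \<open>\<beta> \<bullet> \<beta>\<close>.\<close>
  have uniq: "c = \<gamma>" if c: "c \<in> orb \<beta>" "c \<noteq> \<beta>" "\<beta> \<bullet> c \<noteq> 0" for c
  proof (rule ccontr)
    assume ne: "c \<noteq> \<gamma>"
    have "0 < of_nat (card (orb \<beta>)) * (avg \<beta> \<bullet> avg \<beta>)"
      using nz orb_card_pos[of \<beta>] by simp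
    also have "\<dots> = \<beta> \<bullet> (of_nat (card (orb \<beta>)) *\<^sub>R avg \<beta>)"
      using avg_inner_fixed[OF om_avg, of \<beta> \<beta>] by simp
    also have "\<dots> = (\<Sum>d\<in>orb \<beta>. \<beta> \<bullet> d)"
      unfolding card_orb_avg by (rule inner_sum_right)
    also have "\<dots> = \<beta> \<bullet> \<beta> + (\<beta> \<bullet> \<gamma> + (\<beta> \<bullet> c + (\<Sum>d\<in>orb \<beta> - {\<beta>} - {\<gamma>} - {c}. \<beta> \<bullet> d)))"
      using g c ne orb_self[of \<beta>]
      by (simp add: sum.remove[of "orb \<beta>" \<beta>] sum.remove[of "orb \<beta> - {\<beta>}" \<gamma>]
          sum.remove[of "orb \<beta> - {\<beta>} - {\<gamma>}" c])
    also have "\<dots> \<le> 0"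
    proof -
      have "(\<Sum>d\<in>orb \<beta> - {\<beta>} - {\<gamma>} - {c}. \<beta> \<bullet> d) \<le> 0"
        using orbit_obtuse[OF b] by (intro sum_nonpos) auto
      then show ?thesis using neg[OF c] neg[OF g] by simp
    qed
    finally show False by simp
  qed
  obtain t where t: "\<gamma> = (\<omega> ^^ t) \<beta>" using g by (auto simp: orb_def)
  \<comment> \<open>The preimage of \<open>\<beta>\<close> under this power is also a non-orthogonal
    member, so it is \<open>\<gamma>\<close>; thus the power swaps \<open>\<beta>\<close> and
    \<open>\<gamma>\<close>.\<close>
  have tg: "(\<omega> ^^ t) \<gamma> = \<beta>"
  proof -
    obtain c where c: "c \<in> orb \<beta>" "\<beta> = (\<omega> ^^ t) c" using orb_pow_surj[OF orb_self] by blast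
    have "\<beta> \<bullet> c = \<gamma> \<bullet> \<beta>" using t c(2) pow_inner[of t \<beta> c] by simp
    then have "\<beta> \<bullet> c \<noteq> 0" using g by (simp add: inner_commute)
    moreover have "c \<noteq> \<beta>" using t c(2) g(2) by auto
    ultimately show ?thesis using uniq c by metis
  qed
  let ?d = "\<beta> + \<gamma>"
  have avg_d: "avg ?d = of_nat 2 *\<^sub>R avg \<beta>"
    using avg_orb[OF g(1)] by (simp add: linear_add[OF avg_linear] scaleR_2)
  have "\<beta> \<noteq> - \<gamma>"
    using avg_d nz by (auto simp: avg_0)
  then have "?d \<in> \<Phi>"
    using b g orb_root[OF b g(1)] orbit_obtuse[OF b g(1,2)] by (intro sum_root) auto
  moreover have "orthogonal_orbit ?d"
    unfolding orthogonal_orbit_def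
  proof (intro ballI impI)
    fix e assume e: "e \<in> orb ?d" "e \<noteq> ?d"
    then obtain s where s: "e = (\<omega> ^^ s) ?d" by (auto simp: orb_def)
    define u where "u = (\<omega> ^^ s) \<beta>"
    define v where "v = (\<omega> ^^ s) \<gamma>"
    have euv: "e = u + v" by (simp add: s u_def v_def linear_add[OF pow_linear])
    have swap: "(\<omega> ^^ s) ((\<omega> ^^ t) x) = (\<omega> ^^ t) ((\<omega> ^^ s) x)" for x
      by (metis add.commute comp_apply funpow_add)
    have tu: "(\<omega> ^^ t) u = v" using swap t by (simp add: u_def v_def)
    have tv: "(\<omega> ^^ t) v = u" using swap tg by (metis u_def v_def)
    have uo: "u \<in> orb \<beta>" by (simp add: u_def orb_def)
    have vo: "v \<in> orb \<beta>"
      unfolding v_def t by (metis (no_types, lifting) comp_apply funpow_add orb_def rangeI)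
    \<comment> \<open>The power also swaps \<open>u\<close> and \<open>v\<close>, so if either of
      them were \<open>\<beta>\<close> or \<open>\<gamma>\<close>, then \<open>{u, v}\<close> would
      be \<open>{\<beta>, \<gamma>}\<close> and \<open>e\<close> would be
      \<open>\<beta> + \<gamma>\<close>.\<close>
    have ub: "u \<noteq> \<beta>" "u \<noteq> \<gamma>" using euv e(2) tu tg t by (auto simp: add.commute)
    have vb: "v \<noteq> \<beta>" "v \<noteq> \<gamma>" using euv e(2) tv tg t by (auto simp: add.commute)
    have bu: "\<beta> \<bullet> u = 0" "\<beta> \<bullet> v = 0" using uniq[OF uo] uniq[OF vo] ub vb by auto
    have "\<gamma> \<bullet> u = 0" "\<gamma> \<bullet> v = 0"
      using bu tu tv t pow_inner[of t \<beta> u] pow_inner[of t \<beta> v] by auto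
    then show "?d \<bullet> e = 0" using bu by (simp add: euv inner_add_left inner_add_right)
  qed
  ultimately show ?thesis using that[of ?d 2] avg_d by simp
qed

text \<open>For an orthogonal orbit the coroot of the average is a sum of coroots, hence integral on
  roots. Passing from \<open>\<rho>\<close> back to \<open>\<beta>\<close> multiplies the coroot by
  the natural number \<open>c\<close>.\<close>

lemma folded_integral:
  assumes b: "\<beta> \<in> \<Phi>" "avg \<beta> \<noteq> 0" and n: "\<nu> \<in> \<Phi>"
  shows "coroot (avg \<beta>) \<bullet> avg \<nu> \<in> \<int>"
proof -
  obtain \<rho> and c :: nat where r: "\<rho> \<in> \<Phi>" "orthogonal_orbit \<rho>" "c \<noteq> 0" "avg \<rho> = of_nat c *\<^sub>R avg \<beta>"
    using orthogonal_orbit_exists[OF b] .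
  have "coroot (avg \<rho>) \<bullet> avg \<nu> = coroot (avg \<rho>) \<bullet> \<nu>"
    using avg_inner_fixed[OF om_avg, of \<nu> \<rho>] by (simp add: coroot_def inner_commute)
  also have "\<dots> = (\<Sum>\<gamma>\<in>orb \<rho>. coroot \<gamma> \<bullet> \<nu>)"
    unfolding orthogonal_orbit_coroot[OF r(2)] by (rule inner_sum_left)
  also have "\<dots> \<in> \<int>" using r(1) n orb_root by (intro Ints_sum integral) auto
  finally have "of_nat c * (coroot (avg \<rho>) \<bullet> avg \<nu>) \<in> \<int>" by (intro Ints_mult) auto
  moreover have "of_nat c * (coroot (avg \<rho>) \<bullet> avg \<nu>) = coroot (avg \<beta>) \<bullet> avg \<nu>"
    unfolding r(4) using r(3) by (simp add: coroot_inner)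
  ultimately show ?thesis by simp
qed

text \<open>The reflection in \<open>avg \<beta>\<close> is also that in \<open>avg \<rho>\<close>,
  a non-zero multiple, and the product of the reflections in the orthogonal orbit of
  \<open>\<rho>\<close> induces it on averages.\<close>

lemma folded_reflection:
  assumes b: "\<beta> \<in> \<Phi>" "avg \<beta> \<noteq> 0" and n: "\<nu> \<in> \<Phi>"
  shows "\<exists>\<nu>'\<in>\<Phi>. root_reflection (avg \<beta>) (avg \<nu>) = avg \<nu>'"
proof -
  obtain \<rho> and c :: nat where r: "\<rho> \<in> \<Phi>" "orthogonal_orbit \<rho>" "c \<noteq> 0" "avg \<rho> = of_nat c *\<^sub>R avg \<beta>"
    using orthogonal_orbit_exists[OF b] .
  define \<nu>' where "\<nu>' = \<nu> - (\<Sum>\<gamma>\<in>orb \<rho>. (coroot \<gamma> \<bullet> \<nu>) *\<^sub>R \<gamma>)"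
  have "\<nu>' \<in> \<Phi>"
    unfolding \<nu>'_def
    by (rule orthogonal_reflections[OF finite_orb _ _ n])
       (use r orb_root orthogonal_orbit_pairwise in auto)
  moreover have "avg \<nu>' = root_reflection (avg \<rho>) (avg \<nu>)"
  proof -
    have "avg \<nu>' = avg \<nu> - (\<Sum>\<gamma>\<in>orb \<rho>. (coroot \<gamma> \<bullet> \<nu>) *\<^sub>R avg \<gamma>)"
      by (simp add: \<nu>'_def linear_diff[OF avg_linear] linear_sum[OF avg_linear] linear_cmul[OF avg_linear])
    also have "(\<Sum>\<gamma>\<in>orb \<rho>. (coroot \<gamma> \<bullet> \<nu>) *\<^sub>R avg \<gamma>) = (\<Sum>\<gamma>\<in>orb \<rho>. (coroot \<gamma> \<bullet> \<nu>) *\<^sub>R avg \<rho>)"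
      by (rule sum.cong) (auto simp: avg_orb)
    also have "\<dots> = (coroot (avg \<rho>) \<bullet> \<nu>) *\<^sub>R avg \<rho>"
      unfolding orthogonal_orbit_coroot[OF r(2)] by (simp add: inner_sum_left scaleR_sum_left)
    also have "coroot (avg \<rho>) \<bullet> \<nu> = coroot (avg \<rho>) \<bullet> avg \<nu>"
      using avg_inner_fixed[OF om_avg, of \<nu> \<rho>] by (simp add: coroot_def inner_commute)
    finally show ?thesis by (simp add: root_reflection_def)
  qed
  moreover have "root_reflection (avg \<rho>) = root_reflection (avg \<beta>)"
    unfolding r(4) using r(3) by (simp add: root_reflection_scaleR)
  ultimately show ?thesis by metis
qed

end

section \<open>Walls in the fixed space\<close>

lemma refl_word_conj:
  assumes "linear h" "\<And>x y. h x \<bullet> h y = x \<bullet> y"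
  shows "refl_word (map h as) (h x) = h (refl_word as x)"
  by (induction as) (simp_all add: root_reflection_conj[OF assms])

section \<open>Irreducible components\<close>

context crystallographic
begin

definition link :: "('a \<times> 'a) set" where
  "link = {(\<gamma>, \<delta>). \<gamma> \<in> \<Phi> \<and> \<delta> \<in> \<Phi> \<and> \<gamma> \<bullet> \<delta> \<noteq> 0}"

definition component :: "'a \<Rightarrow> 'a set" where
  "component \<beta> = link\<^sup>* `` {\<beta>}"

lemma component_self: "\<beta> \<in> component \<beta>"
  by (simp add: component_def)

lemma component_root: "\<beta> \<in> \<Phi> \<Longrightarrow> component \<beta> \<subseteq> \<Phi>"
  unfolding component_def by (auto elim!: rtranclE simp: link_def)

lemma component_step:
  "\<gamma> \<in> component \<beta> \<Longrightarrow> \<gamma> \<in> \<Phi> \<Longrightarrow> \<delta> \<in> \<Phi> \<Longrightarrow> \<gamma> \<bullet> \<delta> \<noteq> 0 \<Longrightarrow> \<delta> \<in> component \<beta>"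
  unfolding component_def by (auto simp: link_def intro: rtrancl_into_rtrancl)

text \<open>A root \<open>\<delta>\<close> not orthogonal to \<open>\<gamma>\<close> is linked to
  \<open>\<gamma>\<close> and also to its reflection, as the pairing only changes sign. Since
  \<open>\<delta>\<close> is an arbitrary root, the whole reflection group preserves
  components.\<close>

lemma component_reflection:
  assumes b: "\<beta> \<in> \<Phi>" and g: "\<gamma> \<in> component \<beta>" and d: "\<delta> \<in> \<Phi>"
  shows "root_reflection \<delta> \<gamma> \<in> component \<beta>"
proof (cases "\<delta> \<bullet> \<gamma> = 0")
  case True
  then show ?thesis using g by (simp add: root_reflection_orthogonal)
next
  case False
  have gP: "\<gamma> \<in> \<Phi>" using g component_root[OF b] by blast
  have "\<delta> \<in> component \<beta>" using component_step[OF g gP d] False by (simp add: inner_commute)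
  moreover have "\<delta> \<bullet> root_reflection \<delta> \<gamma> = - (\<delta> \<bullet> \<gamma>)"
    using root_reflection_inner_left[of \<delta> \<delta> \<gamma>] by simp
  ultimately show ?thesis
    using component_step[of \<delta> \<beta>] d reflection_closed[OF d gP] False by simp
qed

lemma component_word:
  assumes "\<beta> \<in> \<Phi>" "w \<in> reflection_group \<Phi>" "\<gamma> \<in> component \<beta>"
  shows "w \<gamma> \<in> component \<beta>"
proof -
  have "refl_word as \<gamma> \<in> component \<beta>" if "set as \<subseteq> \<Phi>" for as
    using that by (induction as) (auto simp: assms component_reflection)
  then show ?thesis using assms(2) by (auto simp: reflection_group_eq subset_iff)
qed

lemma component_crystallographic: "\<beta> \<in> \<Phi> \<Longrightarrow> crystallographic (component \<beta>)"
proof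
  assume b: "\<beta> \<in> \<Phi>"
  note sub = component_root[OF b]
  show "finite (component \<beta>)" using sub finite_roots finite_subset by blast
  show "0 \<notin> component \<beta>" using sub zero_not_root by blast
  show "root_reflection \<gamma> \<delta> \<in> component \<beta>" if "\<gamma> \<in> component \<beta>" "\<delta> \<in> component \<beta>" for \<gamma> \<delta>
    using component_reflection[OF b] that sub by blast
  show "coroot \<gamma> \<bullet> \<delta> \<in> \<int>" if "\<gamma> \<in> component \<beta>" "\<delta> \<in> component \<beta>" for \<gamma> \<delta>
    using integral that sub by blast
qed

text \<open>A chain of non-orthogonal roots starting in \<open>A\<close> cannot leave
  \<open>A\<close>.\<close>

lemma component_connected:
  assumes b: "\<beta> \<in> \<Phi>"
  shows "connected_roots (component \<beta>)"
  unfolding connected_roots_def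
proof (intro allI impI, elim conjE)
  fix A assume A: "A \<subseteq> component \<beta>" "A \<noteq> {}" and orth: "\<forall>a\<in>A. \<forall>c\<in>component \<beta> - A. a \<bullet> c = 0"
  have sym: "sym (link\<^sup>*)"
    by (intro sym_rtrancl) (auto simp: sym_def link_def inner_commute)
  obtain a where a: "a \<in> A" using A by blast
  have "c \<in> A" if c: "c \<in> component \<beta>" for c
  proof -
    have "(a, \<beta>) \<in> link\<^sup>*" using a A sym by (auto simp: component_def dest: symD)
    then have "(a, c) \<in> link\<^sup>*" using c by (auto simp: component_def)
    then show ?thesis
    proof (induction rule: rtrancl_induct)
      case (step u v)
      then have "v \<in> component \<beta>" "u \<bullet> v \<noteq> 0"
        using A component_step[of u \<beta> v] by (auto simp: link_def)
      then show ?case using step orth by blast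
    qed (rule a)
  qed
  with A show "A = component \<beta>" by blast
qed

lemma orthogonal_subsystem: "crystallographic {\<gamma> \<in> \<Phi>. \<gamma> \<bullet> x = 0}"
proof
  show "root_reflection \<alpha> \<beta> \<in> {\<gamma> \<in> \<Phi>. \<gamma> \<bullet> x = 0}"
    if "\<alpha> \<in> {\<gamma> \<in> \<Phi>. \<gamma> \<bullet> x = 0}" "\<beta> \<in> {\<gamma> \<in> \<Phi>. \<gamma> \<bullet> x = 0}" for \<alpha> \<beta>
    using that reflection_closed by (auto simp: root_reflection_def inner_diff_left)
qed (use zero_not_root integral in auto)

end

section \<open>Stabilizers in the Weyl group\<close>

context based_roots
begin

text \<open>If the word makes a simple root \<open>a\<close> negative, dominance gives
  \<open>a \<bullet> x \<le> 0\<close>, because the word fixes \<open>x\<close>. So \<open>a\<close>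
  is orthogonal to \<open>x\<close>, and \<open>exchange\<close> splits off its reflection and
  leaves a shorter word.\<close>

lemma dominant_stabilizer:
  assumes x: "\<And>a. a \<in> \<Delta> \<Longrightarrow> 0 \<le> a \<bullet> x" and as: "set as \<subseteq> \<Delta>" "refl_word as x = x"
  shows "refl_word as \<in> reflection_group {\<gamma> \<in> \<Phi>. \<gamma> \<bullet> x = 0}" (is "_ \<in> ?G")
  using as
proof (induction "length as" arbitrary: as rule: less_induct)
  case less
  show ?case
  proof (cases "\<forall>a\<in>\<Delta>. pos (refl_word as a)")
    case True
    then have "refl_word as = id"
      using less.prems by (intro pos_imp_id[of _ \<Delta>]) (auto intro: refl_word_in_group)
    then show ?thesis using refl_word_in_group[of "[]"] by simp
  next
    case False
    then obtain a where a: "a \<in> \<Delta>" "\<not> pos (refl_word as a)" by blast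
    have "refl_word as a \<in> \<Phi>"
      using weyl_root refl_word_in_group[OF less.prems(1)] a base_root by blast
    then have n: "pos (- refl_word as a)" using a pos_or_neg_root by blast
    have "0 \<le> (- refl_word as a) \<bullet> x"
    proof -
      have "(- refl_word as a) \<bullet> x = (\<Sum>b\<in>\<Delta>. (coweight b \<bullet> (- refl_word as a)) * (b \<bullet> x))"
        by (subst base_expand[OF root_span[OF pos_root[OF n]]])
           (simp only: inner_sum_left inner_scaleR_left)
      also have "\<dots> \<ge> 0" using x pos_coef[OF n] by (intro sum_nonneg mult_nonneg_nonneg)
      finally show ?thesis .
    qed
    moreover have "refl_word as a \<bullet> x = a \<bullet> x"
      using refl_word_inner[of as a x] less.prems(2) by simp
    ultimately have ax: "a \<bullet> x = 0" using x[OF a(1)] by simp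
    obtain bs where bs: "length bs < length as" "set bs \<subseteq> set as"
        "refl_word as \<circ> root_reflection a = refl_word bs"
      using exchange[OF less.prems(1) a] by blast
    have "refl_word bs x = x"
      using bs(3) less.prems(2) root_reflection_orthogonal[OF ax] by (metis comp_apply)
    then have "refl_word bs \<in> ?G" using less.hyps[OF bs(1)] bs(2) less.prems(1) by blast
    moreover have "root_reflection a \<in> ?G" using a ax base_root by (intro reflection_in_group) auto
    ultimately have "refl_word bs \<circ> root_reflection a \<in> ?G" by (rule reflection_group_comp)
    moreover have "refl_word bs \<circ> root_reflection a = refl_word as"
      unfolding bs(3)[symmetric] by (simp only: comp_assoc root_reflection_comp comp_id)
    ultimately show ?thesis by simp
  qed
qed

text \<open>Choosing \<open>u\<close> in the group so that \<open>u x\<close> has the greatest value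
  at \<open>rho\<close> makes \<open>u x\<close> dominant; the dominant case is then conjugated
  back.\<close>

lemma stabilizer_generated:
  assumes w: "w \<in> reflection_group \<Delta>" and wx: "w x = x"
  shows "w \<in> reflection_group {\<gamma> \<in> \<Phi>. \<gamma> \<bullet> x = 0}"
proof -
  let ?W = "reflection_group \<Delta>"
  let ?f = "\<lambda>u. u x \<bullet> rho"
  have ne: "?W \<noteq> {}" using w by blast
  then have "Max (?f ` ?W) \<in> ?f ` ?W" using finite_weyl by (intro Max_in) auto
  then obtain u where u: "u \<in> ?W" "Max (?f ` ?W) = ?f u" by blast
  then have max: "?f v \<le> ?f u" if "v \<in> ?W" for v
    using that finite_weyl Max_ge[of "?f ` ?W" "?f v"] by simp
  have dom: "0 \<le> a \<bullet> u x" if a: "a \<in> \<Delta>" for a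
  proof -
    \<comment> \<open>Reflecting in \<open>a\<close> lowers the value by
      \<open>coroot a \<bullet> u x\<close>, since \<open>a\<close> has height 1.\<close>
    have "?f (root_reflection a \<circ> u) \<le> ?f u"
      using a u by (intro max reflection_group_comp reflection_in_group)
    then have "0 \<le> coroot a \<bullet> u x"
      using a by (simp add: root_reflection_def inner_diff_left rho_simple)
    then show ?thesis
      using base_root[OF a] root_nonzero by (simp add: coroot_inner zero_le_divide_iff)
        (metis inner_gt_zero_iff less_le_not_le)
  qed
  obtain h where h: "h \<in> ?W" "u \<circ> h = id" "h \<circ> u = id"
    using reflection_group_inverse[OF u(1)] by blast
  have hu: "h (u z) = z" for z using h(3) by (metis comp_apply id_apply)
  have "u \<circ> w \<circ> h \<in> ?W" by (intro reflection_group_comp u w h)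
  then obtain as where as: "set as \<subseteq> \<Delta>" "u \<circ> w \<circ> h = refl_word as"
    by (auto simp: reflection_group_eq)
  have "refl_word as (u x) = u x"
    unfolding as(2)[symmetric] by (simp add: hu wx)
  then have "refl_word as \<in> reflection_group {\<gamma> \<in> \<Phi>. \<gamma> \<bullet> u x = 0}"
    by (intro dominant_stabilizer dom as(1))
  then obtain bs where bs: "set bs \<subseteq> {\<gamma> \<in> \<Phi>. \<gamma> \<bullet> u x = 0}" "refl_word as = refl_word bs"
    by (auto simp: reflection_group_eq)
  have hh: "linear h" "\<And>x y. h x \<bullet> h y = x \<bullet> y"
    using h(1) reflection_group_linear reflection_group_inner by auto
  have "w = refl_word (map h bs)"
  proof
    fix z
    have "refl_word (map h bs) z = h (refl_word bs (u z))"
      using refl_word_conj[OF hh, of bs "u z"] hu by simp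
    also have "\<dots> = h (u (w (h (u z))))" using as(2) bs(2) by (metis comp_apply)
    finally show "w z = refl_word (map h bs) z" by (simp add: hu)
  qed
  moreover have "set (map h bs) \<subseteq> {\<gamma> \<in> \<Phi>. \<gamma> \<bullet> x = 0}"
  proof -
    have "h \<gamma> \<in> \<Phi> \<and> h \<gamma> \<bullet> x = 0" if "\<gamma> \<in> \<Phi>" "\<gamma> \<bullet> u x = 0" for \<gamma>
      using that weyl_root[OF h(1)] hh(2)[of \<gamma> "u x"] hu[of x] by simp
    then show ?thesis using bs by auto
  qed
  ultimately show ?thesis using refl_word_in_group by metis
qed

end

context folding
begin

text \<open>This excludes mixed signs in \<open>fold_coef_sign\<close>: at a fixed vector in the
  interior of the chamber of the folded basis, only roots with average 0 can vanish.\<close>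

lemma avg_zero_on_wall:
  assumes fx: "\<omega> x = x" and dom: "\<And>a. a \<in> \<Delta> \<Longrightarrow> a \<notin> orb a0 \<Longrightarrow> 0 < x \<bullet> a"
    and b: "\<beta> \<in> \<Phi>" "\<beta> \<bullet> x = 0"
  shows "avg \<beta> = 0"
proof -
  define X where "X = {\<gamma> \<in> \<Phi>. \<gamma> \<bullet> x = 0}"
  interpret X: crystallographic X unfolding X_def by (rule orthogonal_subsystem)
  have XP: "\<gamma> \<in> \<Phi>" if "\<gamma> \<in> X" for \<gamma> using that by (simp add: X_def)
  have bX: "\<beta> \<in> X" using b by (simp add: X_def)
  define Y where "Y = X.component \<beta>"
  have YX: "Y \<subseteq> X" unfolding Y_def by (rule X.component_root[OF bX])
  interpret Y: crystallographic Y
    unfolding Y_def by (rule X.component_crystallographic[OF bX])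
  have conY: "connected_roots Y" unfolding Y_def by (rule X.component_connected[OF bX])
  \<comment> \<open>Since \<open>\<omega>\<close> fixes \<open>x\<close>, it is a product of
    reflections in roots of \<open>X\<close>, so it cannot permute the components of
    \<open>X\<close>.\<close>
  have omX: "\<omega> \<in> reflection_group X"
    unfolding X_def by (rule stabilizer_generated[OF om_weyl fx])
  have omY: "\<omega> \<gamma> \<in> Y" if "\<gamma> \<in> Y" for \<gamma>
    using X.component_word[OF bX omX] that by (simp add: Y_def)
  have powY: "(\<omega> ^^ t) \<gamma> \<in> Y" if "\<gamma> \<in> Y" for \<gamma> t
    using that by (induction t) (auto intro: omY)
  \<comment> \<open>If \<open>eta\<close> vanishes on a positive root, its support avoids the affine
    orbit; but \<open>x\<close> is positive on the other simple roots and so cannot vanish on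
    it.\<close>
  have regX: "eta \<bullet> \<gamma> \<noteq> 0" if g: "\<gamma> \<in> X" for \<gamma>
  proof
    assume e: "eta \<bullet> \<gamma> = 0"
    have *: False if p: "pos \<delta>" and dx: "\<delta> \<bullet> x = 0" and e: "eta \<bullet> \<delta> = 0" for \<delta>
    proof -
      have d: "\<delta> \<in> \<Phi>" using p pos_root by blast
      have c0: "coweight a \<bullet> \<delta> = 0" if "a \<in> \<Delta>" "a \<in> orb a0" for a
        using eta_zero_coef[OF d e that] .
      have "(\<Sum>a\<in>\<Delta>. (coweight a \<bullet> \<delta>) * (x \<bullet> a)) = x \<bullet> \<delta>"
        by (subst (2) base_expand[OF root_span[OF d]]) (simp add: inner_sum_right)
      then have s: "(\<Sum>a\<in>\<Delta>. (coweight a \<bullet> \<delta>) * (x \<bullet> a)) = 0" using dx by (simp add: inner_commute)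
      have nonneg: "0 \<le> (coweight a \<bullet> \<delta>) * (x \<bullet> a)" if "a \<in> \<Delta>" for a
        using c0[OF that] pos_coef[OF p that] dom[OF that] by (cases "a \<in> orb a0") auto
      have "coweight a \<bullet> \<delta> = 0" if a: "a \<in> \<Delta>" for a
      proof -
        have "(coweight a \<bullet> \<delta>) * (x \<bullet> a) = 0"
          using s nonneg a by (subst (asm) sum_nonneg_eq_0_iff) auto
        then show ?thesis using c0[OF a] dom[OF a] by (cases "a \<in> orb a0") auto
      qed
      then show False using root_coef_nonzero[OF d] by blast
    qed
    show False
      using pos_or_neg_root[OF XP[OF g]] *[of \<gamma>] *[of "- \<gamma>"] e g by (auto simp: X_def)
  qed
  interpret Y: regular_functional Y eta
    by unfold_locales (use regX YX in \<open>auto simp: inner_commute\<close>)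
  note posY = Y.pos_roots_def
  \<comment> \<open>The representative of \<open>eta\<close> modulo \<open>m\<close> strictly
    between 0 and \<open>m\<close>. Such a representative exists since \<open>eta\<close> is
    non-zero on \<open>Y\<close> and bounded by \<open>m\<close>, and it is constant on
    orbits.\<close>
  define g where "g \<gamma> = (if 0 < eta \<bullet> \<gamma> then eta \<bullet> \<gamma> else eta \<bullet> \<gamma> + of_nat m)" for \<gamma>
  have g_orb: "g \<gamma> = g \<delta>" if d: "\<delta> \<in> Y" and c: "\<gamma> \<in> orb \<delta>" for \<gamma> \<delta>
  proof -
    have dP: "\<delta> \<in> \<Phi>" "\<gamma> \<in> \<Phi>" using d YX XP orb_root[OF _ c] by auto
    have cY: "\<gamma> \<in> Y" using c powY[OF d] by (auto simp: orb_def)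
    have range: "0 < g \<epsilon> \<and> g \<epsilon> < of_nat m" if "\<epsilon> \<in> Y" for \<epsilon>
      using eta_bound[of \<epsilon>] regX[of \<epsilon>] that YX XP by (auto simp: g_def abs_less_iff)
    obtain k :: int where k: "eta \<bullet> \<gamma> = eta \<bullet> \<delta> + of_nat m * of_int k" using eta_orb[OF dP(1) c] .
    have "\<exists>j::int. g \<gamma> - g \<delta> = of_nat m * of_int j"
      by (rule exI[of _ "k + (if 0 < eta \<bullet> \<gamma> then 0 else 1) - (if 0 < eta \<bullet> \<delta> then 0 else 1)"])
         (simp add: g_def k algebra_simps)
    then obtain j :: int where j: "g \<gamma> - g \<delta> = of_nat m * of_int j" by blast
    have "\<bar>real m * real_of_int j\<bar> < real m"
      unfolding j[symmetric] using range[OF d] range[OF cY] by auto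
    then have "real m * \<bar>real_of_int j\<bar> < real m * 1" by (simp add: abs_mult)
    then have "\<bar>real_of_int j\<bar> < 1" using order_pos by (simp only: mult_less_cancel_left_pos of_nat_0_less_iff)
    then have "j = 0" by linarith
    then show ?thesis using j by simp
  qed
  have "Y \<noteq> {}" using X.component_self by (auto simp: Y_def)
  then obtain \<theta> where th: "\<theta> \<in> Y.pos_roots"
    and max: "\<And>b. b \<in> Y.pos_roots \<Longrightarrow> b \<noteq> \<theta> \<Longrightarrow> \<exists>c\<in>Y.pos_roots. b + c \<in> Y.pos_roots"
    using Y.maximal_root_exists[OF conY] by blast
  have eta_pos: "0 < eta \<bullet> \<gamma>" if "\<gamma> \<in> Y.pos_roots" for \<gamma>
    using that by (simp add: posY inner_commute)
  have posY_Y: "\<gamma> \<in> Y" if "\<gamma> \<in> Y.pos_roots" for \<gamma> using that by (simp add: posY)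
  text \<open>The negative roots in the orbit of a simple root can only be \<open>- \<theta>\<close>: the simple roots together
    with \<open>- \<theta>\<close> are the roots on which \<open>g\<close> is indecomposable, and \<open>g\<close> is constant on orbits.\<close>
  have negative: "- b = - \<theta>"
    if al: "\<alpha> \<in> Y.simple_roots" and mem: "- b \<in> orb \<alpha>" and bp: "b \<in> Y.pos_roots" for \<alpha> b
  proof (rule ccontr)
    assume "- b \<noteq> - \<theta>"
    then obtain c where c: "c \<in> Y.pos_roots" "b + c \<in> Y.pos_roots" using max[OF bp] by auto
    have aY: "\<alpha> \<in> Y" "0 < eta \<bullet> \<alpha>" using al Y.simple_pos posY_Y eta_pos by auto
    obtain t where t: "\<alpha> = (\<omega> ^^ t) (- b)" using orb_sym[OF mem] by (auto simp: orb_def)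
    define u where "u = (\<omega> ^^ t) (- (b + c))"
    define v where "v = (\<omega> ^^ t) c"
    have bcY: "- (b + c) \<in> Y" using c(2) posY_Y Y.uminus_root by blast
    have uvY: "u \<in> Y" "v \<in> Y" unfolding u_def v_def using c(1) bcY posY_Y by (blast intro: powY)+
    have auv: "\<alpha> = u + v" unfolding t u_def v_def by (simp add: linear_add[OF pow_linear, symmetric])
    have "g u = g (- (b + c))" "g v = g c" "g \<alpha> = g (- b)"
      using g_orb[OF bcY, of u] g_orb[OF posY_Y[OF c(1)], of v] g_orb[of "- b" \<alpha>] posY_Y[OF bp]
      unfolding u_def v_def t by (auto simp: orb_def)
    then have "g \<alpha> = g u + g v"
      using eta_pos[OF bp] eta_pos[OF c(1)] eta_pos[OF c(2)] by (auto simp: g_def inner_add_right inner_diff_right)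
    moreover have "g \<alpha> = eta \<bullet> u + eta \<bullet> v" using aY by (simp add: g_def auv inner_add_right)
    \<comment> \<open>The values of \<open>g\<close> and of \<open>eta\<close> at \<open>u\<close>
      and \<open>v\<close> have the same sum, so the correction by \<open>m\<close> occurs at
      neither of them.\<close>
    ultimately have "0 < eta \<bullet> u" "0 < eta \<bullet> v"
      using order_pos by (auto simp: g_def split: if_splits)
    then have "u \<in> Y.pos_roots" "v \<in> Y.pos_roots" using uvY by (auto simp: posY inner_commute)
    then show False using al auv by (auto simp: Y.simple_roots_def)
  qed
  have avg_simple: "avg \<alpha> = - avg \<theta>" if al: "\<alpha> \<in> Y.simple_roots" for \<alpha>
  proof -
    have aY: "\<alpha> \<in> Y" using al Y.simple_pos posY_Y by auto
    have "(\<Sum>\<gamma>\<in>orb \<alpha>. eta \<bullet> \<gamma>) = eta \<bullet> (of_nat (card (orb \<alpha>)) *\<^sub>R avg \<alpha>)"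
      unfolding card_orb_avg by (rule inner_sum_right[symmetric])
    also have "\<dots> = 0" using eta_fixed[OF om_avg] by simp
    finally have s: "(\<Sum>\<gamma>\<in>orb \<alpha>. eta \<bullet> \<gamma>) = 0" .
    have "\<exists>\<gamma>\<in>orb \<alpha>. \<not> 0 < eta \<bullet> \<gamma>"
    proof (rule ccontr)
      assume "\<not> ?thesis"
      then have "0 < (\<Sum>\<gamma>\<in>orb \<alpha>. eta \<bullet> \<gamma>)" using orb_self[of \<alpha>] by (intro sum_pos) auto
      with s show False by simp
    qed
    then obtain \<gamma> where c: "\<gamma> \<in> orb \<alpha>" "\<not> 0 < eta \<bullet> \<gamma>" by blast
    then have cY: "\<gamma> \<in> Y" using powY[OF aY] by (auto simp: orb_def)
    then have "- \<gamma> \<in> Y.pos_roots"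
      using c Y.pos_or_neg[OF cY] eta_pos by blast
    then have "\<gamma> = - \<theta>" using negative[OF al, of "- \<gamma>"] c by simp
    then show ?thesis using avg_orb[OF c(1)] by (simp add: avg_uminus)
  qed
  have avg_comb: "avg \<gamma> = - (of_nat (sum n Y.simple_roots)) *\<^sub>R avg \<theta>"
    if "\<gamma> = (\<Sum>\<alpha>\<in>Y.simple_roots. of_nat (n \<alpha>) *\<^sub>R \<alpha>)" for \<gamma> and n :: "'a \<Rightarrow> nat"
  proof -
    have "avg \<gamma> = (\<Sum>\<alpha>\<in>Y.simple_roots. of_nat (n \<alpha>) *\<^sub>R avg \<alpha>)"
      unfolding that by (simp only: linear_sum[OF avg_linear] linear_cmul[OF avg_linear])
    also have "\<dots> = (\<Sum>\<alpha>\<in>Y.simple_roots. of_nat (n \<alpha>) *\<^sub>R (- avg \<theta>))"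
      by (rule sum.cong) (simp_all add: avg_simple)
    finally show ?thesis by (simp add: sum_negf scaleR_sum_left)
  qed
  obtain n :: "'a \<Rightarrow> nat" where "\<theta> = (\<Sum>\<alpha>\<in>Y.simple_roots. of_nat (n \<alpha>) *\<^sub>R \<alpha>)"
    using Y.pos_comb[OF th] by blast
  then have "avg \<theta> = - (of_nat (sum n Y.simple_roots)) *\<^sub>R avg \<theta>" by (rule avg_comb)
  \<comment> \<open>A positive multiple of \<open>avg \<theta>\<close> is 0, hence so is every
    average on \<open>Y\<close>.\<close>
  then have "(1 + of_nat (sum n Y.simple_roots)) *\<^sub>R avg \<theta> = 0"
    by (simp only: scaleR_add_left scaleR_one scaleR_minus_left eq_neg_iff_add_eq_0)
  moreover have "1 + real (sum n Y.simple_roots) \<noteq> 0"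
    using of_nat_0_le_iff[of "sum n Y.simple_roots", where 'a = real] by linarith
  ultimately have th0: "avg \<theta> = 0" by (simp only: scaleR_eq_0_iff) blast
  have "avg \<gamma> = 0" if gp: "\<gamma> \<in> Y.pos_roots" for \<gamma>
  proof -
    obtain n :: "'a \<Rightarrow> nat" where "\<gamma> = (\<Sum>\<alpha>\<in>Y.simple_roots. of_nat (n \<alpha>) *\<^sub>R \<alpha>)"
      using Y.pos_comb[OF gp] by blast
    from avg_comb[OF this] th0 show ?thesis by (simp only: scaleR_zero_right)
  qed
  moreover have "\<beta> \<in> Y" using X.component_self by (simp add: Y_def)
  ultimately show ?thesis
    using Y.pos_or_neg[of \<beta>] avg_uminus[of \<beta>] by (metis neg_equal_0_iff_equal)
qed

end

section \<open>The folded root system\<close>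

lemma crystallographic_iff_root_system: "crystallographic \<Phi> \<longleftrightarrow> root_system (span \<Phi>) \<Phi>"
  unfolding crystallographic_def root_system_def by blast

text \<open>If \<open>A\<close> is orthogonal to its complement, both are root systems in their
  spans, and these spans are orthogonal complements in \<open>E\<close>.\<close>

lemma irreducible_imp_connected:
  assumes irr: "irreducible_root_system E \<Phi>"
  shows "connected_roots \<Phi>"
  unfolding connected_roots_def
proof (intro allI impI, elim conjE, rule ccontr)
  fix A assume A: "A \<subseteq> \<Phi>" "A \<noteq> {}" and orth: "\<forall>a\<in>A. \<forall>b\<in>\<Phi> - A. a \<bullet> b = 0" and ne: "A \<noteq> \<Phi>"
  have rs: "root_system E \<Phi>" and nred: "\<not> reducible_root_system E \<Phi>"
    using irr by (auto simp: irreducible_root_system_def)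
  interpret crystallographic \<Phi>
    using rs by (auto simp: crystallographic_iff_root_system root_system_def)
  have part: "root_system (span B) B"
    if B: "B \<subseteq> \<Phi>" and o: "\<And>a b. a \<in> B \<Longrightarrow> b \<in> \<Phi> - B \<Longrightarrow> a \<bullet> b = 0" for B
    unfolding root_system_def
  proof (intro conjI ballI)
    show "finite B" using B finite_roots finite_subset by blast
    show "0 \<notin> B" using B zero_not_root by blast
    fix \<alpha> \<beta> assume ab: "\<alpha> \<in> B" "\<beta> \<in> B"
    show "coroot \<alpha> \<bullet> \<beta> \<in> \<int>" using ab B integral by blast
    show "root_reflection \<alpha> \<beta> \<in> B"
    proof (rule ccontr)
      let ?r = "root_reflection \<alpha> \<beta>"
      assume "?r \<notin> B"
      then have r: "?r \<in> \<Phi> - B" using ab B reflection_closed by blast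
      \<comment> \<open>The reflected root is a combination of \<open>\<alpha>\<close> and
        \<open>\<beta>\<close>; outside \<open>B\<close> it would be orthogonal to both and hence to
        itself.\<close>
      have "?r \<bullet> ?r = \<beta> \<bullet> ?r - (coroot \<alpha> \<bullet> \<beta>) * (\<alpha> \<bullet> ?r)"
        by (subst (1) root_reflection_def) (simp add: inner_diff_left)
      also have "\<dots> = 0" using o[OF ab(1) r] o[OF ab(2) r] by simp
      finally have "?r = 0" by (simp only: inner_eq_zero_iff)
      with r show False using zero_not_root by (metis DiffD1)
    qed
  qed simp
  let ?B = "\<Phi> - A"
  have B: "?B \<noteq> {}" "\<Phi> - ?B = A" using A ne by auto
  have spanne: "span C \<noteq> {0}" if "C \<subseteq> \<Phi>" "C \<noteq> {}" for C
    using that span_base zero_not_root by fastforce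
  have o1: "u \<bullet> v = 0" if "u \<in> span A" "v \<in> span ?B" for u v
    using orthogonal_to_span[of _ ?B u] orthogonal_to_span[of _ A] orth that
    by (metis orthogonal_commute orthogonal_def)
  have "reducible_root_system E \<Phi>"
    unfolding reducible_root_system_def
  proof (intro exI conjI)
    show "\<Phi> = A \<union> ?B" "A \<inter> ?B = {}" using A by auto
    show "E = {x + y |x y. x \<in> span A \<and> y \<in> span ?B}"
      using rs A span_Un[of A ?B] by (auto simp: root_system_def Un_absorb1)
    show "span A \<inter> span ?B = {0}"
    proof (intro equalityI subsetI)
      fix x assume "x \<in> span A \<inter> span ?B"
      then have "x \<bullet> x = 0" using o1 by blast
      then show "x \<in> {0}" by simp
    qed (simp add: span_zero)
    show "span A \<noteq> {0}" "span ?B \<noteq> {0}" using spanne[of A] spanne[of ?B] A B by blast+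
    show "root_system (span A) A" using orth A by (intro part) auto
    show "root_system (span ?B) ?B"
    proof (rule part)
      show "a \<bullet> b = 0" if "a \<in> ?B" "b \<in> \<Phi> - ?B" for a b
        using orth that B(2) inner_commute[of a b] by simp
    qed simp
  qed
  with nred show False by blast
qed

section \<open>The averaged roots and the averaged basis in the fixed space\<close>

context folding
begin

text \<open>With \<open>fold_base\<close> and \<open>fold_space\<close>, this expresses the objects
  of the theorem by \<open>avg\<close> and \<open>orb\<close>; the identification is made in
  \<open>theorem1p1\<close>.\<close>

definition fold_roots :: "'a set" where
  "fold_roots = {avg \<beta> | \<beta>. \<beta> \<in> \<Phi> \<and> avg \<beta> \<noteq> 0}"

definition fold_base :: "'a set" where
  "fold_base = {avg \<alpha> | \<alpha>. \<alpha> \<in> \<Delta> \<and> \<alpha> \<notin> orb a0}"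

definition fold_space :: "'a set" where
  "fold_space = {x \<in> span \<Delta>. \<omega> x = x}"

lemma subspace_fold_space: "subspace fold_space"
  unfolding fold_space_def
  by (rule subspaceI)
     (auto simp: span_zero span_add span_scale linear_0[OF om_linear] linear_add[OF om_linear]
       linear_cmul[OF om_linear])

lemma avg_fold_space: "x \<in> span \<Delta> \<Longrightarrow> avg x \<in> fold_space"
  by (simp add: fold_space_def avg_span om_avg)

lemma fold_space_avg: "x \<in> fold_space \<Longrightarrow> x = (\<Sum>a\<in>\<Delta>. (coweight a \<bullet> x) *\<^sub>R avg a)"
proof -
  assume x: "x \<in> fold_space"
  then have xs: "x \<in> span \<Delta>" and "\<omega> x = x" by (auto simp: fold_space_def)
  then have "x = avg x" by (simp add: avg_fixed)
  also have "\<dots> = avg (\<Sum>a\<in>\<Delta>. (coweight a \<bullet> x) *\<^sub>R a)" using base_expand[OF xs] by simp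
  also have "\<dots> = (\<Sum>a\<in>\<Delta>. (coweight a \<bullet> x) *\<^sub>R avg a)"
    by (simp only: linear_sum[OF avg_linear] linear_cmul[OF avg_linear])
  finally show ?thesis .
qed

lemma orbit_coweight_avg_self: "\<alpha> \<in> \<Delta> \<Longrightarrow> \<alpha> \<notin> orb a0 \<Longrightarrow> orbit_coweight \<alpha> \<bullet> avg \<alpha> = 1"
  using orbit_coweight_pair[of \<alpha> \<alpha>] orb_self[of \<alpha>] by (simp add: orbit_coweight_avg)

lemma fold_base_roots: "fold_base \<subseteq> fold_roots"
proof
  fix b assume "b \<in> fold_base"
  then obtain \<alpha> where al: "\<alpha> \<in> \<Delta>" "\<alpha> \<notin> orb a0" "b = avg \<alpha>" by (auto simp: fold_base_def)
  have "avg \<alpha> \<noteq> 0"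
  proof
    assume "avg \<alpha> = 0"
    with orbit_coweight_avg_self[OF al(1,2)] show False by simp
  qed
  then show "b \<in> fold_roots" using al(3) base_root[OF al(1)] unfolding fold_roots_def by blast
qed

lemma finite_fold_roots: "finite fold_roots"
proof -
  have "fold_roots \<subseteq> avg ` \<Phi>" by (auto simp: fold_roots_def)
  then show ?thesis by (rule finite_subset) simp
qed

lemma finite_fold_base: "finite fold_base"
  by (rule finite_subset[OF fold_base_roots finite_fold_roots])

lemma fold_roots_space: "fold_roots \<subseteq> fold_space"
  by (auto simp: fold_roots_def intro: avg_fold_space root_span)

text \<open>An element of the folded basis may be the average of several simple roots. By
  \<open>orbit_coweight_pair\<close> they form one orbit, so any choice has the right
  pairings.\<close>

definition fold_coweight :: "'a \<Rightarrow> 'a" where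
  "fold_coweight b = orbit_coweight (SOME \<alpha>. \<alpha> \<in> \<Delta> \<and> \<alpha> \<notin> orb a0 \<and> avg \<alpha> = b)"

lemma fold_coweight_cases:
  assumes "b \<in> fold_base"
  obtains \<alpha> where "\<alpha> \<in> \<Delta>" "\<alpha> \<notin> orb a0" "avg \<alpha> = b" "fold_coweight b = orbit_coweight \<alpha>"
proof -
  let ?P = "\<lambda>\<alpha>. \<alpha> \<in> \<Delta> \<and> \<alpha> \<notin> orb a0 \<and> avg \<alpha> = b"
  have "\<exists>\<alpha>. ?P \<alpha>" using assms by (auto simp: fold_base_def)
  then have "?P (SOME \<alpha>. ?P \<alpha>)" by (rule someI_ex)
  then show ?thesis using that unfolding fold_coweight_def by blast
qed

lemma fold_coweight_dual:
  assumes b: "b \<in> fold_base" and c: "c \<in> fold_base"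
  shows "fold_coweight b \<bullet> c = (if b = c then 1 else 0)"
proof -
  obtain \<alpha> where al: "\<alpha> \<in> \<Delta>" "\<alpha> \<notin> orb a0" "avg \<alpha> = b" "fold_coweight b = orbit_coweight \<alpha>" using fold_coweight_cases[OF b] .
  obtain \<gamma> where ga: "\<gamma> \<in> \<Delta>" "\<gamma> \<notin> orb a0" "avg \<gamma> = c" using c by (auto simp: fold_base_def)
  show ?thesis
  proof (cases "b = c")
    case True
    then show ?thesis using orbit_coweight_avg_self[OF al(1,2)] al by simp
  next
    case False
    then have "\<gamma> \<notin> orb \<alpha>" using avg_orb[of \<gamma> \<alpha>] al ga by auto
    then show ?thesis using orbit_coweight_pair[OF al(1,2), of \<gamma>] ga al False orbit_coweight_avg[of \<alpha> \<gamma>] by simp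
  qed
qed

lemma fold_coweight_fixed: "b \<in> fold_base \<Longrightarrow> \<omega> (fold_coweight b) = fold_coweight b"
  by (simp add: fold_coweight_def om_orbit_coweight)

lemma fold_coweight_int: "b \<in> fold_base \<Longrightarrow> \<beta> \<in> \<Phi> \<Longrightarrow> fold_coweight b \<bullet> avg \<beta> \<in> \<int>"
  by (elim fold_coweight_cases) (simp add: orbit_coweight_avg orbit_coweight_int)

lemma fold_coweight_sum: "b \<in> fold_base \<Longrightarrow> fold_coweight b \<bullet> (\<Sum>c\<in>fold_base. u c *\<^sub>R c) = u b"
  by (simp add: inner_sum_right fold_coweight_dual finite_fold_base if_distrib[of "(*) _"] cong: if_cong)

lemma independent_fold_base: "independent fold_base"
proof (rule independent_if_scalars_zero[OF finite_fold_base])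
  fix f b assume "(\<Sum>c\<in>fold_base. f c *\<^sub>R c) = 0" "b \<in> fold_base"
  then show "f b = 0" using fold_coweight_sum[of b f] by simp
qed

lemma avg_relation:
  "of_nat m *\<^sub>R avg a0 + (\<Sum>a\<in>{a \<in> \<Delta>. a \<notin> orb a0}. node_mark a *\<^sub>R avg a) = 0"
proof -
  have split: "D0 = orb a0 \<union> {a \<in> \<Delta>. a \<notin> orb a0}"
    using orb_D0[of a0] orb_self[of a0] by auto
  have "0 = avg (\<Sum>a\<in>D0. node_mark a *\<^sub>R a)" by (simp only: node_mark_relation avg_0)
  also have "\<dots> = (\<Sum>a\<in>D0. node_mark a *\<^sub>R avg a)"
    by (simp only: linear_sum[OF avg_linear] linear_cmul[OF avg_linear])
  also have "\<dots> = (\<Sum>a\<in>orb a0. node_mark a *\<^sub>R avg a) + (\<Sum>a\<in>{a \<in> \<Delta>. a \<notin> orb a0}. node_mark a *\<^sub>R avg a)"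
    by (subst split, rule sum.union_disjoint) auto
  also have "(\<Sum>a\<in>orb a0. node_mark a *\<^sub>R avg a) = (\<Sum>a\<in>orb a0. avg a0)"
    using node_mark_orb[of a0] avg_orb[of _ a0] by (intro sum.cong) auto
  also have "\<dots> = of_nat m *\<^sub>R avg a0" by (simp add: sum_constant_scaleR card_O0)
  finally show ?thesis by simp
qed

text \<open>The simple roots in the affine orbit have the average of \<open>a0\<close>, which
  \<open>avg_relation\<close> expresses by the folded basis.\<close>

lemma avg_in_span:
  assumes "a \<in> \<Delta>" shows "avg a \<in> span fold_base"
proof (cases "a \<in> orb a0")
  case False
  then show ?thesis using assms by (auto simp: fold_base_def intro: span_base)
next
  case True
  let ?S = "\<Sum>a\<in>{a \<in> \<Delta>. a \<notin> orb a0}. node_mark a *\<^sub>R avg a"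
  have "?S \<in> span fold_base"
    by (intro span_sum span_scale span_base) (auto simp: fold_base_def)
  then have "(- 1 / of_nat m) *\<^sub>R ?S \<in> span fold_base" by (rule span_scale)
  moreover have "(- 1 / of_nat m) *\<^sub>R ?S = avg a0"
  proof -
    have "?S = - (of_nat m *\<^sub>R avg a0)" using avg_relation by (simp add: add_eq_0_iff2)
    then show ?thesis using order_pos by simp
  qed
  ultimately show ?thesis using avg_orb[OF True] by simp
qed

lemma span_fold_base: "span fold_base = fold_space"
proof
  show "span fold_base \<subseteq> fold_space"
    using fold_base_roots fold_roots_space subspace_fold_space by (intro span_minimal) auto
  show "fold_space \<subseteq> span fold_base"
  proof
    fix x assume "x \<in> fold_space"
    then have "x = (\<Sum>a\<in>\<Delta>. (coweight a \<bullet> x) *\<^sub>R avg a)" by (rule fold_space_avg)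
    also have "\<dots> \<in> span fold_base" by (intro span_sum span_scale avg_in_span)
    finally show "x \<in> span fold_base" .
  qed
qed

lemma span_fold_roots: "span fold_roots = fold_space"
  using span_mono[OF fold_base_roots] span_fold_base
    span_minimal[OF fold_roots_space subspace_fold_space] by blast

lemma fold_base_expand:
  assumes "x \<in> fold_space" shows "x = (\<Sum>b\<in>fold_base. (fold_coweight b \<bullet> x) *\<^sub>R b)"
proof -
  obtain u where u: "x = (\<Sum>b\<in>fold_base. u b *\<^sub>R b)"
    using assms unfolding span_fold_base[symmetric] by (auto simp: span_finite[OF finite_fold_base])
  show ?thesis
    by (subst u, rule sum.cong) (simp_all add: u fold_coweight_sum)
qed

lemma fold_root_system: "root_system fold_space fold_roots"
  unfolding root_system_def
proof (intro conjI ballI)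
  show "finite fold_roots" by (rule finite_fold_roots)
  show "0 \<notin> fold_roots" by (auto simp: fold_roots_def)
  show "span fold_roots = fold_space" by (rule span_fold_roots)
  fix r s assume "r \<in> fold_roots" "s \<in> fold_roots"
  then obtain \<beta> \<nu> where b: "\<beta> \<in> \<Phi>" "avg \<beta> \<noteq> 0" "r = avg \<beta>" and n: "\<nu> \<in> \<Phi>" "avg \<nu> \<noteq> 0" "s = avg \<nu>"
    by (auto simp: fold_roots_def)
  show "coroot r \<bullet> s \<in> \<int>" using folded_integral[OF b(1,2) n(1)] b n by simp
  obtain \<nu>' where n': "\<nu>' \<in> \<Phi>" "root_reflection r s = avg \<nu>'"
    using folded_reflection[OF b(1,2) n(1)] b n by auto
  \<comment> \<open>Reflections preserve norms, so the reflected average is not 0.\<close>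
  have "avg \<nu>' \<noteq> 0"
    using n root_reflection_inner[of r s s] unfolding n'(2) by auto
  then show "root_reflection r s \<in> fold_roots" using n' by (auto simp: fold_roots_def)
qed

text \<open>With coefficients of both signs one can choose positive weights under which they cancel.
  These weights define a fixed vector that is positive on the folded basis and orthogonal to
  \<open>\<beta>\<close>, contrary to \<open>avg_zero_on_wall\<close>.\<close>

lemma fold_coef_sign:
  assumes b: "\<beta> \<in> \<Phi>"
  shows "(\<forall>b\<in>fold_base. 0 \<le> fold_coweight b \<bullet> avg \<beta>) \<or> (\<forall>b\<in>fold_base. fold_coweight b \<bullet> avg \<beta> \<le> 0)"
proof (rule ccontr)
  define k where "k b = fold_coweight b \<bullet> avg \<beta>" for b
  assume "\<not> ?thesis"
  then obtain b1 b2 where b12: "b1 \<in> fold_base" "k b1 < 0" "b2 \<in> fold_base" "0 < k b2"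
    by (auto simp: k_def not_le)
  define P where "P = (\<Sum>b\<in>fold_base. max (k b) 0)"
  define N where "N = (\<Sum>b\<in>fold_base. max (- k b) 0)"
  have "0 < P"
    unfolding P_def using b12 finite_fold_base by (intro sum_pos2[of _ b2]) auto
  moreover have "0 < N"
    unfolding N_def using b12 finite_fold_base by (intro sum_pos2[of _ b1]) auto
  ultimately have PN: "0 < P" "0 < N" by auto
  text \<open>Positive weights for which the \<open>k b\<close> cancel.\<close>
  define t where "t b = (if 0 < k b then N else if k b < 0 then P else 1)" for b
  have t_pos: "0 < t b" for b using PN by (simp add: t_def)
  define x where "x = (\<Sum>b\<in>fold_base. t b *\<^sub>R fold_coweight b)"
  have fx: "\<omega> x = x"
    unfolding x_def linear_sum[OF om_linear] linear_cmul[OF om_linear]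
    by (rule sum.cong) (simp_all add: fold_coweight_fixed)
  have x_avg: "x \<bullet> \<gamma> = x \<bullet> avg \<gamma>" for \<gamma>
    using avg_inner_fixed[OF fx, of \<gamma>] by (simp add: inner_commute)
  have dom: "0 < x \<bullet> a" if a: "a \<in> \<Delta>" "a \<notin> orb a0" for a
  proof -
    have ab: "avg a \<in> fold_base" using a by (auto simp: fold_base_def)
    have "x \<bullet> avg a = (\<Sum>b\<in>fold_base. t b * (if b = avg a then 1 else 0))"
      unfolding x_def inner_sum_left using ab by (intro sum.cong) (simp_all add: fold_coweight_dual)
    also have "\<dots> = t (avg a)"
      using ab finite_fold_base by (simp add: if_distrib[of "(*) _"] cong: if_cong)
    finally show ?thesis using t_pos x_avg by simp
  qed
  have "x \<bullet> avg \<beta> = (\<Sum>b\<in>fold_base. t b * k b)"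
    by (simp add: x_def inner_sum_left k_def)
  also have "\<dots> = (\<Sum>b\<in>fold_base. N * max (k b) 0 - P * max (- k b) 0)"
    by (rule sum.cong) (auto simp: t_def)
  also have "\<dots> = N * P - P * N"
    unfolding P_def N_def sum_subtractf sum_distrib_left ..
  finally have "\<beta> \<bullet> x = 0" using x_avg[of \<beta>] by (simp add: inner_commute)
  with dom have "avg \<beta> = 0" by (intro avg_zero_on_wall[OF fx _ b])
  then show False using b12 by (simp add: k_def)
qed

lemma fold_root_basis: "root_basis fold_space fold_roots fold_base"
  unfolding root_basis_def
proof (intro conjI ballI)
  show "fold_base \<subseteq> fold_roots" by (rule fold_base_roots)
  show "independent fold_base" by (rule independent_fold_base)
  show "span fold_base = fold_space" by (rule span_fold_base)
next
  fix r assume r: "r \<in> fold_roots"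
  then obtain \<beta> where b: "\<beta> \<in> \<Phi>" "r = avg \<beta>" by (auto simp: fold_roots_def)
  define c where "c d = \<lfloor>fold_coweight d \<bullet> r\<rfloor>" for d
  have c: "of_int (c d) = fold_coweight d \<bullet> r" if "d \<in> fold_base" for d
    using fold_coweight_int[OF that b(1)] by (auto simp: c_def b(2) elim!: Ints_cases)
  have "r = (\<Sum>d\<in>fold_base. (fold_coweight d \<bullet> r) *\<^sub>R d)"
    using r fold_roots_space by (intro fold_base_expand) auto
  also have "\<dots> = (\<Sum>d\<in>fold_base. of_int (c d) *\<^sub>R d)"
    by (rule sum.cong) (simp_all add: c)
  finally have "r = (\<Sum>d\<in>fold_base. of_int (c d) *\<^sub>R d)" .
  moreover have "(\<forall>d\<in>fold_base. 0 \<le> c d) \<or> (\<forall>d\<in>fold_base. c d \<le> 0)"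
  proof -
    have "0 \<le> c d \<longleftrightarrow> 0 \<le> fold_coweight d \<bullet> r" "c d \<le> 0 \<longleftrightarrow> fold_coweight d \<bullet> r \<le> 0" if "d \<in> fold_base" for d
      unfolding c[OF that, symmetric] by simp_all
    then show ?thesis using fold_coef_sign[OF b(1)] b(2) by simp
  qed
  ultimately show "\<exists>c :: 'a \<Rightarrow> int. r = (\<Sum>\<alpha>\<in>fold_base. of_int (c \<alpha>) *\<^sub>R \<alpha>) \<and>
      ((\<forall>\<alpha>\<in>fold_base. 0 \<le> c \<alpha>) \<or> (\<forall>\<alpha>\<in>fold_base. c \<alpha> \<le> 0))"
    by blast
next
  fix d assume d: "d \<in> fold_base"
  have "(1/2) *\<^sub>R d \<notin> fold_roots"
  proof
    assume "(1/2) *\<^sub>R d \<in> fold_roots"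
    then obtain \<beta> where b: "\<beta> \<in> \<Phi>" "(1/2) *\<^sub>R d = avg \<beta>" by (auto simp: fold_roots_def)
    \<comment> \<open>Integrality of the coefficients excludes the value 1/2.\<close>
    then have "fold_coweight d \<bullet> ((1/2) *\<^sub>R d) \<in> \<int>" using fold_coweight_int[OF d b(1)] by simp
    then obtain i :: int where "1/2 = real_of_int i" using fold_coweight_dual[OF d d] by (auto elim!: Ints_cases)
    then have "real_of_int (2 * i) = 1" by simp
    then have "2 * i = 1" by linarith
    then show False by presburger
  qed
  then show "indivisible_root fold_roots d"
    using d fold_base_roots by (auto simp: indivisible_root_def)
qed

text \<open>In \<open>avg_relation\<close> all coefficients are positive, so no element of the folded basis can lie in
  the part that does not contain the average of the affine root.\<close>

lemma fold_irreducible_step: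
  assumes roots: "fold_roots = P \<union> Q"
    and disj: "span P \<inter> span Q = {0}" and a0P: "avg a0 \<in> span P"
  shows "span Q = {0}"
proof -
  define S where "S R = (\<Sum>a\<in>{a \<in> \<Delta>. a \<notin> orb a0 \<and> avg a \<in> R}. node_mark a *\<^sub>R avg a)" for R
  have S_span: "S R \<in> span R" for R
    unfolding S_def by (intro span_sum span_scale span_base) auto
  have PQ: "avg a \<in> P \<union> Q" if "a \<in> \<Delta>" "a \<notin> orb a0" for a
    using that fold_base_roots roots by (auto simp: fold_base_def)
  have notboth: "\<not> (r \<in> P \<and> r \<in> Q)" for r
  proof
    assume r: "r \<in> P \<and> r \<in> Q"
    then have "r \<in> span P \<inter> span Q" using span_base by blast
    then have "r = 0" using disj by simp
    moreover have "r \<in> fold_roots" using r roots by blast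
    ultimately show False by (auto simp: fold_roots_def)
  qed
  have "(\<Sum>a\<in>{a \<in> \<Delta>. a \<notin> orb a0}. node_mark a *\<^sub>R avg a) = S P + S Q"
  proof -
    have "{a \<in> \<Delta>. a \<notin> orb a0}
        = {a \<in> \<Delta>. a \<notin> orb a0 \<and> avg a \<in> P} \<union> {a \<in> \<Delta>. a \<notin> orb a0 \<and> avg a \<in> Q}"
      using PQ by auto
    then show ?thesis
      unfolding S_def using notboth by (simp only:) (intro sum.union_disjoint, auto)
  qed
  \<comment> \<open>The relation expresses \<open>S Q\<close> by vectors of \<open>span P\<close>,
    so it lies in both spans.\<close>
  then have "S Q = - (of_nat m *\<^sub>R avg a0) - S P"
    using avg_relation by (simp only: eq_diff_eq eq_neg_iff_add_eq_0 ac_simps)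
  also have "\<dots> \<in> span P" using a0P S_span by (intro span_diff span_neg span_scale)
  finally have SQ: "S Q = 0" using S_span[of Q] disj by blast
  have "avg a \<notin> Q" if a: "a \<in> \<Delta>" "a \<notin> orb a0" for a
  proof
    assume q: "avg a \<in> Q"
    have ab: "avg a \<in> fold_base" using a by (auto simp: fold_base_def)
    \<comment> \<open>Nodes with the same average as \<open>a\<close> contribute their positive
      marks and all others 0, so a single such \<open>a\<close> makes \<open>S Q\<close>
      non-zero.\<close>
    have "fold_coweight (avg a) \<bullet> S Q
        = (\<Sum>c\<in>{c \<in> \<Delta>. c \<notin> orb a0 \<and> avg c \<in> Q}. node_mark c * (if avg a = avg c then 1 else 0))"
      unfolding S_def inner_sum_right
    proof (rule sum.cong)
      fix c assume "c \<in> {c \<in> \<Delta>. c \<notin> orb a0 \<and> avg c \<in> Q}"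
      then have "avg c \<in> fold_base" by (auto simp: fold_base_def)
      then show "fold_coweight (avg a) \<bullet> (node_mark c *\<^sub>R avg c) = node_mark c * (if avg a = avg c then 1 else 0)"
        using fold_coweight_dual[OF ab] by simp
    qed simp
    also have "\<dots> > 0"
    proof (rule sum_pos2[of _ a])
      show "0 < node_mark a * (if avg a = avg a then 1 else 0)" using node_mark_ge1[of a] a by simp
      show "0 \<le> node_mark c * (if avg a = avg c then 1 else 0)"
        if "c \<in> {c \<in> \<Delta>. c \<notin> orb a0 \<and> avg c \<in> Q}" for c
        using node_mark_ge1[of c] that by simp
    qed (use a q in auto)
    finally show False using SQ by simp
  qed
  then have "fold_base \<subseteq> P" using PQ by (auto simp: fold_base_def)
  then have "fold_space \<subseteq> span P" using span_mono span_fold_base by blast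
  moreover have "span Q \<subseteq> fold_space"
    using roots span_fold_roots span_mono[of Q fold_roots] by blast
  ultimately show "span Q = {0}" using disj span_zero by blast
qed

text \<open>The average of the affine root is 0 or an averaged root, so it lies in the span of one
  part, and the other part then spans 0.\<close>

lemma fold_irreducible: "irreducible_root_system fold_space fold_roots"
  unfolding irreducible_root_system_def
proof (intro conjI notI fold_root_system)
  assume "reducible_root_system fold_space fold_roots"
  then obtain P Q E1 E2 where PQ: "fold_roots = P \<union> Q" "E1 \<inter> E2 = {0}" "E1 \<noteq> {0}" "E2 \<noteq> {0}"
      "span P = E1" "span Q = E2"
    unfolding reducible_root_system_def root_system_def by blast
  have QP: "fold_roots = Q \<union> P" "span Q \<inter> span P = {0}" using PQ by auto
  have "avg a0 \<in> span P \<or> avg a0 \<in> span Q"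
  proof (cases "avg a0 = 0")
    case True
    then show ?thesis by (simp add: span_zero)
  next
    case False
    then have "avg a0 \<in> P \<union> Q"
      using highest_root unfolding PQ(1)[symmetric] fold_roots_def by (auto intro!: exI[of _ a0])
    then show ?thesis using span_base by blast
  qed
  then show False
    using fold_irreducible_step[OF PQ(1)] fold_irreducible_step[OF QP] PQ by auto
qed

end

section \<open>The empty root system, and the passage to the given definitions\<close>

lemma empty_folding:
  assumes "\<omega> \<in> Omega {} ({} :: 'a::euclidean_space set)"
  shows "irreducible_root_system (fixed_space (span {}) \<omega>) (folded_roots {} \<omega>) \<and>
         root_basis (fixed_space (span {}) \<omega>) (folded_roots {} \<omega>) (folded_basis {} {} \<omega>)"
proof -
  have G: "reflection_group ({} :: 'a set) = {id}" by (simp add: reflection_group_eq)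
  have "longest_element ({} :: 'a set) = id"
  proof -
    have "is_arg_max (reflection_length ({} :: 'a set)) (\<lambda>w. w \<in> {id}) (longest_element {})"
      unfolding longest_element_def arg_max_on_def arg_max_def G
      by (rule someI[of _ id]) (simp add: is_arg_max_def)
    then show ?thesis by (simp add: is_arg_max_def)
  qed
  \<comment> \<open>Whatever the value of \<open>highest_root\<close>, both factors are the longest
    element of the trivial group.\<close>
  then have "\<omega> = id" using assms by (auto simp: Omega_def)
  then have sp: "fixed_space (span {}) \<omega> = {0}" by (auto simp: fixed_space_def)
  have fr: "folded_roots {} \<omega> = {}" "folded_basis {} {} \<omega> = {}"
    by (auto simp: folded_roots_def folded_basis_def)
  have "\<not> reducible_root_system {0} ({} :: 'a set)"
  proof
    assume "reducible_root_system {0} ({} :: 'a set)"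
    then obtain E1 E2 :: "'a set" where E: "{0} = {x + y | x y. x \<in> E1 \<and> y \<in> E2}"
        "E1 \<inter> E2 = {0}" "E1 \<noteq> {0}"
      unfolding reducible_root_system_def by blast
    have "x = 0" if "x \<in> E1" for x
    proof -
      have "x + 0 \<in> {x + y | x y. x \<in> E1 \<and> y \<in> E2}" using that E(2) by blast
      then show ?thesis by (simp add: E(1)[symmetric])
    qed
    then show False using E(2,3) by auto
  qed
  then show ?thesis
    unfolding sp fr by (auto simp: irreducible_root_system_def root_system_def root_basis_def independent_empty)
qed

text \<open>Two powers coincide because the group is finite; cancelling gives a positive
  exponent.\<close>

lemma (in based_roots) weyl_finite_order:
  assumes w: "w \<in> reflection_group \<Delta>"
  obtains n where "0 < n" "w ^^ n = id"
proof -
  have "\<not> inj (\<lambda>n. w ^^ n)"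
  proof
    assume "inj (\<lambda>n. w ^^ n)"
    moreover have "range (\<lambda>n. w ^^ n) \<subseteq> reflection_group \<Delta>"
      using reflection_group_funpow[OF w] by auto
    ultimately show False
      using finite_weyl finite_subset finite_imageD infinite_UNIV_nat by blast
  qed
  then obtain i j where ij: "i < j" "w ^^ i = w ^^ j"
    by (metis injI linorder_neqE_nat)
  have "bij (w ^^ i)" using reflection_group_bij[OF reflection_group_funpow[OF w]] .
  moreover have "(w ^^ i) ((w ^^ (j - i)) x) = (w ^^ i) x" for x
    using ij by (metis comp_apply funpow_add le_add_diff_inverse less_imp_le_nat)
  ultimately have "w ^^ (j - i) = id" by (auto simp: fun_eq_iff bij_def dest: injD)
  then show ?thesis using that[of "j - i"] ij by simp
qed

theorem theorem1p1:
  fixes E \<Phi> \<Delta> :: "'a::euclidean_space set" and \<omega> :: "'a \<Rightarrow> 'a"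
  assumes "irreducible_root_system E \<Phi>"
    and "reduced_roots \<Phi>"
    and "root_basis E \<Phi> \<Delta>"
    and "\<omega> \<in> Omega \<Phi> \<Delta>"
  shows "irreducible_root_system (fixed_space E \<omega>) (folded_roots \<Phi> \<omega>) \<and>
         root_basis (fixed_space E \<omega>) (folded_roots \<Phi> \<omega>) (folded_basis \<Phi> \<Delta> \<omega>)"
proof (cases "\<Phi> = {}")
  case True
  then have "\<Delta> = {}" "E = span {}"
    using assms by (auto simp: root_basis_def irreducible_root_system_def root_system_def)
  then show ?thesis using empty_folding assms(4) True by simp
next
  case False
  have ind: "independent \<Delta>" and span: "span \<Delta> = E"
    using assms(3) by (auto simp: root_basis_def)
  obtain d where d: "\<And>b. b \<in> \<Delta> \<Longrightarrow> d b \<in> span \<Delta>"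
    "\<And>b c. b \<in> \<Delta> \<Longrightarrow> c \<in> \<Delta> \<Longrightarrow> d b \<bullet> c = (if b = c then 1 else 0)"
    using dual_basis_exists[OF ind] by blast
  interpret crystallographic \<Phi>
    using assms(1) by (auto simp: crystallographic_iff_root_system root_system_def irreducible_root_system_def)
  interpret based_roots \<Phi> \<Delta> d
  proof
    show "connected_roots \<Phi>" using irreducible_imp_connected[OF assms(1)] .
    show "(1/2) *\<^sub>R \<alpha> \<notin> \<Phi>" if "\<alpha> \<in> \<Phi>" for \<alpha>
      using assms(2) that by (auto simp: reduced_roots_def indivisible_root_def)
  qed (use False assms(3) d in \<open>auto simp: root_basis_def\<close>)
  note om = Omega_permutes[OF assms(4) ind]
  have bij: "bij \<omega>" using reflection_group_bij[OF om(1)] .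
  interpret G: group "perm_group :: ('a \<Rightarrow> 'a) monoid" by (rule group_BijGroup)
  have carr: "\<omega> \<in> carrier perm_group" using bij by (simp add: carrier_perm_group)
  let ?m = "G.ord \<omega>"
  have pow_id: "\<omega> ^^ n = id \<longleftrightarrow> ?m dvd n" for n
    using G.pow_eq_id[OF carr, of n] by (simp add: pow_perm_group[OF bij] one_perm_group)
  have "0 < ?m"
    using weyl_finite_order[OF om(1)] pow_id by (metis dvd_0_left_iff gr0I less_numeral_extra(3))
  then have iso: "isometry_of_finite_order \<omega> ?m"
    using reflection_group_linear[OF om(1)] reflection_group_inner[OF om(1)] pow_id
    by (intro isometry_of_finite_order.intro) auto
  interpret folding \<Phi> \<Delta> d \<omega> ?m
    using om pow_id by (intro folding.intro folding_axioms.intro iso based_roots_axioms) auto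
  \<comment> \<open>The exponents run from 1 to the order in one sum and from 0 in the other; both
    go once around the cycle.\<close>
  have average: "orbit_average \<omega> = avg"
  proof
    fix x
    have "(\<Sum>t=1..?m. (\<omega> ^^ t) x) = (\<Sum>t<?m. (\<omega> ^^ Suc t) x)"
      by (rule sum.reindex_bij_witness[of _ Suc "\<lambda>t. t - 1"]) auto
    then show "orbit_average \<omega> x = avg x"
      unfolding orbit_average_def avg_def Let_def pow_perm_group[OF bij] sum_pow_Suc by simp
  qed
  \<comment> \<open>The definition has integer exponents, \<open>orb\<close> natural ones. A power
    with exponent \<open>- k\<close> that maps \<open>\<alpha>\<close> to the affine root is read
    backwards as \<open>\<alpha> = (\<omega> ^^ k) a0\<close>.\<close>
  have never: "(\<forall>t::int. (\<omega> [^]\<^bsub>perm_group\<^esub> t) \<alpha> \<noteq> affine_root \<Phi> \<Delta>) \<longleftrightarrow> \<alpha> \<notin> orb a0" for \<alpha>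
  proof
    assume n: "\<forall>t::int. (\<omega> [^]\<^bsub>perm_group\<^esub> t) \<alpha> \<noteq> affine_root \<Phi> \<Delta>"
    show "\<alpha> \<notin> orb a0"
    proof
      assume "\<alpha> \<in> orb a0"
      then obtain t where "a0 = (\<omega> ^^ t) \<alpha>" using orb_sym by (auto simp: orb_def)
      then show False
        using n[rule_format, of "int t"] by (simp add: int_pow_int pow_perm_group[OF bij] affine_root_def)
    qed
  next
    assume n: "\<alpha> \<notin> orb a0"
    show "\<forall>t::int. (\<omega> [^]\<^bsub>perm_group\<^esub> t) \<alpha> \<noteq> affine_root \<Phi> \<Delta>"
    proof (intro allI notI)
      fix t :: int assume t: "(\<omega> [^]\<^bsub>perm_group\<^esub> t) \<alpha> = affine_root \<Phi> \<Delta>"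
      show False
      proof (cases t rule: int_cases2)
        case (nonneg k)
        then have "a0 = (\<omega> ^^ k) \<alpha>"
          using t by (simp add: int_pow_int pow_perm_group[OF bij] affine_root_def)
        then have "a0 \<in> orb \<alpha>" unfolding orb_def by (rule range_eqI)
        then show False using n orb_sym by blast
      next
        case (nonpos k)
        then have "\<omega> [^]\<^bsub>perm_group\<^esub> t = inv_into UNIV (\<omega> ^^ k)"
          using carr by (simp add: G.int_pow_neg_int pow_perm_group[OF bij] inv_perm_group pow_bij)
        then have "\<alpha> = (\<omega> ^^ k) a0"
          using t pow_bij[of k] by (auto simp: affine_root_def bij_def surj_f_inv_f inv_f_f dest: surj_f_inv_f[of _ \<alpha>])
        then show False using n by (auto simp: orb_def)
      qed
    qed
  qed
  have "fixed_space E \<omega> = fold_space" by (simp add: fixed_space_def fold_space_def span)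
  moreover have "folded_roots \<Phi> \<omega> = fold_roots"
    by (simp add: folded_roots_def fold_roots_def average)
  moreover have "folded_basis \<Phi> \<Delta> \<omega> = fold_base"
    unfolding folded_basis_def fold_base_def average never by simp
  ultimately show ?thesis using fold_irreducible fold_root_basis by simp
qed

end
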